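(* Let $\mathcal{G}=(X,Y,A,B,\lambda)$ be an imitation game. The following assertions are equivalent: (1) $\mathcal{G}$ has a perfect quantum commuting strategy, i.e. $\mathcal{C}_{\rm qc}(\mathcal{G})\neq\emptyset$; (2) the C*-algebra of the game $C^*(\mathcal{G})$ is nonzero, and it has a tracial state.
   Context: $X,Y,A,B$ are finite non-empty sets. A non-signalling game is a tuple $\mathcal{G}=(X,Y,A,B,\lambda)$ with $\lambda:X\times Y\times A\times B\to\{0,1\}$. It is an imitation game if: (i) for every $x\in X$ and $a,a'\in A$ with $a\ne a'$ there is $y\in Y$ with $\sum_{b\in B}\lambda(x,y,a,b)\lambda(x,y,a',b)=0$; and (ii) for every $y\in Y$ and $b,b'\in B$ with $b\neq b'$ there is $x\in X$ with $\sum_{a\in A}\lambda(x,y,a,b)\lambda(x,y,a,b')=0$. The game C*-algebra $C^*(\mathcal{G})$ is the universal unital C*-algebra generated by projections $(p_{x,a})_{x\in X,a\in A}$ and $(q_{y,b})_{y\in Y,b\in B}$ satisfying $\sum_{a}p_{x,a}=1$ for every $x$, $\sum_{b}q_{y,b}=1$ for every $y$, and $p_{x,a}q_{y,b}=0$ whenever $\lambda(x,y,a,b)=0$. The zero C*-algebra is regarded as a unital C*-algebra, so $C^*(\mathcal{G})=\{0\}$ is possible. A PVM is a finite tuple of projections on a Hilbert space summing to the identity. $\mathcal{C}_{\rm qc}$ is the set of families $p=\{p(a,b|x,y)\}$ of the form $p(a,b|x,y)=\langle\xi|P_{x,a}Q_{y,b}|\xi\rangle$ with $\xi$ a unit vector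 in a Hilbert space $\mathcal{H}$, $(P_{x,a})_{a\in A}$, $(Q_{y,b})_{b\in B}$ PVMs on $\mathcal{H}$ for all $x,y$, and $P_{x,a}Q_{y,b}=Q_{y,b}P_{x,a}$ for all $x,y,a,b$. $\mathcal{C}_{\rm qc}(\mathcal{G})=\{p\in\mathcal{C}_{\rm qc}:\lambda(x,y,a,b)=0\Rightarrow p(a,b|x,y)=0\}$ is the set of perfect quantum commuting strategies of $\mathcal{G}$. *)

theory Defs
  imports Complex_Main "HOL-Library.Poly_Mapping" "HOL-Algebra.Module"
begin

text \<open>
  The finite non-empty sets $X, Y, A, B$ are finite types. The rule function
  $\lambda : X \times Y \times A \times B \to \{0,1\}$ is a Boolean predicate; \<open>of_bool\<close> turns
  it back into a number.
\<close>

definition imitation_game ::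
  "('x::finite \<Rightarrow> 'y::finite \<Rightarrow> 'a::finite \<Rightarrow> 'b::finite \<Rightarrow> bool) \<Rightarrow> bool" where
  "imitation_game lam \<longleftrightarrow>
     (\<forall>x a a'. a \<noteq> a' \<longrightarrow>
        (\<exists>y. (\<Sum>b\<in>UNIV. of_bool (lam x y a b) * of_bool (lam x y a' b)) = (0::nat))) \<and>
     (\<forall>y b b'. b \<noteq> b' \<longrightarrow>
        (\<exists>x. (\<Sum>a\<in>UNIV. of_bool (lam x y a b) * of_bool (lam x y a b')) = (0::nat)))"

definition complex_ring :: "complex ring" where
  "complex_ring = \<lparr>carrier = UNIV, mult = (*), one = 1, zero = 0, add = (+)\<rparr>"


section \<open>Quantum commuting strategies\<close>

text \<open>
  As usual for modules in HOL-Algebra, the record inherits the (irrelevant) ring fields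
  \<open>mult\<close> and \<open>one\<close>. Inner products are linear in the second argument.
\<close>

record 'v inner_module = "(complex, 'v) module" +
  cinner :: "'v \<Rightarrow> 'v \<Rightarrow> complex"

definition hnorm :: "('v, 'm) inner_module_scheme \<Rightarrow> 'v \<Rightarrow> real" where
  "hnorm H v = sqrt (Re (cinner H v v))"

locale complex_hilbert_space = module complex_ring H
  for H :: "('v, 'm) inner_module_scheme" (structure) +
  assumes cinner_add: "\<lbrakk>u \<in> carrier H; v \<in> carrier H; w \<in> carrier H\<rbrakk> \<Longrightarrow>
      cinner H u (v \<oplus> w) = cinner H u v + cinner H u w"
    and cinner_smult: "\<lbrakk>u \<in> carrier H; v \<in> carrier H\<rbrakk> \<Longrightarrow>
      cinner H u (c \<odot> v) = c * cinner H u v"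
    and cinner_commute: "\<lbrakk>u \<in> carrier H; v \<in> carrier H\<rbrakk> \<Longrightarrow>
      cinner H u v = cnj (cinner H v u)"
    and cinner_nonneg: "v \<in> carrier H \<Longrightarrow> 0 \<le> Re (cinner H v v)"
    and cinner_definite: "\<lbrakk>v \<in> carrier H; cinner H v v = 0\<rbrakk> \<Longrightarrow> v = \<zero>"
    and complete: "\<lbrakk>\<And>n. s n \<in> carrier H;
        \<forall>e>0. \<exists>N. \<forall>m\<ge>N. \<forall>n\<ge>N. hnorm H (s m \<ominus> s n) < e\<rbrakk> \<Longrightarrow>
      \<exists>v\<in>carrier H. (\<lambda>n. hnorm H (s n \<ominus> v)) \<longlonglongrightarrow> 0"

definition bounded_operator :: "('v, 'm) inner_module_scheme \<Rightarrow> ('v \<Rightarrow> 'v) \<Rightarrow> bool" where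
  "bounded_operator H T \<longleftrightarrow>
     (\<forall>v\<in>carrier H. T v \<in> carrier H) \<and>
     (\<forall>u\<in>carrier H. \<forall>v\<in>carrier H. T (u \<oplus>\<^bsub>H\<^esub> v) = T u \<oplus>\<^bsub>H\<^esub> T v) \<and>
     (\<forall>c. \<forall>v\<in>carrier H. T (c \<odot>\<^bsub>H\<^esub> v) = c \<odot>\<^bsub>H\<^esub> T v) \<and>
     (\<exists>K. \<forall>v\<in>carrier H. hnorm H (T v) \<le> K * hnorm H v)"

definition projection :: "('v, 'm) inner_module_scheme \<Rightarrow> ('v \<Rightarrow> 'v) \<Rightarrow> bool" where
  "projection H T \<longleftrightarrow> bounded_operator H T \<and>
     (\<forall>v\<in>carrier H. T (T v) = T v) \<and>
     (\<forall>u\<in>carrier H. \<forall>v\<in>carrier H. cinner H (T u) v = cinner H u (T v))"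

definition PVM :: "('v, 'm) inner_module_scheme \<Rightarrow> ('i::finite \<Rightarrow> 'v \<Rightarrow> 'v) \<Rightarrow> bool" where
  "PVM H E \<longleftrightarrow> (\<forall>i. projection H (E i)) \<and>
     (\<forall>v\<in>carrier H. (\<Oplus>\<^bsub>H\<^esub>i\<in>UNIV. E i v) = v)"

text \<open>
  Families $p(a,b|x,y)$ are written \<open>p a b x y\<close>. HOL cannot quantify over all Hilbert spaces
  inside a formula, so the set of correlations is indexed by the type \<open>'v\<close> in which the
  vectors of the Hilbert spaces live; the carrier of a Hilbert space is an arbitrary subset of
  that type. For \<open>'v = 'h + (nat \<Rightarrow> complex)\<close> with a free type variable \<open>'h\<close>, a statement
  covers Hilbert spaces on every type, while the second summand guarantees that all separable
  Hilbert spaces occur for every choice of \<open>'h\<close>.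
\<close>

definition qc_correlations ::
  "'v itself \<Rightarrow> ('a::finite \<Rightarrow> 'b::finite \<Rightarrow> 'x::finite \<Rightarrow> 'y::finite \<Rightarrow> real) set" where
  "qc_correlations _ = {p. \<exists>(H :: 'v inner_module) \<xi> P Q.
     complex_hilbert_space H \<and> \<xi> \<in> carrier H \<and> hnorm H \<xi> = 1 \<and>
     (\<forall>x. PVM H (P x)) \<and> (\<forall>y. PVM H (Q y)) \<and>
     (\<forall>x y a b. \<forall>v\<in>carrier H. P x a (Q y b v) = Q y b (P x a v)) \<and>
     (\<forall>a b x y. complex_of_real (p a b x y) = cinner H \<xi> (P x a (Q y b \<xi>)))}"

definition perfect_qc_strategies ::
  "'v itself \<Rightarrow> ('x::finite \<Rightarrow> 'y::finite \<Rightarrow> 'a::finite \<Rightarrow> 'b::finite \<Rightarrow> bool) \<Rightarrow>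
   ('a \<Rightarrow> 'b \<Rightarrow> 'x \<Rightarrow> 'y \<Rightarrow> real) set" where
  "perfect_qc_strategies V lam =
     {p \<in> qc_correlations V. \<forall>x y a b. \<not> lam x y a b \<longrightarrow> p a b x y = 0}"


section \<open>The free unital *-algebra on self-adjoint generators\<close>

datatype ('x, 'y, 'a, 'b) generator = GenP 'x 'a | GenQ 'y 'b

datatype 'g nc_word = Word "'g list"

fun rev_word :: "'g nc_word \<Rightarrow> 'g nc_word" where
  "rev_word (Word w) = Word (rev w)"

text \<open>Words form a monoid under concatenation, written additively as \<open>Poly_Mapping\<close> requires.\<close>

instantiation nc_word :: (type) monoid_add
begin

definition zero_nc_word :: "'a nc_word" where "0 = Word []"

fun plus_nc_word :: "'a nc_word \<Rightarrow> 'a nc_word \<Rightarrow> 'a nc_word" where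
  "Word v + Word w = Word (v @ w)"

instance
proof
  fix u v w :: "'a nc_word"
  show "u + v + w = u + (v + w)" by (cases u; cases v; cases w) simp
  show "0 + u = u" "u + 0 = u" by (cases u; simp add: zero_nc_word_def)+
qed

end

text \<open>
  Finitely supported complex functions on words with the convolution product are the
  noncommutative polynomials.
\<close>

type_synonym 'g ncpoly = "'g nc_word \<Rightarrow>\<^sub>0 complex"

definition gen :: "'g \<Rightarrow> 'g ncpoly" where
  "gen g = Poly_Mapping.single (Word [g]) 1"

definition nc_smult :: "complex \<Rightarrow> 'g ncpoly \<Rightarrow> 'g ncpoly" where
  "nc_smult c f = Poly_Mapping.map ((*) c) f"

definition nc_star :: "'g ncpoly \<Rightarrow> 'g ncpoly" where
  "nc_star f = Poly_Mapping.map_key rev_word (Poly_Mapping.map cnj f)"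

definition cstar_seminorm :: "('g ncpoly \<Rightarrow> real) \<Rightarrow> bool" where
  "cstar_seminorm s \<longleftrightarrow>
     (\<forall>f g. s (f + g) \<le> s f + s g) \<and>
     (\<forall>c f. s (nc_smult c f) = cmod c * s f) \<and>
     (\<forall>f g. s (f * g) \<le> s f * s g) \<and>
     (\<forall>f. s (nc_star f * f) = (s f)\<^sup>2)"


section \<open>The C*-algebra of a game\<close>

abbreviation polyP :: "'x \<Rightarrow> 'a \<Rightarrow> ('x, 'y, 'a, 'b) generator ncpoly" where
  "polyP x a \<equiv> gen (GenP x a)"

abbreviation polyQ :: "'y \<Rightarrow> 'b \<Rightarrow> ('x, 'y, 'a, 'b) generator ncpoly" where
  "polyQ y b \<equiv> gen (GenQ y b)"

text \<open>
  C*-seminorms that annihilate the defining relations of the game (self-adjointness of the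
  generators is built into \<open>nc_star\<close>). They are exactly the functions
  \<open>f \<mapsto> \<parallel>\<pi> f\<parallel>\<close> for unital *-homomorphisms \<open>\<pi>\<close> from the free *-algebra to a unital
  C*-algebra in which the relations hold, the zero algebra giving the seminorm 0. Their supremum is again one of them (proved at the end),
  so its separated completion is the universal unital C*-algebra for these relations.
\<close>

definition game_seminorms ::
  "('x::finite \<Rightarrow> 'y::finite \<Rightarrow> 'a::finite \<Rightarrow> 'b::finite \<Rightarrow> bool) \<Rightarrow>
   (('x, 'y, 'a, 'b) generator ncpoly \<Rightarrow> real) set" where
  "game_seminorms lam = {s. cstar_seminorm s \<and>
     (\<forall>x a. s (polyP x a * polyP x a - polyP x a) = 0) \<and>
     (\<forall>y b. s (polyQ y b * polyQ y b - polyQ y b) = 0) \<and>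
     (\<forall>x. s ((\<Sum>a\<in>UNIV. polyP x a) - 1) = 0) \<and>
     (\<forall>y. s ((\<Sum>b\<in>UNIV. polyQ y b) - 1) = 0) \<and>
     (\<forall>x y a b. \<not> lam x y a b \<longrightarrow> s (polyP x a * polyQ y b) = 0)}"

definition game_norm ::
  "('x::finite \<Rightarrow> 'y::finite \<Rightarrow> 'a::finite \<Rightarrow> 'b::finite \<Rightarrow> bool) \<Rightarrow>
   ('x, 'y, 'a, 'b) generator ncpoly \<Rightarrow> real" where
  "game_norm lam f = (SUP s\<in>game_seminorms lam. s f)"

definition game_Cauchy ::
  "('x::finite \<Rightarrow> 'y::finite \<Rightarrow> 'a::finite \<Rightarrow> 'b::finite \<Rightarrow> bool) \<Rightarrow>
   (nat \<Rightarrow> ('x, 'y, 'a, 'b) generator ncpoly) \<Rightarrow> bool" where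
  "game_Cauchy lam u \<longleftrightarrow>
     (\<forall>e>0. \<exists>N. \<forall>m\<ge>N. \<forall>n\<ge>N. game_norm lam (u m - u n) < e)"

definition game_rel ::
  "('x::finite \<Rightarrow> 'y::finite \<Rightarrow> 'a::finite \<Rightarrow> 'b::finite \<Rightarrow> bool) \<Rightarrow>
   (nat \<Rightarrow> ('x, 'y, 'a, 'b) generator ncpoly) rel" where
  "game_rel lam = {(u, v). game_Cauchy lam u \<and> game_Cauchy lam v \<and>
     (\<lambda>n. game_norm lam (u n - v n)) \<longlonglongrightarrow> 0}"

record 'c cstar_structure = "(complex, 'c) module" +
  star :: "'c \<Rightarrow> 'c"
  cnorm :: "'c \<Rightarrow> real"

text \<open>
  The separated completion of the free *-algebra with respect to \<open>game_norm\<close>: Cauchy sequences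
  modulo sequences converging to 0, with the pointwise operations.
\<close>

definition game_cstar_algebra ::
  "('x::finite \<Rightarrow> 'y::finite \<Rightarrow> 'a::finite \<Rightarrow> 'b::finite \<Rightarrow> bool) \<Rightarrow>
   (nat \<Rightarrow> ('x, 'y, 'a, 'b) generator ncpoly) set cstar_structure" where
  "game_cstar_algebra lam =
     \<lparr>carrier = {u. game_Cauchy lam u} // game_rel lam,
      mult = (\<lambda>U V. \<Union>u\<in>U. \<Union>v\<in>V. game_rel lam `` {\<lambda>n. u n * v n}),
      one = game_rel lam `` {\<lambda>n. 1},
      zero = game_rel lam `` {\<lambda>n. 0},
      add = (\<lambda>U V. \<Union>u\<in>U. \<Union>v\<in>V. game_rel lam `` {\<lambda>n. u n + v n}),
      smult = (\<lambda>c U. \<Union>u\<in>U. game_rel lam `` {\<lambda>n. nc_smult c (u n)}),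
      star = (\<lambda>U. \<Union>u\<in>U. game_rel lam `` {\<lambda>n. nc_star (u n)}),
      cnorm = (\<lambda>U. THE r. \<forall>u\<in>U. (\<lambda>n. game_norm lam (u n)) \<longlonglongrightarrow> r)\<rparr>"

definition tracial_state :: "('c, 'm) cstar_structure_scheme \<Rightarrow> ('c \<Rightarrow> complex) \<Rightarrow> bool" where
  "tracial_state C \<tau> \<longleftrightarrow>
     (\<forall>u\<in>carrier C. \<forall>v\<in>carrier C. \<tau> (u \<oplus>\<^bsub>C\<^esub> v) = \<tau> u + \<tau> v) \<and>
     (\<forall>c. \<forall>u\<in>carrier C. \<tau> (c \<odot>\<^bsub>C\<^esub> u) = c * \<tau> u) \<and>
     (\<forall>u\<in>carrier C. \<tau> (star C u \<otimes>\<^bsub>C\<^esub> u) \<in> \<real> \<and> 0 \<le> Re (\<tau> (star C u \<otimes>\<^bsub>C\<^esub> u))) \<and>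
     \<tau> \<one>\<^bsub>C\<^esub> = 1 \<and>
     (\<forall>u\<in>carrier C. \<forall>v\<in>carrier C. \<tau> (u \<otimes>\<^bsub>C\<^esub> v) = \<tau> (v \<otimes>\<^bsub>C\<^esub> u))"


section \<open>The game norm is the largest game seminorm\<close>

lemma inj_rev_word: "inj rev_word"
proof (rule injI)
  fix u v :: "'g nc_word" assume "rev_word u = rev_word v"
  then show "u = v" by (cases u; cases v) simp
qed

lemma lookup_nc_star:
  "Poly_Mapping.lookup (nc_star f) w = cnj (Poly_Mapping.lookup f (rev_word w))"
  by (simp add: nc_star_def map_key.rep_eq[OF inj_rev_word] Poly_Mapping.map.rep_eq when_def)

lemma lookup_nc_smult:
  "Poly_Mapping.lookup (nc_smult c f) w = c * Poly_Mapping.lookup f w"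
  by (simp add: nc_smult_def Poly_Mapping.map.rep_eq when_def)

lemma nc_star_gen: "nc_star (gen g) = gen g"
proof (rule poly_mapping_eqI)
  fix w :: "'a nc_word"
  show "Poly_Mapping.lookup (nc_star (gen g)) w = Poly_Mapping.lookup (gen g) w"
    by (cases w) (auto simp: lookup_nc_star gen_def lookup_single when_def)
qed

lemma nc_star_add: "nc_star (f + g) = nc_star f + nc_star g"
  by (rule poly_mapping_eqI) (simp add: lookup_nc_star lookup_add)

lemma nc_star_sum: "nc_star (sum F I) = (\<Sum>i\<in>I. nc_star (F i))"
proof (induction I rule: infinite_finite_induct)
  case (insert x I)
  then show ?case by (simp add: nc_star_add)
qed (auto intro!: poly_mapping_eqI simp: lookup_nc_star)

lemma rev_word_add: "rev_word (v + w) = rev_word w + rev_word v"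
  by (cases v; cases w) simp

lemma rev_word_rev_word [simp]: "rev_word (rev_word w) = w"
  by (cases w) simp

lemma nc_star_single: "nc_star (Poly_Mapping.single w c) = Poly_Mapping.single (rev_word w) (cnj c)"
  by (rule poly_mapping_eqI) (auto simp: lookup_nc_star lookup_single when_def)

lemma ncpoly_sum: "(\<Sum>w\<in>Poly_Mapping.keys f. Poly_Mapping.single w (Poly_Mapping.lookup f w)) = f"
proof (rule poly_mapping_eqI)
  fix k
  show "Poly_Mapping.lookup (\<Sum>w\<in>Poly_Mapping.keys f. Poly_Mapping.single w (Poly_Mapping.lookup f w)) k
      = Poly_Mapping.lookup f k"
    by (cases "k \<in> Poly_Mapping.keys f")
      (auto simp: lookup_sum lookup_single when_def in_keys_iff)
qed

lemma nc_star_mult: "nc_star (f * g) = nc_star g * nc_star f"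
proof -
  have "nc_star (f * g) = nc_star ((\<Sum>v\<in>Poly_Mapping.keys f. Poly_Mapping.single v (Poly_Mapping.lookup f v)) *
      (\<Sum>w\<in>Poly_Mapping.keys g. Poly_Mapping.single w (Poly_Mapping.lookup g w)))"
    by (simp only: ncpoly_sum)
  also have "\<dots> = nc_star (\<Sum>w\<in>Poly_Mapping.keys g. Poly_Mapping.single w (Poly_Mapping.lookup g w)) *
      nc_star (\<Sum>v\<in>Poly_Mapping.keys f. Poly_Mapping.single v (Poly_Mapping.lookup f v))"
    by (simp add: sum_product nc_star_sum nc_star_single mult_single rev_word_add mult.commute
        sum.swap[of _ "Poly_Mapping.keys g"])
  finally show ?thesis by (simp only: ncpoly_sum)
qed

lemma nc_star_nc_star: "nc_star (nc_star f) = f"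
  by (rule poly_mapping_eqI) (simp add: lookup_nc_star)

lemma cstar_seminorm_zero: "cstar_seminorm s \<Longrightarrow> s 0 = 0"
proof -
  assume "cstar_seminorm s"
  then have "s (nc_smult 0 0) = cmod 0 * s 0" unfolding cstar_seminorm_def by blast
  moreover have "nc_smult 0 0 = (0 :: 'a ncpoly)"
    by (rule poly_mapping_eqI) (simp add: lookup_nc_smult)
  ultimately show ?thesis by simp
qed

lemma cstar_seminorm_nonneg:
  assumes "cstar_seminorm s"
  shows "0 \<le> s f"
proof -
  have "s (f + nc_smult (-1) f) \<le> s f + s (nc_smult (-1) f)"
    and "s (nc_smult (-1) f) = cmod (-1) * s f"
    using assms unfolding cstar_seminorm_def by blast+
  moreover have "f + nc_smult (-1) f = 0"
    by (rule poly_mapping_eqI) (simp add: lookup_nc_smult lookup_add)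
  ultimately show ?thesis using cstar_seminorm_zero[OF assms] by simp
qed

lemma cstar_seminorm_one:
  assumes "cstar_seminorm s"
  shows "s 1 \<le> 1"
proof -
  have "nc_star 1 = (1 :: 'a ncpoly)"
    by (simp only: single_one[symmetric] nc_star_single) (simp add: zero_nc_word_def)
  then have "s 1 = (s 1)\<^sup>2"
    using assms unfolding cstar_seminorm_def by (metis mult_1)
  then show ?thesis by (auto simp: power2_eq_square)
qed

lemma game_seminorm_gen:
  assumes "s \<in> game_seminorms lam"
  shows "s (gen g) \<le> 1"
proof -
  have s: "cstar_seminorm s" using assms by (simp add: game_seminorms_def)
  have "s (gen g * gen g - gen g) = 0"
    using assms by (cases g) (auto simp: game_seminorms_def)
  moreover have "s (gen g * gen g) \<le> s (gen g * gen g - gen g) + s (gen g)"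
    using s unfolding cstar_seminorm_def by (metis diff_add_cancel)
  moreover have "s (gen g * gen g) = (s (gen g))\<^sup>2"
    using s unfolding cstar_seminorm_def by (metis nc_star_gen)
  ultimately have "s (gen g) * s (gen g) \<le> s (gen g) * 1"
    by (simp add: power2_eq_square)
  then show ?thesis using cstar_seminorm_nonneg[OF s, of "gen g"]
    by (cases "s (gen g) = 0") (auto simp: mult_le_cancel_left)
qed

lemma game_seminorm_word:
  assumes "s \<in> game_seminorms lam"
  shows "s (Poly_Mapping.single (Word w) 1) \<le> 1"
proof (induction w)
  case Nil
  show ?case using assms cstar_seminorm_one[of s]
    by (simp flip: zero_nc_word_def add: game_seminorms_def)
next
  case (Cons g w)
  have s: "cstar_seminorm s" using assms by (simp add: game_seminorms_def)
  have "Poly_Mapping.single (Word (g # w)) 1 = gen g * Poly_Mapping.single (Word w) (1 :: complex)"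
    by (simp add: gen_def mult_single)
  then have "s (Poly_Mapping.single (Word (g # w)) 1) \<le> s (gen g) * s (Poly_Mapping.single (Word w) 1)"
    using s unfolding cstar_seminorm_def by metis
  also have "\<dots> \<le> 1 * 1"
    by (intro mult_mono game_seminorm_gen[OF assms] Cons cstar_seminorm_nonneg[OF s]) simp
  finally show ?case by simp
qed

lemma game_seminorm_bound:
  assumes "s \<in> game_seminorms lam"
  shows "s f \<le> (\<Sum>w\<in>Poly_Mapping.keys f. cmod (Poly_Mapping.lookup f w))"
proof -
  have s: "cstar_seminorm s" using assms by (simp add: game_seminorms_def)
  have mono: "s (Poly_Mapping.single w c) \<le> cmod c" for w c
  proof -
    obtain l where l: "w = Word l" by (cases w)
    have "Poly_Mapping.single w c = nc_smult c (Poly_Mapping.single w 1)"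
      by (rule poly_mapping_eqI) (simp add: lookup_nc_smult lookup_single when_def)
    then have "s (Poly_Mapping.single w c) = cmod c * s (Poly_Mapping.single w 1)"
      using s unfolding cstar_seminorm_def by metis
    also have "\<dots> \<le> cmod c * 1"
      unfolding l by (intro mult_left_mono game_seminorm_word[OF assms]) simp
    finally show ?thesis by simp
  qed
  have "s (sum F I) \<le> (\<Sum>i\<in>I. s (F i))" if "finite I" for F and I :: "('a, 'b, 'c, 'd) generator nc_word set"
    using that
  proof (induction I)
    case empty
    then show ?case by (simp add: cstar_seminorm_zero[OF s])
  next
    case (insert i I)
    then have "s (F i + sum F I) \<le> s (F i) + s (sum F I)"
      using s unfolding cstar_seminorm_def by blast
    then show ?case using insert by simp
  qed
  then have "s (\<Sum>w\<in>Poly_Mapping.keys f. Poly_Mapping.single w (Poly_Mapping.lookup f w))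
      \<le> (\<Sum>w\<in>Poly_Mapping.keys f. s (Poly_Mapping.single w (Poly_Mapping.lookup f w)))" by simp
  also have "\<dots> \<le> (\<Sum>w\<in>Poly_Mapping.keys f. cmod (Poly_Mapping.lookup f w))"
    by (intro sum_mono mono)
  finally show ?thesis by (simp only: ncpoly_sum)
qed

lemma game_seminorms_bdd: "bdd_above ((\<lambda>s. s f) ` game_seminorms lam)"
  using game_seminorm_bound by (auto intro!: bdd_aboveI)

lemma game_seminorm_le_game_norm: "s \<in> game_seminorms lam \<Longrightarrow> s f \<le> game_norm lam f"
  unfolding game_norm_def by (rule cSUP_upper[OF _ game_seminorms_bdd])

lemma game_seminorms_nonempty: "game_seminorms lam \<noteq> {}"
proof -
  have "(\<lambda>_. 0) \<in> game_seminorms lam" by (simp add: game_seminorms_def cstar_seminorm_def)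
  then show ?thesis by blast
qed

lemma game_norm_least: "(\<And>s. s \<in> game_seminorms lam \<Longrightarrow> s f \<le> r) \<Longrightarrow> game_norm lam f \<le> r"
  unfolding game_norm_def by (rule cSUP_least[OF game_seminorms_nonempty])

theorem game_norm_in_game_seminorms: "game_norm lam \<in> game_seminorms lam"
proof -
  let ?N = "game_norm lam"
  have cs: "cstar_seminorm s" if "s \<in> game_seminorms lam" for s
    using that by (simp add: game_seminorms_def)
  note le = game_seminorm_le_game_norm
  obtain s0 where s0: "s0 \<in> game_seminorms lam" using game_seminorms_nonempty by blast
  have nonneg: "0 \<le> ?N f" for f
    using cstar_seminorm_nonneg[OF cs[OF s0], of f] le[OF s0, of f] by linarith
  have vanish: "?N f = 0" if "\<And>s. s \<in> game_seminorms lam \<Longrightarrow> s f = 0" for f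
    by (rule antisym[OF game_norm_least nonneg]) (simp add: that)
  have add: "?N (f + g) \<le> ?N f + ?N g" for f g
  proof (rule game_norm_least)
    fix s assume s: "s \<in> game_seminorms lam"
    have "s (f + g) \<le> s f + s g" using cs[OF s] unfolding cstar_seminorm_def by blast
    then show "s (f + g) \<le> ?N f + ?N g" using le[OF s, of f] le[OF s, of g] by linarith
  qed
  have mult: "?N (f * g) \<le> ?N f * ?N g" for f g
  proof (rule game_norm_least)
    fix s assume s: "s \<in> game_seminorms lam"
    have "s (f * g) \<le> s f * s g" using cs[OF s] unfolding cstar_seminorm_def by blast
    also have "\<dots> \<le> ?N f * ?N g"
      by (intro mult_mono le[OF s] nonneg cstar_seminorm_nonneg[OF cs[OF s]])
    finally show "s (f * g) \<le> ?N f * ?N g" .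
  qed
  have smult: "?N (nc_smult c f) = cmod c * ?N f" for c f
  proof -
    have eq: "s (nc_smult c f) = cmod c * s f" if "s \<in> game_seminorms lam" for s
      using cs[OF that] unfolding cstar_seminorm_def by blast
    show ?thesis
    proof (cases "c = 0")
      case True
      then show ?thesis using eq by (simp add: vanish)
    next
      case False
      have "?N (nc_smult c f) \<le> cmod c * ?N f"
        by (rule game_norm_least) (simp add: eq mult_left_mono le)
      moreover have "?N f \<le> ?N (nc_smult c f) / cmod c"
      proof (rule game_norm_least)
        fix s assume s: "s \<in> game_seminorms lam"
        show "s f \<le> ?N (nc_smult c f) / cmod c"
          using le[OF s, of "nc_smult c f"] False by (simp add: eq[OF s] field_simps)
      qed
      ultimately show ?thesis using False by (simp add: field_simps)
    qed
  qed
  have star: "?N (nc_star f * f) = (?N f)\<^sup>2" for f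
  proof (rule antisym)
    have eq: "s (nc_star f * f) = (s f)\<^sup>2" if "s \<in> game_seminorms lam" for s
      using cs[OF that] unfolding cstar_seminorm_def by blast
    show "?N (nc_star f * f) \<le> (?N f)\<^sup>2"
      by (rule game_norm_least)
        (simp add: eq power_mono le cstar_seminorm_nonneg cs)
    have "?N f \<le> sqrt (?N (nc_star f * f))"
    proof (rule game_norm_least)
      fix s assume s: "s \<in> game_seminorms lam"
      show "s f \<le> sqrt (?N (nc_star f * f))"
        using le[OF s, of "nc_star f * f"] by (intro real_le_rsqrt) (simp add: eq[OF s])
    qed
    then show "(?N f)\<^sup>2 \<le> ?N (nc_star f * f)"
      using nonneg by (metis power_mono real_sqrt_pow2)
  qed
  have "cstar_seminorm ?N"
    unfolding cstar_seminorm_def using add smult mult star by blast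
  moreover have "?N f = 0" if "\<forall>s\<in>game_seminorms lam. s f = 0" for f
    using vanish that by blast
  ultimately show ?thesis
    unfolding game_seminorms_def[of lam]
    by (auto intro!: vanish simp: game_seminorms_def)
qed

end

theory Submission
  imports Defs "HOL-Library.Countable"
begin

text \<open>
  Both conditions are equivalent to the existence of a linear functional \<open>\<phi>\<close> on the free *-algebra
  that is unital, positive and tracial and kills the ideal generated by the relations of the game
  (locale \<open>game_trace\<close>).

  A tracial state on \<open>C*(G)\<close> restricts to such a functional, because polynomials of game norm 0 are
  identified with 0. Conversely, left multiplication in the GNS space of \<open>\<phi>\<close> satisfies the relations,
  so its operator norm is one of the seminorms whose supremum is the game norm
  (\<open>opnorm_in_game_seminorms\<close>). Hence \<open>\<bar>\<phi> f\<bar>\<close> is at most the game norm of \<open>f\<close>, and \<open>\<phi>\<close> extends to the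
  completion by continuity. The algebra is nonzero because a state takes
  different values at 1 and 0.

  Given \<open>\<phi>\<close>, the GNS space carries two commuting families of projections: left multiplication by the
  \<open>p_{x,a}\<close> and, thanks to the trace, right multiplication by the \<open>q_{y,b}\<close>. With the class of 1 as
  vector they give the correlation \<open>\<phi>(p_{x,a} q_{y,b})\<close>, which vanishes whenever the rule forbids it. To
  obtain a Hilbert space among the sequences of complex numbers, the words are orthonormalised by the
  Gram-Schmidt process, and the operators become matrices with finite rows acting on square-summable
  sequences.

  The imitation property is used to get from a perfect strategy \<open>(\<xi>, P, Q)\<close> to \<open>\<phi>\<close>. In the strategy
  the two families commute, whereas in \<open>C*(G)\<close> they multiply to 0 for forbidden outcomes, so \<open>P_{x,a}\<close>
  is replaced by the projection \<open>R_{x,a}\<close> onto the vectors killed by all \<open>Q_{y,b}\<close> that are forbidden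
  together with \<open>(x,a)\<close>. Then \<open>R_{x,a} Q_{y,b} = 0\<close> for forbidden outcomes, and the imitation property
  gives \<open>R_{x,a} \<xi> = P_{x,a} \<xi>\<close> (\<open>imitation_transfer\<close>). Symmetrically there are \<open>S_{y,b}\<close> built from the
  \<open>P_{x,a}\<close> with \<open>S_{y,b} \<xi> = Q_{y,b} \<xi>\<close>. The operators \<open>R, Q\<close> commute with their mirror images \<open>P, S\<close>, and
  on \<open>\<xi>\<close> they agree with them; so in \<open>\<langle>\<xi>, w \<xi>\<rangle>\<close>, for a word \<open>w\<close> in \<open>R\<close> and \<open>Q\<close>, the first letter can
  be moved to the end, which makes the vector state of \<open>\<xi>\<close> a trace
  (\<open>game_trace_of_mirrored_operators\<close>).
\<close>

section \<open>Algebra of noncommutative polynomials\<close>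

lemma nc_smult_eq: "nc_smult c f = Poly_Mapping.single 0 c * f"
  by (simp add: mult_map_scale_conv_mult nc_smult_def)

lemma nc_smult_single: "nc_smult c (Poly_Mapping.single w d) = Poly_Mapping.single w (c * d)"
  by (simp add: nc_smult_eq mult_single)

lemma nc_smult_mult_left: "nc_smult c f * g = nc_smult c (f * g)"
  by (simp add: nc_smult_eq mult.assoc)

lemma single_0_commute: "f * Poly_Mapping.single 0 c = Poly_Mapping.single 0 c * (f :: 'g ncpoly)"
proof -
  have "(\<Sum>w\<in>Poly_Mapping.keys f. Poly_Mapping.single w (Poly_Mapping.lookup f w)) * Poly_Mapping.single 0 c
      = Poly_Mapping.single 0 c * (\<Sum>w\<in>Poly_Mapping.keys f. Poly_Mapping.single w (Poly_Mapping.lookup f w))"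
    by (simp add: sum_distrib_left sum_distrib_right mult_single mult.commute)
  then show ?thesis by (simp only: ncpoly_sum)
qed

lemma nc_smult_mult_right: "f * nc_smult c g = nc_smult c (f * g)"
  by (simp add: nc_smult_eq mult.assoc[symmetric] single_0_commute)

lemma nc_smult_nc_smult: "nc_smult c (nc_smult d f) = nc_smult (c * d) f"
  by (simp add: nc_smult_eq mult.assoc[symmetric] mult_single)

lemma nc_smult_1: "nc_smult 1 f = f"
  by (simp add: nc_smult_eq)

lemma nc_smult_0: "nc_smult 0 f = 0"
  by (simp add: nc_smult_eq)

lemma nc_smult_minus_1: "nc_smult (-1) f = - f"
  by (simp add: nc_smult_eq single_uminus)

lemma nc_star_smult: "nc_star (nc_smult c f) = nc_smult (cnj c) (nc_star f)"
  by (rule poly_mapping_eqI) (simp add: lookup_nc_star lookup_nc_smult)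

lemma nc_star_0 [simp]: "nc_star 0 = 0"
  by (rule poly_mapping_eqI) (simp add: lookup_nc_star)

lemma nc_star_1 [simp]: "nc_star 1 = 1"
  by (simp only: single_one[symmetric] nc_star_single) (simp add: zero_nc_word_def)

lemma nc_star_diff: "nc_star (f - g) = nc_star f - nc_star g"
  by (rule poly_mapping_eqI) (simp add: lookup_nc_star lookup_minus)

lemma ncpoly_induct [case_names single add]:
  assumes single: "\<And>w c. P (Poly_Mapping.single (Word w) c)"
    and add: "\<And>f g. P f \<Longrightarrow> P g \<Longrightarrow> P (f + g)"
  shows "P (f :: 'g ncpoly)"
proof -
  have single': "P (Poly_Mapping.single w c)" for w c
    using single by (cases w) auto
  have *: "P (\<Sum>w\<in>K. Poly_Mapping.single w (Poly_Mapping.lookup f w))" if "finite K" for K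
    using that
  proof (induction K rule: finite_induct)
    case empty
    then show ?case using single[of "[]" 0] by simp
  qed (simp add: add single')
  from *[of "Poly_Mapping.keys f"] show ?thesis by (simp add: ncpoly_sum)
qed

lemma single_Cons: "Poly_Mapping.single (Word (g # w)) c = gen g * Poly_Mapping.single (Word w) c"
  by (simp add: gen_def mult_single)

section \<open>The GNS form of a positive functional\<close>

text \<open>
  The discriminant argument for the Cauchy-Schwarz inequality, stated for numbers so that it serves
  both the semidefinite form of a functional and the inner product of a Hilbert space.
\<close>

lemma discriminant_le:
  fixes a b :: real
  assumes nonneg: "\<And>t. 0 \<le> a + 2 * Re (t * c) + (cmod t)\<^sup>2 * b" and a: "0 \<le> a" and b: "0 \<le> b"
  shows "(cmod c)\<^sup>2 \<le> a * b"
proof -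
  have *: "0 \<le> a - 2 * r * (cmod c)\<^sup>2 + r\<^sup>2 * (cmod c)\<^sup>2 * b" for r :: real
  proof -
    have eq: "complex_of_real (- r) * cnj c * c = complex_of_real (- r * (cmod c)\<^sup>2)"
      using complex_norm_square[of c] by (simp add: mult.commute[of "cnj c"])
    have "0 \<le> a + 2 * Re (complex_of_real (- r) * cnj c * c) + (cmod (complex_of_real (- r) * cnj c))\<^sup>2 * b"
      by (rule nonneg)
    then show ?thesis
      unfolding eq by (simp add: norm_mult power_mult_distrib)
  qed
  show ?thesis
  proof (cases "b = 0")
    case True
    show ?thesis
    proof (rule ccontr)
      assume "\<not> ?thesis"
      then have "0 < (cmod c)\<^sup>2" using True by simp
      \<comment> \<open>for \<open>b = 0\<close> the bound is affine in \<open>r\<close>, and this \<open>r\<close> makes it \<open>- 1\<close>\<close>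
      then show False using *[of "(a + 1) / (2 * (cmod c)\<^sup>2)"] True by simp
    qed
  next
    case False
    have "0 \<le> a - (cmod c)\<^sup>2 / b"
      using *[of "1 / b"] False by (simp add: field_simps power2_eq_square)
    then show ?thesis using False b by (simp add: field_simps)
  qed
qed

locale positive_functional =
  fixes \<phi> :: "'g ncpoly \<Rightarrow> complex"
  assumes phi_add: "\<phi> (f + g) = \<phi> f + \<phi> g"
    and phi_smult: "\<phi> (nc_smult c f) = c * \<phi> f"
    and phi_pos: "\<phi> (nc_star f * f) \<in> \<real>" "0 \<le> Re (\<phi> (nc_star f * f))"
    and phi_one: "\<phi> 1 = 1"
begin

text \<open>
  \<open>B\<close> is the GNS form and \<open>N\<close> its seminorm. The form is only semidefinite; instead of dividing by the
  null space, statements about GNS vectors are formulated modulo polynomials with \<open>N f = 0\<close>.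
\<close>

definition B :: "'g ncpoly \<Rightarrow> 'g ncpoly \<Rightarrow> complex" where
  "B f g = \<phi> (nc_star f * g)"

definition N :: "'g ncpoly \<Rightarrow> real" where
  "N f = sqrt (Re (B f f))"

lemma phi_0 [simp]: "\<phi> 0 = 0"
  using phi_add[of 0 0] by simp

lemma phi_minus: "\<phi> (- f) = - \<phi> f"
  using phi_smult[of "-1" f] by (simp add: nc_smult_minus_1)

lemma phi_diff: "\<phi> (f - g) = \<phi> f - \<phi> g"
  using phi_add[of f "- g"] by (simp add: phi_minus)

lemma phi_sum: "\<phi> (sum F I) = (\<Sum>i\<in>I. \<phi> (F i))"
  by (induction I rule: infinite_finite_induct) (simp_all add: phi_add)

lemma B_add_left: "B (f + g) h = B f h + B g h"
  and B_add_right: "B h (f + g) = B h f + B h g"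
  by (simp_all add: B_def nc_star_add distrib_left distrib_right phi_add)

lemma B_smult_left: "B (nc_smult c f) h = cnj c * B f h"
  and B_smult_right: "B h (nc_smult c f) = c * B h f"
  by (simp_all add: B_def nc_star_smult nc_smult_mult_left nc_smult_mult_right phi_smult)

lemma B_diff_left: "B (f - g) h = B f h - B g h"
  and B_diff_right: "B h (f - g) = B h f - B h g"
  by (simp_all add: B_def nc_star_diff left_diff_distrib right_diff_distrib phi_diff)

lemma B_0 [simp]: "B 0 h = 0" "B h 0 = 0"
  by (simp_all add: B_def)

lemma B_sum_left: "B (sum F I) h = (\<Sum>i\<in>I. B (F i) h)"
  and B_sum_right: "B h (sum F I) = (\<Sum>i\<in>I. B h (F i))"
  by (simp_all add: B_def nc_star_sum sum_distrib_left sum_distrib_right phi_sum)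

lemma B_mult_left: "B (f * g) h = B g (nc_star f * h)"
  by (simp add: B_def nc_star_mult mult.assoc)

lemma B_self: "Im (B f f) = 0" "0 \<le> Re (B f f)"
  using phi_pos[of f] by (auto simp: B_def complex_is_Real_iff)

lemma N_nonneg [simp]: "0 \<le> N f"
  by (simp add: N_def B_self)

lemma B_eq_N: "B f f = complex_of_real ((N f)\<^sup>2)"
  by (simp add: N_def B_self complex_eq_iff)

text \<open>
  Hermitian symmetry is a consequence of positivity: the diagonal values at \<open>f + g\<close> and \<open>f + \<i> g\<close> are real.
\<close>

lemma B_commute: "B f g = cnj (B g f)"
proof -
  have expand: "B (f + nc_smult c g) (f + nc_smult c g)
      = B f f + c * B f g + cnj c * B g f + c * cnj c * B g g" for c
    by (simp add: B_add_left B_add_right B_smult_left B_smult_right algebra_simps)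
  have "Im (B (f + nc_smult 1 g) (f + nc_smult 1 g)) = 0"
    "Im (B (f + nc_smult \<i> g) (f + nc_smult \<i> g)) = 0"
    by (rule B_self)+
  then have "Im (B f g) + Im (B g f) = 0" "Re (B f g) - Re (B g f) = 0"
    unfolding expand by (simp_all add: B_self)
  then show ?thesis by (simp add: complex_eq_iff)
qed

lemma N_sq: "(N f)\<^sup>2 = Re (B f f)"
  by (simp add: N_def B_self)

lemma N_add_smult_sq: "(N (f + nc_smult c g))\<^sup>2 = (N f)\<^sup>2 + 2 * Re (c * B f g) + (cmod c)\<^sup>2 * (N g)\<^sup>2"
proof -
  have "Re (B (f + nc_smult c g) (f + nc_smult c g))
      = Re (B f f) + Re (c * B f g) + Re (cnj (c * B f g)) + Re (complex_of_real ((cmod c)\<^sup>2) * B g g)"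
    by (simp add: B_add_left B_add_right B_smult_left B_smult_right B_commute[of g f] algebra_simps
        complex_norm_square del: of_real_power)
  then show ?thesis by (simp add: N_sq)
qed

lemma Cauchy_Schwarz: "cmod (B f g) \<le> N f * N g"
proof -
  have "(cmod (B f g))\<^sup>2 \<le> (N f)\<^sup>2 * (N g)\<^sup>2"
    by (rule discriminant_le) (simp_all only: N_add_smult_sq[symmetric] zero_le_power2)
  then show ?thesis by (simp flip: power_mult_distrib)
qed

lemma N_add: "N (f + g) \<le> N f + N g"
proof -
  have "Re (B f g) \<le> N f * N g"
    using Cauchy_Schwarz[of f g] complex_Re_le_cmod[of "B f g"] by linarith
  then have "(N (f + g))\<^sup>2 \<le> (N f + N g)\<^sup>2"
    using N_add_smult_sq[of f 1 g] by (simp add: nc_smult_1 power2_sum)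
  then show ?thesis by (rule power2_le_imp_le) simp
qed

lemma N_smult: "N (nc_smult c f) = cmod c * N f"
proof -
  have "(N (nc_smult c f))\<^sup>2 = (cmod c * N f)\<^sup>2"
    using N_add_smult_sq[of 0 c f] by (simp add: N_sq[of 0] power_mult_distrib)
  then show ?thesis by (simp add: power2_eq_iff_nonneg)
qed

lemma N_eq_0_imp: "N f = 0 \<Longrightarrow> B f g = 0" "N f = 0 \<Longrightarrow> B g f = 0"
  using Cauchy_Schwarz[of f g] Cauchy_Schwarz[of g f] by auto

end

section \<open>Traces that respect the rules of a game\<close>

definition game_relations ::
  "('x::finite \<Rightarrow> 'y::finite \<Rightarrow> 'a::finite \<Rightarrow> 'b::finite \<Rightarrow> bool) \<Rightarrow>
   ('x, 'y, 'a, 'b) generator ncpoly set" where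
  "game_relations lam =
     range (\<lambda>g. gen g * gen g - gen g) \<union>
     range (\<lambda>x. (\<Sum>a\<in>UNIV. polyP x a) - 1) \<union>
     range (\<lambda>y. (\<Sum>b\<in>UNIV. polyQ y b) - 1) \<union>
     {polyP x a * polyQ y b | x y a b. \<not> lam x y a b}"

lemma game_seminorms_iff:
  "s \<in> game_seminorms lam \<longleftrightarrow> cstar_seminorm s \<and> (\<forall>r\<in>game_relations lam. s r = 0)"
proof -
  have "(\<forall>g. s (gen g * gen g - gen g) = 0) \<longleftrightarrow>
      (\<forall>x a. s (polyP x a * polyP x a - polyP x a) = 0) \<and>
      (\<forall>y b. s (polyQ y b * polyQ y b - polyQ y b) = 0)"
    by (metis generator.exhaust)
  moreover have "(\<forall>r\<in>{polyP x a * polyQ y b | x y a b. \<not> lam x y a b}. s r = 0) \<longleftrightarrow>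
      (\<forall>x y a b. \<not> lam x y a b \<longrightarrow> s (polyP x a * polyQ y b) = 0)"
    by blast
  ultimately show ?thesis
    by (simp only: game_seminorms_def game_relations_def ball_Un ball_simps ball_UNIV mem_Collect_eq conj_assoc)
qed

text \<open>
  The common reformulation of both sides of the equivalence. By the trace property it is enough that
  multiples \<open>r * f\<close> of a relation are killed (\<open>phi_relation_mid\<close>).
\<close>

locale game_trace = positive_functional \<phi>
  for lam :: "'x::finite \<Rightarrow> 'y::finite \<Rightarrow> 'a::finite \<Rightarrow> 'b::finite \<Rightarrow> bool"
    and \<phi> :: "('x, 'y, 'a, 'b) generator ncpoly \<Rightarrow> complex" +
  assumes phi_trace: "\<phi> (f * g) = \<phi> (g * f)"
    and phi_relation: "r \<in> game_relations lam \<Longrightarrow> \<phi> (r * f) = 0"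
begin

lemma phi_relation_mid: "r \<in> game_relations lam \<Longrightarrow> \<phi> (f * r * g) = 0"
  using phi_trace[of f "r * g"] phi_relation[of r "g * f"] by (simp add: mult.assoc)

lemma gen_idem: "B f (gen g * (gen g * h)) = B f (gen g * h)"
proof -
  have "gen g * gen g - gen g \<in> game_relations lam"
    by (simp add: game_relations_def)
  then have "\<phi> (nc_star f * (gen g * gen g - gen g) * h) = 0" by (rule phi_relation_mid)
  then show ?thesis
    by (simp add: B_def phi_diff algebra_simps)
qed

text \<open>A generator acts as a projection on the GNS space, hence as a contraction.\<close>

lemma N_gen_mult: "N (gen g * f) \<le> N f"
proof -
  have "(N (gen g * f))\<^sup>2 = Re (B f (gen g * f))"
    by (simp add: N_sq B_mult_left nc_star_gen gen_idem)
  also have "\<dots> \<le> N f * N (gen g * f)"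
    using Cauchy_Schwarz[of f "gen g * f"] complex_Re_le_cmod[of "B f (gen g * f)"] by linarith
  finally have "N (gen g * f) * N (gen g * f) \<le> N f * N (gen g * f)" by (simp add: power2_eq_square)
  then show ?thesis using N_nonneg[of "gen g * f"] by (auto simp: mult_le_cancel_right less_le)
qed

lemma N_mult_bounded: "\<exists>C\<ge>0. \<forall>g. N (f * g) \<le> C * N g"
proof (induction f rule: ncpoly_induct)
  case (single w c)
  have "N (Poly_Mapping.single (Word w) c * g) \<le> cmod c * N g" for g
  proof (induction w)
    case Nil
    then show ?case by (simp flip: zero_nc_word_def nc_smult_eq add: N_smult)
  next
    case (Cons h w)
    then show ?case
      using N_gen_mult[of h "Poly_Mapping.single (Word w) c * g"] by (simp add: single_Cons mult.assoc)
  qed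
  then show ?case by (intro exI[of _ "cmod c"]) auto
next
  case (add f1 f2)
  then obtain C1 C2 where C: "C1 \<ge> 0" "C2 \<ge> 0" "\<And>g. N (f1 * g) \<le> C1 * N g" "\<And>g. N (f2 * g) \<le> C2 * N g"
    by blast
  have "N ((f1 + f2) * g) \<le> (C1 + C2) * N g" for g
    using N_add[of "f1 * g" "f2 * g"] C(3)[of g] C(4)[of g] by (simp add: distrib_right)
  then show ?case using C(1,2) by (intro exI[of _ "C1 + C2"]) simp
qed

text \<open>
  The operator norm of left multiplication by \<open>f\<close> on the GNS space. As an infimum of bounds it is
  determined by \<open>opnorm_least\<close> and \<open>N_mult_le\<close>, from which all its properties follow.
\<close>

definition opnorm :: "('x, 'y, 'a, 'b) generator ncpoly \<Rightarrow> real" where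
  "opnorm f = Inf {C. 0 \<le> C \<and> (\<forall>g. N (f * g) \<le> C * N g)}"

lemma opnorm_least: "0 \<le> C \<Longrightarrow> (\<And>g. N (f * g) \<le> C * N g) \<Longrightarrow> opnorm f \<le> C"
  unfolding opnorm_def by (rule cInf_lower) (auto intro: bdd_belowI[of _ 0])

lemma opnorm_nonneg: "0 \<le> opnorm f"
  unfolding opnorm_def using N_mult_bounded[of f] by (intro cInf_greatest) auto

lemma N_mult_le: "N (f * g) \<le> opnorm f * N g"
proof (cases "N g = 0")
  case True
  then show ?thesis using N_mult_bounded[of f] by (metis mult_zero_right)
next
  case False
  then have pos: "0 < N g" using N_nonneg[of g] by linarith
  have "N (f * g) / N g \<le> opnorm f"
    unfolding opnorm_def
    using N_mult_bounded[of f] pos by (intro cInf_greatest) (auto simp: field_simps)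
  then show ?thesis using pos by (simp add: field_simps)
qed

lemma opnorm_smult_le: "opnorm (nc_smult c f) \<le> cmod c * opnorm f"
  using N_mult_le[of f]
  by (intro opnorm_least)
    (auto simp: opnorm_nonneg nc_smult_mult_left N_smult mult.assoc intro: mult_left_mono)

lemma opnorm_smult: "opnorm (nc_smult c f) = cmod c * opnorm f"
proof (cases "c = 0")
  case True
  then show ?thesis using opnorm_smult_le[of c f] opnorm_nonneg[of "nc_smult c f"] by simp
next
  case False
  have "opnorm f \<le> cmod (inverse c) * opnorm (nc_smult c f)"
    using opnorm_smult_le[of "inverse c" "nc_smult c f"] False by (simp add: nc_smult_nc_smult nc_smult_1)
  then have "cmod c * opnorm f \<le> opnorm (nc_smult c f)"
    using False by (simp add: norm_inverse norm_divide field_simps)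
  then show ?thesis using opnorm_smult_le[of c f] by linarith
qed

lemma opnorm_mult: "opnorm (f * g) \<le> opnorm f * opnorm g"
proof (rule opnorm_least)
  fix h
  have "N (f * (g * h)) \<le> opnorm f * N (g * h)" by (rule N_mult_le)
  also have "\<dots> \<le> opnorm f * (opnorm g * N h)"
    by (intro mult_left_mono N_mult_le opnorm_nonneg)
  finally show "N (f * g * h) \<le> opnorm f * opnorm g * N h" by (simp add: mult.assoc)
qed (simp add: opnorm_nonneg)

lemma opnorm_add: "opnorm (f + g) \<le> opnorm f + opnorm g"
proof (rule opnorm_least)
  fix h
  show "N ((f + g) * h) \<le> (opnorm f + opnorm g) * N h"
    using N_add[of "f * h" "g * h"] N_mult_le[of f h] N_mult_le[of g h] by (simp add: distrib_right)
qed (simp add: opnorm_nonneg)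

text \<open>
  The half of the C*-identity that rests on the form:
  \<open>N (f * g)\<^sup>2 = B g (nc_star f * f * g)\<close>, estimated by Cauchy-Schwarz.
\<close>

lemma opnorm_sq_le: "(opnorm f)\<^sup>2 \<le> opnorm (nc_star f * f)"
proof -
  have "opnorm f \<le> sqrt (opnorm (nc_star f * f))"
  proof (rule opnorm_least)
    fix g
    have "(N (f * g))\<^sup>2 = Re (B g (nc_star f * f * g))"
      by (simp add: N_sq B_mult_left mult.assoc)
    also have "\<dots> \<le> N g * N (nc_star f * f * g)"
      using Cauchy_Schwarz[of g "nc_star f * f * g"] complex_Re_le_cmod by (rule order_trans[rotated])
    also have "\<dots> \<le> N g * (opnorm (nc_star f * f) * N g)"
      by (intro mult_left_mono N_mult_le) simp
    also have "\<dots> = (sqrt (opnorm (nc_star f * f)) * N g)\<^sup>2"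
      by (simp add: power_mult_distrib opnorm_nonneg power2_eq_square[of "N g"])
    finally show "N (f * g) \<le> sqrt (opnorm (nc_star f * f)) * N g"
      by (rule power2_le_imp_le) (simp add: opnorm_nonneg)
  qed (simp add: opnorm_nonneg)
  then show ?thesis using opnorm_nonneg by (metis power_mono real_sqrt_pow2)
qed

lemma opnorm_star_le: "opnorm f \<le> opnorm (nc_star f)"
proof -
  have "opnorm f * opnorm f \<le> opnorm (nc_star f) * opnorm f"
    using opnorm_sq_le[of f] opnorm_mult[of "nc_star f" f] by (simp add: power2_eq_square)
  then show ?thesis using opnorm_nonneg[of f] opnorm_nonneg[of "nc_star f"]
    by (cases "opnorm f = 0") (auto simp: mult_le_cancel_right)
qed

lemma opnorm_star: "opnorm (nc_star f * f) = (opnorm f)\<^sup>2"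
proof -
  have "opnorm (nc_star f) = opnorm f"
    using opnorm_star_le[of f] opnorm_star_le[of "nc_star f"] by (simp add: nc_star_nc_star)
  then show ?thesis
    using opnorm_sq_le[of f] opnorm_mult[of "nc_star f" f] by (simp add: power2_eq_square)
qed

lemma opnorm_in_game_seminorms: "opnorm \<in> game_seminorms lam"
  unfolding game_seminorms_iff cstar_seminorm_def
proof (intro conjI allI ballI)
  fix r assume r: "r \<in> game_relations lam"
  have "N (r * g) = 0" for g
  proof -
    have "\<phi> ((nc_star (r * g)) * r * g) = 0" by (rule phi_relation_mid[OF r])
    then show ?thesis by (simp add: N_def B_def mult.assoc)
  qed
  then have "opnorm r \<le> 0" by (intro opnorm_least) auto
  then show "opnorm r = 0" using opnorm_nonneg[of r] by simp
qed (fact opnorm_add opnorm_smult opnorm_mult opnorm_star)+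

text \<open>
  \<open>\<phi> f\<close> is a matrix coefficient at the unit vector 1, so it is bounded by the operator norm, which is
  among the seminorms defining the game norm.
\<close>

lemma phi_le_game_norm: "cmod (\<phi> f) \<le> game_norm lam f"
proof -
  have N1: "N 1 = 1" by (simp add: N_def B_def phi_one)
  have "cmod (\<phi> f) \<le> N f"
    using Cauchy_Schwarz[of 1 f] by (simp add: N1) (simp add: B_def)
  also have "\<dots> \<le> opnorm f" using N_mult_le[of f 1] by (simp add: N1)
  also have "\<dots> \<le> game_norm lam f"
    by (rule game_seminorm_le_game_norm[OF opnorm_in_game_seminorms])
  finally show ?thesis .
qed

end

section \<open>Tracial states on the game algebra\<close>

lemma cstar_seminorm_minus:
  assumes "cstar_seminorm s" shows "s (- f) = s f"
proof -
  have "s (nc_smult (-1) f) = cmod (-1) * s f"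
    using assms unfolding cstar_seminorm_def by blast
  then show ?thesis by (simp add: nc_smult_minus_1)
qed

lemma cstar_seminorm_nc_star:
  assumes s: "cstar_seminorm s" shows "s (nc_star f) = s f"
proof -
  have le: "s f \<le> s (nc_star f)" for f
  proof -
    have "s f * s f = s (nc_star f * f)"
      using s unfolding cstar_seminorm_def power2_eq_square by metis
    also have "\<dots> \<le> s (nc_star f) * s f"
      using s unfolding cstar_seminorm_def by blast
    finally have "s f * s f \<le> s (nc_star f) * s f" .
    then show ?thesis
      using cstar_seminorm_nonneg[OF s, of f] cstar_seminorm_nonneg[OF s, of "nc_star f"]
      by (auto simp: mult_le_cancel_right)
  qed
  show ?thesis using le[of f] le[of "nc_star f"] by (simp add: nc_star_nc_star)
qed

context
  fixes lam :: "'x::finite \<Rightarrow> 'y::finite \<Rightarrow> 'a::finite \<Rightarrow> 'b::finite \<Rightarrow> bool"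
begin

abbreviation gn where "gn \<equiv> game_norm lam"

lemma cstar_seminorm_game_norm: "cstar_seminorm gn"
  using game_norm_in_game_seminorms[of lam] by (simp add: game_seminorms_iff)

lemma game_norm_relation: "r \<in> game_relations lam \<Longrightarrow> gn r = 0"
  using game_norm_in_game_seminorms[of lam] by (simp add: game_seminorms_iff)

lemmas game_norm_nonneg [simp] = cstar_seminorm_nonneg[OF cstar_seminorm_game_norm]
lemmas game_norm_0 [simp] = cstar_seminorm_zero[OF cstar_seminorm_game_norm]
lemmas game_norm_star [simp] = cstar_seminorm_nc_star[OF cstar_seminorm_game_norm]
lemmas game_norm_minus [simp] = cstar_seminorm_minus[OF cstar_seminorm_game_norm]

lemma game_norm_add: "gn (f + g) \<le> gn f + gn g"
  and game_norm_mult: "gn (f * g) \<le> gn f * gn g"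
  and game_norm_smult: "gn (nc_smult c f) = cmod c * gn f"
  using cstar_seminorm_game_norm unfolding cstar_seminorm_def by blast+

lemma game_norm_diff_commute: "gn (f - g) = gn (g - f)"
  using game_norm_minus[of "g - f"] by simp

lemma game_norm_diff_diff: "gn ((f + g) - (f' + g')) \<le> gn (f - f') + gn (g - g')"
  using game_norm_add[of "f - f'" "g - g'"] by (simp add: algebra_simps)

lemma game_norm_triangle: "gn (f - h) \<le> gn (f - g) + gn (g - h)"
  using game_norm_add[of "f - g" "g - h"] by simp

lemma game_norm_mult_diff: "gn (f * g - f' * g') \<le> gn f * gn (g - g') + gn (f - f') * gn g'"
proof -
  have "f * g - f' * g' = f * (g - g') + (f - f') * g'" by (simp add: algebra_simps)
  then have "gn (f * g - f' * g') \<le> gn (f * (g - g')) + gn ((f - f') * g')"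
    using game_norm_add by simp
  then show ?thesis using game_norm_mult[of f "g - g'"] game_norm_mult[of "f - f'" g'] by linarith
qed

lemma game_CauchyD:
  "game_Cauchy lam u \<Longrightarrow> 0 < e \<Longrightarrow> \<exists>M. \<forall>m\<ge>M. \<forall>n\<ge>M. gn (u m - u n) < e"
  by (simp add: game_Cauchy_def)

text \<open>The epsilon argument shared by all algebraic operations on Cauchy sequences.\<close>

lemma game_Cauchy_dominated:
  assumes "game_Cauchy lam u" "game_Cauchy lam v" "0 \<le> K"
    and le: "\<And>m n. gn (w m - w n) \<le> K * gn (u m - u n) + K * gn (v m - v n)"
  shows "game_Cauchy lam w"
  unfolding game_Cauchy_def
proof (intro allI impI)
  fix e :: real assume "0 < e"
  define d where "d = e / (2 * (K + 1))"
  have d: "0 < d" using \<open>0 < e\<close> \<open>0 \<le> K\<close> by (simp add: d_def)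
  have "d * (2 * (K + 1)) = e"
    using \<open>0 \<le> K\<close> nonzero_eq_divide_eq[of "2 * (K + 1)" d e] by (simp add: d_def)
  then have e: "e = (K + 1) * d + (K + 1) * d" by (simp add: algebra_simps)
  obtain M1 M2 where M: "\<And>m n. m \<ge> M1 \<Longrightarrow> n \<ge> M1 \<Longrightarrow> gn (u m - u n) < d"
      "\<And>m n. m \<ge> M2 \<Longrightarrow> n \<ge> M2 \<Longrightarrow> gn (v m - v n) < d"
    using game_CauchyD[OF assms(1) d] game_CauchyD[OF assms(2) d] by blast
  have "gn (w m - w n) < e" if "m \<ge> max M1 M2" "n \<ge> max M1 M2" for m n
  proof -
    have "gn (w m - w n) \<le> (K + 1) * gn (u m - u n) + (K + 1) * gn (v m - v n)"
      using le[of m n] game_norm_nonneg[of "u m - u n"] game_norm_nonneg[of "v m - v n"]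
      unfolding distrib_right by linarith
    also have "\<dots> < e"
      unfolding e using M that \<open>0 \<le> K\<close> by (intro add_strict_mono mult_strict_left_mono) auto
    finally show ?thesis .
  qed
  then show "\<exists>M. \<forall>m\<ge>M. \<forall>n\<ge>M. gn (w m - w n) < e" by blast
qed

lemma game_Cauchy_const [simp]: "game_Cauchy lam (\<lambda>_. f)"
  by (simp add: game_Cauchy_def)

lemma game_Cauchy_add:
  "game_Cauchy lam u \<Longrightarrow> game_Cauchy lam v \<Longrightarrow> game_Cauchy lam (\<lambda>n. u n + v n)"
  by (rule game_Cauchy_dominated[of u v 1]) (simp_all add: game_norm_diff_diff)

lemma nc_smult_diff: "nc_smult c f - nc_smult c g = nc_smult c (f - g)"
  by (simp add: nc_smult_eq right_diff_distrib)

lemma game_Cauchy_smult: "game_Cauchy lam u \<Longrightarrow> game_Cauchy lam (\<lambda>n. nc_smult c (u n))"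
  by (rule game_Cauchy_dominated[of u u "cmod c"]) (simp_all add: nc_smult_diff game_norm_smult)

lemma game_Cauchy_star: "game_Cauchy lam u \<Longrightarrow> game_Cauchy lam (\<lambda>n. nc_star (u n))"
  by (rule game_Cauchy_dominated[of u u 1]) (simp_all flip: nc_star_diff)

lemma game_Cauchy_bounded:
  assumes "game_Cauchy lam u"
  obtains K where "0 \<le> K" "\<And>n. gn (u n) \<le> K"
proof -
  have "Cauchy (\<lambda>n. gn (u n))"
  proof (rule CauchyI)
    fix e :: real assume "0 < e"
    then obtain M where M: "\<And>m n. m \<ge> M \<Longrightarrow> n \<ge> M \<Longrightarrow> gn (u m - u n) < e"
      using game_CauchyD[OF assms] by blast
    have "norm (gn (u m) - gn (u n)) < e" if "m \<ge> M" "n \<ge> M" for m n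
      using game_norm_add[of "u m - u n" "u n"] game_norm_add[of "u n - u m" "u m"] M[OF that]
        game_norm_diff_commute[of "u m" "u n"] by auto
    then show "\<exists>M. \<forall>m\<ge>M. \<forall>n\<ge>M. norm (gn (u m) - gn (u n)) < e" by blast
  qed
  then have "Bseq (\<lambda>n. gn (u n))" by (rule Cauchy_Bseq)
  then obtain K where "0 < K" "\<And>n. norm (gn (u n)) \<le> K" by (auto elim: BseqE)
  then show thesis using that[of K] by auto
qed

lemma game_Cauchy_mult:
  assumes "game_Cauchy lam u" "game_Cauchy lam v"
  shows "game_Cauchy lam (\<lambda>n. u n * v n)"
proof -
  obtain K L where K: "0 \<le> K" "\<And>n. gn (u n) \<le> K" and L: "0 \<le> L" "\<And>n. gn (v n) \<le> L"
    using game_Cauchy_bounded[OF assms(1)] game_Cauchy_bounded[OF assms(2)] by metis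
  show ?thesis
  proof (rule game_Cauchy_dominated[OF assms, of "K + L"])
    fix m n
    have "gn (u m) * gn (v m - v n) + gn (u m - u n) * gn (v n)
        \<le> (K + L) * gn (v m - v n) + gn (u m - u n) * (K + L)"
      using K(1) L(1) K(2)[of m] L(2)[of n] by (intro add_mono mult_mono) auto
    then show "gn (u m * v m - u n * v n) \<le> (K + L) * gn (u m - u n) + (K + L) * gn (v m - v n)"
      using game_norm_mult_diff[of "u m" "v m" "u n" "v n"] by (simp add: mult.commute)
  qed (use K L in auto)
qed

lemma game_relD:
  "(u, v) \<in> game_rel lam \<Longrightarrow> game_Cauchy lam u \<and> game_Cauchy lam v \<and> (\<lambda>n. gn (u n - v n)) \<longlonglongrightarrow> 0"
  by (simp add: game_rel_def)

lemma game_relI: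
  assumes "game_Cauchy lam u" "game_Cauchy lam v" "a \<longlonglongrightarrow> 0" "\<And>n. gn (u n - v n) \<le> a n"
  shows "(u, v) \<in> game_rel lam"
  using assms tendsto_sandwich[of "\<lambda>_. 0" "\<lambda>n. gn (u n - v n)" sequentially a 0]
  by (simp add: game_rel_def)

lemma equiv_game_rel: "equiv {u. game_Cauchy lam u} (game_rel lam)"
proof (rule equivI)
  show "game_rel lam \<subseteq> {u. game_Cauchy lam u} \<times> {u. game_Cauchy lam u}"
    by (auto simp: game_rel_def)
  show "refl_on {u. game_Cauchy lam u} (game_rel lam)"
    by (auto simp: refl_on_def game_rel_def)
  show "sym (game_rel lam)"
    by (auto simp: sym_def game_rel_def game_norm_diff_commute)
  show "trans (game_rel lam)"
  proof (rule transI)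
    fix u v w assume uv: "(u, v) \<in> game_rel lam" and vw: "(v, w) \<in> game_rel lam"
    show "(u, w) \<in> game_rel lam"
    proof (rule game_relI)
      show "(\<lambda>n. gn (u n - v n) + gn (v n - w n)) \<longlonglongrightarrow> 0"
        using tendsto_add[of "\<lambda>n. gn (u n - v n)" 0 sequentially "\<lambda>n. gn (v n - w n)" 0]
          game_relD[OF uv] game_relD[OF vw] by simp
    qed (use game_relD[OF uv] game_relD[OF vw] game_norm_triangle in auto)
  qed
qed

definition game_class :: "(nat \<Rightarrow> ('x, 'y, 'a, 'b) generator ncpoly) \<Rightarrow> _" where
  "game_class u = game_rel lam `` {u}"

lemma carrier_game_cstar_algebra: "carrier (game_cstar_algebra lam) = game_class ` {u. game_Cauchy lam u}"
  by (auto simp: game_cstar_algebra_def game_class_def quotient_def)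

lemma game_class_eq_iff:
  assumes "game_Cauchy lam u" "game_Cauchy lam v"
  shows "game_class u = game_class v \<longleftrightarrow> (u, v) \<in> game_rel lam"
  using eq_equiv_class_iff[OF equiv_game_rel, of u v] assms by (simp add: game_class_def)

lemma mem_cls: "u' \<in> game_class u \<longleftrightarrow> (u, u') \<in> game_rel lam"
  by (simp add: game_class_def)

lemma game_class_self: "game_Cauchy lam u \<Longrightarrow> u \<in> game_class u"
  by (simp add: mem_cls game_rel_def)

text \<open>
  The operations of the game algebra are unions over all representatives. When the operation respects
  the equivalence, all members of the union coincide, so one representative computes the result.
\<close>

lemma game_class_lift:
  assumes u: "game_Cauchy lam u"
    and F: "\<And>u'. (u, u') \<in> game_rel lam \<Longrightarrow> (F u, F u') \<in> game_rel lam"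
  shows "(\<Union>u'\<in>game_class u. game_rel lam `` {F u'}) = game_class (F u)"
proof -
  have "game_rel lam `` {F u'} = game_class (F u)" if "u' \<in> game_class u" for u'
    using equiv_class_eq[OF equiv_game_rel F[of u']] that by (simp add: mem_cls game_class_def)
  then show ?thesis using game_class_self[OF u] by blast
qed

lemma game_class_lift2:
  assumes u: "game_Cauchy lam u" "game_Cauchy lam v"
    and F: "\<And>u' v'. (u, u') \<in> game_rel lam \<Longrightarrow> (v, v') \<in> game_rel lam \<Longrightarrow> (F u v, F u' v') \<in> game_rel lam"
  shows "(\<Union>u'\<in>game_class u. \<Union>v'\<in>game_class v. game_rel lam `` {F u' v'}) = game_class (F u v)"
proof -
  have "game_rel lam `` {F u' v'} = game_class (F u v)" if "u' \<in> game_class u" "v' \<in> game_class v" for u' v'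
    using equiv_class_eq[OF equiv_game_rel F[of u' v']] that by (simp add: mem_cls game_class_def)
  then show ?thesis using game_class_self[OF u(1)] game_class_self[OF u(2)] by blast
qed

lemma game_class_one: "\<one>\<^bsub>game_cstar_algebra lam\<^esub> = game_class (\<lambda>_. 1)"
  and game_class_zero: "\<zero>\<^bsub>game_cstar_algebra lam\<^esub> = game_class (\<lambda>_. 0)"
  by (simp_all add: game_cstar_algebra_def game_class_def)

lemma game_class_add:
  assumes "game_Cauchy lam u" "game_Cauchy lam v"
  shows "game_class u \<oplus>\<^bsub>game_cstar_algebra lam\<^esub> game_class v = game_class (\<lambda>n. u n + v n)"
proof -
  have "((\<lambda>n. u n + v n), (\<lambda>n. u' n + v' n)) \<in> game_rel lam"
    if "(u, u') \<in> game_rel lam" "(v, v') \<in> game_rel lam" for u' v'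
  proof (rule game_relI)
    show "(\<lambda>n. gn (u n - u' n) + gn (v n - v' n)) \<longlonglongrightarrow> 0"
      using that[THEN game_relD] by (auto intro: tendsto_add_zero)
  qed (use that[THEN game_relD] game_norm_diff_diff in \<open>auto intro: game_Cauchy_add\<close>)
  then show ?thesis
    using game_class_lift2[OF assms, of "\<lambda>u v n. u n + v n"] by (simp add: game_cstar_algebra_def)
qed

lemma game_class_mult:
  assumes "game_Cauchy lam u" "game_Cauchy lam v"
  shows "game_class u \<otimes>\<^bsub>game_cstar_algebra lam\<^esub> game_class v = game_class (\<lambda>n. u n * v n)"
proof -
  have "((\<lambda>n. u n * v n), (\<lambda>n. u' n * v' n)) \<in> game_rel lam"
    if rel: "(u, u') \<in> game_rel lam" "(v, v') \<in> game_rel lam" for u' v'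
  proof -
    obtain K where K: "0 \<le> K" "\<And>n. gn (u n) \<le> K"
      using game_Cauchy_bounded[OF assms(1)] by metis
    obtain L where L: "0 \<le> L" "\<And>n. gn (v' n) \<le> L"
      using game_Cauchy_bounded[of v'] game_relD[OF rel(2)] by metis
    show ?thesis
    proof (rule game_relI)
      show "(\<lambda>n. K * gn (v n - v' n) + gn (u n - u' n) * L) \<longlonglongrightarrow> 0"
        using rel[THEN game_relD]
        by (auto intro: tendsto_add_zero tendsto_mult_right_zero tendsto_mult_left_zero)
      fix n
      have "gn (u n) * gn (v n - v' n) + gn (u n - u' n) * gn (v' n)
          \<le> K * gn (v n - v' n) + gn (u n - u' n) * L"
        using K L by (intro add_mono mult_right_mono mult_left_mono) auto
      then show "gn (u n * v n - u' n * v' n) \<le> K * gn (v n - v' n) + gn (u n - u' n) * L"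
        using game_norm_mult_diff[of "u n" "v n" "u' n" "v' n"] by linarith
    qed (use rel[THEN game_relD] in \<open>auto intro: game_Cauchy_mult\<close>)
  qed
  then show ?thesis
    using game_class_lift2[OF assms, of "\<lambda>u v n. u n * v n"] by (simp add: game_cstar_algebra_def)
qed

lemma game_class_smult:
  assumes "game_Cauchy lam u"
  shows "c \<odot>\<^bsub>game_cstar_algebra lam\<^esub> game_class u = game_class (\<lambda>n. nc_smult c (u n))"
proof -
  have "((\<lambda>n. nc_smult c (u n)), (\<lambda>n. nc_smult c (u' n))) \<in> game_rel lam"
    if "(u, u') \<in> game_rel lam" for u'
  proof (rule game_relI)
    show "(\<lambda>n. cmod c * gn (u n - u' n)) \<longlonglongrightarrow> 0"
      using that[THEN game_relD] by (auto intro: tendsto_mult_right_zero)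
  qed (use that[THEN game_relD] in \<open>auto intro: game_Cauchy_smult simp: nc_smult_diff game_norm_smult\<close>)
  then show ?thesis
    using game_class_lift[OF assms, of "\<lambda>u n. nc_smult c (u n)"] by (simp add: game_cstar_algebra_def)
qed

lemma game_class_star:
  assumes "game_Cauchy lam u"
  shows "star (game_cstar_algebra lam) (game_class u) = game_class (\<lambda>n. nc_star (u n))"
proof -
  have "((\<lambda>n. nc_star (u n)), (\<lambda>n. nc_star (u' n))) \<in> game_rel lam"
    if "(u, u') \<in> game_rel lam" for u'
  proof (rule game_relI)
    show "(\<lambda>n. gn (u n - u' n)) \<longlonglongrightarrow> 0"
      using that[THEN game_relD] by auto
  qed (use that[THEN game_relD] in \<open>auto intro: game_Cauchy_star simp flip: nc_star_diff\<close>)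
  then show ?thesis
    using game_class_lift[OF assms, of "\<lambda>u n. nc_star (u n)"] by (simp add: game_cstar_algebra_def)
qed

text \<open>
  Restriction to constant sequences. A polynomial of game norm 0 becomes equal to 0 in the game algebra,
  and multiples of relations are such polynomials.
\<close>

lemma game_trace_if_tracial_state:
  assumes "tracial_state (game_cstar_algebra lam) \<tau>"
  shows "game_trace lam (\<lambda>f. \<tau> (game_class (\<lambda>_. f)))"
proof -
  have C: "game_class (\<lambda>_. f) \<in> carrier (game_cstar_algebra lam)" for f
    by (simp add: carrier_game_cstar_algebra)
  note \<tau> = assms[unfolded tracial_state_def]
  have add: "\<tau> (game_class (\<lambda>_. f + g)) = \<tau> (game_class (\<lambda>_. f)) + \<tau> (game_class (\<lambda>_. g))" for f g
    using \<tau> C game_class_add[of "\<lambda>_. f" "\<lambda>_. g"] by (metis game_Cauchy_const)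
  have zero: "\<tau> (game_class (\<lambda>_. f)) = 0" if "gn f = 0" for f
  proof -
    have "game_class (\<lambda>_. f) = game_class (\<lambda>_. 0)"
      using that by (simp add: game_class_eq_iff game_rel_def)
    then show ?thesis using add[of 0 0] by simp
  qed
  show ?thesis
  proof
    show "\<tau> (game_class (\<lambda>_. f + g)) = \<tau> (game_class (\<lambda>_. f)) + \<tau> (game_class (\<lambda>_. g))" for f g by (rule add)
    show "\<tau> (game_class (\<lambda>_. nc_smult c f)) = c * \<tau> (game_class (\<lambda>_. f))" for c f
      using \<tau> C game_class_smult[of "\<lambda>_. f" c] by (metis game_Cauchy_const)
    have "game_class (\<lambda>_. nc_star f * f) = star (game_cstar_algebra lam) (game_class (\<lambda>_. f))
        \<otimes>\<^bsub>game_cstar_algebra lam\<^esub> game_class (\<lambda>_. f)" for f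
      by (simp add: game_class_star game_class_mult)
    then show "\<tau> (game_class (\<lambda>_. nc_star f * f)) \<in> \<real>" "0 \<le> Re (\<tau> (game_class (\<lambda>_. nc_star f * f)))" for f
      using \<tau> C by simp_all
    show "\<tau> (game_class (\<lambda>_. 1)) = 1"
      using \<tau> by (simp add: game_class_one)
    show "\<tau> (game_class (\<lambda>_. f * g)) = \<tau> (game_class (\<lambda>_. g * f))" for f g
      using \<tau> C game_class_mult[of "\<lambda>_. f" "\<lambda>_. g"] game_class_mult[of "\<lambda>_. g" "\<lambda>_. f"]
      by (metis game_Cauchy_const)
    fix r f assume "r \<in> game_relations lam"
    then have "gn (r * f) = 0"
      using game_norm_mult[of r f] game_norm_relation[of r] by (simp add: order_antisym)
    then show "\<tau> (game_class (\<lambda>_. r * f)) = 0" by (rule zero)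
  qed
qed

text \<open>
  Extension by continuity: along a Cauchy sequence the values of \<open>\<phi>\<close> converge, since \<open>\<phi>\<close> is dominated
  by the game norm, and equivalent sequences have the same limit. So the representative chosen in the
  definition of \<open>\<tau>\<close> is immaterial, and the identities for \<open>\<tau>\<close> are limits of those for \<open>\<phi>\<close>.
\<close>

lemma tracial_state_if_game_trace:
  assumes "game_trace lam \<phi>"
  shows "\<exists>\<tau>. tracial_state (game_cstar_algebra lam) \<tau>"
proof -
  interpret game_trace lam \<phi> by (fact assms)
  define \<tau> where "\<tau> U = lim (\<lambda>n. \<phi> ((SOME u. u \<in> U) n))" for U
  have conv: "convergent (\<lambda>n. \<phi> (u n))" if u: "game_Cauchy lam u" for u
  proof -
    have "Cauchy (\<lambda>n. \<phi> (u n))"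
    proof (rule CauchyI)
      fix e :: real assume "0 < e"
      then obtain M where M: "\<And>m n. m \<ge> M \<Longrightarrow> n \<ge> M \<Longrightarrow> gn (u m - u n) < e"
        using game_CauchyD[OF u] by blast
      have "norm (\<phi> (u m) - \<phi> (u n)) < e" if "m \<ge> M" "n \<ge> M" for m n
        using phi_le_game_norm[of "u m - u n"] M[OF that] by (simp add: phi_diff)
      then show "\<exists>M. \<forall>m\<ge>M. \<forall>n\<ge>M. norm (\<phi> (u m) - \<phi> (u n)) < e" by blast
    qed
    then show ?thesis by (simp add: Cauchy_convergent_iff)
  qed
  have \<tau>: "(\<lambda>n. \<phi> (u n)) \<longlonglongrightarrow> \<tau> (game_class u)" if u: "game_Cauchy lam u" for u
  proof -
    define v where "v = (SOME v. v \<in> game_class u)"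
    have "v \<in> game_class u" unfolding v_def by (rule someI[of _ u]) (rule game_class_self[OF u])
    then have v: "game_Cauchy lam v" "(\<lambda>n. gn (u n - v n)) \<longlonglongrightarrow> 0"
      using game_relD by (auto simp: mem_cls)
    have "norm (\<phi> (u n) - \<phi> (v n)) \<le> gn (u n - v n)" for n
      using phi_le_game_norm[of "u n - v n"] by (simp add: phi_diff)
    then have "(\<lambda>n. \<phi> (u n) - \<phi> (v n)) \<longlonglongrightarrow> 0"
      by (intro tendsto_0_le[OF v(2), of _ 1]) simp
    moreover have "(\<lambda>n. \<phi> (v n)) \<longlonglongrightarrow> \<tau> (game_class u)"
      using conv[OF v(1)] by (simp add: \<tau>_def v_def convergent_LIMSEQ_iff)
    ultimately show ?thesis using tendsto_add by fastforce
  qed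
  have "tracial_state (game_cstar_algebra lam) \<tau>"
    unfolding tracial_state_def carrier_game_cstar_algebra
  proof (intro conjI ballI allI; clarsimp simp: game_class_add game_class_smult game_class_star game_class_mult game_class_one game_Cauchy_star)
    show "\<tau> (game_class (\<lambda>_. 1)) = 1"
      using \<tau>[of "\<lambda>_. 1"] by (simp add: phi_one LIMSEQ_const_iff)
  next
    fix u v assume uv: "game_Cauchy lam u" "game_Cauchy lam v"
    show "\<tau> (game_class (\<lambda>n. u n + v n)) = \<tau> (game_class u) + \<tau> (game_class v)"
      using LIMSEQ_unique[OF \<tau>[OF game_Cauchy_add[OF uv]]] tendsto_add[OF \<tau>[OF uv(1)] \<tau>[OF uv(2)]]
      by (simp add: phi_add)
    show "\<tau> (game_class (\<lambda>n. u n * v n)) = \<tau> (game_class (\<lambda>n. v n * u n))"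
      using LIMSEQ_unique[OF \<tau>[OF game_Cauchy_mult[OF uv]]] \<tau>[OF game_Cauchy_mult[OF uv(2,1)]]
      by (simp add: phi_trace[of "u _"])
  next
    fix u assume u: "game_Cauchy lam u"
    show "\<tau> (game_class (\<lambda>n. nc_smult c (u n))) = c * \<tau> (game_class u)" for c
      using LIMSEQ_unique[OF \<tau>[OF game_Cauchy_smult[OF u]]] tendsto_mult_left[OF \<tau>[OF u]]
      by (simp add: phi_smult)
    have lim: "(\<lambda>n. \<phi> (nc_star (u n) * u n)) \<longlonglongrightarrow> \<tau> (game_class (\<lambda>n. nc_star (u n) * u n))"
      by (rule \<tau>[OF game_Cauchy_mult[OF game_Cauchy_star[OF u] u]])
    show "\<tau> (game_class (\<lambda>n. nc_star (u n) * u n)) \<in> \<real>"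
      using tendsto_Im[OF lim] phi_pos(1) by (simp add: complex_is_Real_iff LIMSEQ_const_iff)
    show "0 \<le> Re (\<tau> (game_class (\<lambda>n. nc_star (u n) * u n)))"
      using tendsto_Re[OF lim] by (rule LIMSEQ_le_const) (simp add: phi_pos)
  qed
  then show ?thesis by blast
qed

lemma carrier_nonzero_if_tracial_state:
  assumes \<tau>: "tracial_state (game_cstar_algebra lam) \<tau>"
  shows "carrier (game_cstar_algebra lam) \<noteq> {\<zero>\<^bsub>game_cstar_algebra lam\<^esub>}"
proof
  assume "carrier (game_cstar_algebra lam) = {\<zero>\<^bsub>game_cstar_algebra lam\<^esub>}"
  moreover have "game_class (\<lambda>_. 1) \<in> carrier (game_cstar_algebra lam)"
    by (simp add: carrier_game_cstar_algebra)
  ultimately have "game_class (\<lambda>_. 1) = game_class (\<lambda>_. 0)" by (simp add: game_class_zero)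
  moreover have "\<tau> (game_class (\<lambda>_. 1)) = 1"
    using \<tau> by (simp add: tracial_state_def game_class_one)
  moreover interpret game_trace lam "\<lambda>f. \<tau> (game_class (\<lambda>_. f))"
    by (rule game_trace_if_tracial_state[OF \<tau>])
  have "\<tau> (game_class (\<lambda>_. 0)) = 0" by (rule phi_0)
  ultimately show False by simp
qed

end

theorem tracial_state_iff_game_trace:
  "(\<exists>\<tau>. tracial_state (game_cstar_algebra lam) \<tau>) \<longleftrightarrow> (\<exists>\<phi>. game_trace lam \<phi>)"
  using game_trace_if_tracial_state tracial_state_if_game_trace by blast

section \<open>Self-adjoint operators and projections\<close>

lemma complex_ring_simps [simp]:
  "carrier complex_ring = UNIV" "\<one>\<^bsub>complex_ring\<^esub> = 1" "\<zero>\<^bsub>complex_ring\<^esub> = 0"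
  "a \<otimes>\<^bsub>complex_ring\<^esub> b = a * b" "a \<oplus>\<^bsub>complex_ring\<^esub> b = a + b"
  by (simp_all add: complex_ring_def)

definition self_adjoint :: "('v, 'm) inner_module_scheme \<Rightarrow> ('v \<Rightarrow> 'v) \<Rightarrow> bool" where
  "self_adjoint H T \<longleftrightarrow> (\<forall>v\<in>carrier H. T v \<in> carrier H) \<and>
     (\<forall>u\<in>carrier H. \<forall>v\<in>carrier H. cinner H (T u) v = cinner H u (T v))"

lemma self_adjointD:
  assumes "self_adjoint H T"
  shows "v \<in> carrier H \<Longrightarrow> T v \<in> carrier H"
    and "u \<in> carrier H \<Longrightarrow> v \<in> carrier H \<Longrightarrow> cinner H (T u) v = cinner H u (T v)"
  using assms by (auto simp: self_adjoint_def)

lemma self_adjoint_funpow: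
  assumes "self_adjoint H T" shows "self_adjoint H (T ^^ k)"
proof (induction k)
  case (Suc k)
  then show ?case
    using assms unfolding self_adjoint_def by (simp add: funpow_swap1)
qed (simp add: self_adjoint_def)

lemma projectionD:
  assumes "projection H T"
  shows "self_adjoint H T" "v \<in> carrier H \<Longrightarrow> T (T v) = T v"
  using assms by (auto simp: projection_def bounded_operator_def self_adjoint_def)

context complex_hilbert_space
begin

lemma smult_mem [simp]: "v \<in> carrier H \<Longrightarrow> c \<odot> v \<in> carrier H"
  by (rule smult_closed) simp_all

lemma cinner_add_left:
  "\<lbrakk>u \<in> carrier H; v \<in> carrier H; w \<in> carrier H\<rbrakk> \<Longrightarrow> cinner H (u \<oplus> v) w = cinner H u w + cinner H v w"
  using cinner_add[of w u v] by (simp add: cinner_commute[of _ w])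

lemma cinner_smult_left:
  "\<lbrakk>u \<in> carrier H; v \<in> carrier H\<rbrakk> \<Longrightarrow> cinner H (c \<odot> u) v = cnj c * cinner H u v"
  using cinner_smult[of v u c] by (simp add: cinner_commute[of _ v])

lemma cinner_zero_right [simp]: "u \<in> carrier H \<Longrightarrow> cinner H u \<zero> = 0"
  using cinner_add[of u \<zero> \<zero>] by simp

lemma cinner_zero_left [simp]: "u \<in> carrier H \<Longrightarrow> cinner H \<zero> u = 0"
  using cinner_add_left[of \<zero> \<zero> u] by simp

lemma cinner_minus_right: "\<lbrakk>u \<in> carrier H; v \<in> carrier H\<rbrakk> \<Longrightarrow> cinner H u (\<ominus> v) = - cinner H u v"
  using cinner_add[of u v "\<ominus> v"] by (simp add: M.r_neg eq_neg_iff_add_eq_0 add.commute)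

lemma cinner_diff_right:
  "\<lbrakk>u \<in> carrier H; v \<in> carrier H; w \<in> carrier H\<rbrakk> \<Longrightarrow> cinner H u (v \<ominus> w) = cinner H u v - cinner H u w"
  by (simp add: M.minus_eq cinner_add cinner_minus_right)

lemma cinner_diff_left:
  "\<lbrakk>u \<in> carrier H; v \<in> carrier H; w \<in> carrier H\<rbrakk> \<Longrightarrow> cinner H (v \<ominus> w) u = cinner H v u - cinner H w u"
  using cinner_diff_right[of u v w] by (simp add: cinner_commute[of _ u])

text \<open>
  Identities between vectors and operators are verified weakly, against all test vectors; this avoids
  computing in the module and turns limits of operators into limits of numbers.
\<close>

lemma cinner_ext:
  assumes "u \<in> carrier H" "v \<in> carrier H" "\<And>z. z \<in> carrier H \<Longrightarrow> cinner H z u = cinner H z v"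
  shows "u = v"
proof -
  have "cinner H (u \<ominus> v) (u \<ominus> v) = 0"
    using assms by (simp add: cinner_diff_right)
  then have "u \<ominus> v = \<zero>" using assms by (intro cinner_definite) auto
  then have "u \<oplus> \<ominus> v = \<zero>" using assms by (simp add: M.minus_eq)
  then have "\<ominus> (\<ominus> v) = u" using assms by (intro M.minus_equality) auto
  then show ?thesis using assms by simp
qed

lemma cinner_finsum:
  "\<lbrakk>u \<in> carrier H; F \<in> A \<rightarrow> carrier H; finite A\<rbrakk> \<Longrightarrow> cinner H u (finsum H F A) = (\<Sum>i\<in>A. cinner H u (F i))"
  by (rotate_tac 2, induction A rule: finite_induct)
    (auto simp: Pi_def cinner_add M.finsum_insert intro!: M.finsum_closed)

lemma cinner_finsum_left:
  "\<lbrakk>u \<in> carrier H; F \<in> A \<rightarrow> carrier H; finite A\<rbrakk> \<Longrightarrow> cinner H (finsum H F A) u = (\<Sum>i\<in>A. cinner H (F i) u)"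
  using cinner_finsum[of u F A]
  by (subst cinner_commute) (auto simp: Pi_def cinner_commute[of _ u] intro!: M.finsum_closed sum.cong)

lemma cinner_self: "v \<in> carrier H \<Longrightarrow> Im (cinner H v v) = 0"
  using cinner_commute[of v v] by (simp add: complex_eq_iff)

lemma hnorm_nonneg [simp]: "v \<in> carrier H \<Longrightarrow> 0 \<le> hnorm H v"
  by (simp add: hnorm_def cinner_nonneg)

lemma hnorm_sq: "v \<in> carrier H \<Longrightarrow> (hnorm H v)\<^sup>2 = Re (cinner H v v)"
  by (simp add: hnorm_def cinner_nonneg)

lemma cinner_eq_hnorm: "v \<in> carrier H \<Longrightarrow> cinner H v v = complex_of_real ((hnorm H v)\<^sup>2)"
  by (simp add: hnorm_sq complex_eq_iff cinner_self)

lemma hnorm_add_smult_sq: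
  assumes "u \<in> carrier H" "v \<in> carrier H"
  shows "(hnorm H (u \<oplus> c \<odot> v))\<^sup>2 = (hnorm H u)\<^sup>2 + 2 * Re (c * cinner H u v) + (cmod c)\<^sup>2 * (hnorm H v)\<^sup>2"
proof -
  have "cinner H (u \<oplus> c \<odot> v) (u \<oplus> c \<odot> v)
      = cinner H u u + c * cinner H u v + cnj (c * cinner H u v) + complex_of_real ((cmod c)\<^sup>2) * cinner H v v"
    using assms
    by (simp add: cinner_add cinner_add_left cinner_smult cinner_smult_left cinner_commute[of v u]
        algebra_simps complex_norm_square del: of_real_power)
  then have "Re (cinner H (u \<oplus> c \<odot> v) (u \<oplus> c \<odot> v))
      = Re (cinner H u u) + 2 * Re (c * cinner H u v) + (cmod c)\<^sup>2 * Re (cinner H v v)"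
    by simp
  then show ?thesis using assms by (simp add: hnorm_sq)
qed

lemma hnorm_diff_sq:
  assumes "u \<in> carrier H" "v \<in> carrier H"
  shows "(hnorm H (u \<ominus> v))\<^sup>2 = (hnorm H u)\<^sup>2 - 2 * Re (cinner H u v) + (hnorm H v)\<^sup>2"
  using assms cinner_commute[of v u] by (simp add: hnorm_sq cinner_diff_right cinner_diff_left)

lemma Cauchy_Schwarz:
  assumes "u \<in> carrier H" "v \<in> carrier H"
  shows "cmod (cinner H u v) \<le> hnorm H u * hnorm H v"
proof -
  have "(cmod (cinner H u v))\<^sup>2 \<le> (hnorm H u)\<^sup>2 * (hnorm H v)\<^sup>2"
    by (rule discriminant_le) (simp_all only: hnorm_add_smult_sq[OF assms, symmetric] zero_le_power2)
  then show ?thesis using assms by (simp flip: power_mult_distrib add: power_mono_iff)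
qed

lemma cinner_tendsto:
  assumes "\<And>n. s n \<in> carrier H" "v \<in> carrier H" "z \<in> carrier H" "(\<lambda>n. hnorm H (s n \<ominus> v)) \<longlonglongrightarrow> 0"
  shows "(\<lambda>n. cinner H z (s n)) \<longlonglongrightarrow> cinner H z v"
proof -
  have "norm (cinner H z (s n) - cinner H z v) \<le> norm (hnorm H (s n \<ominus> v)) * hnorm H z" for n
    using Cauchy_Schwarz[of z "s n \<ominus> v"] assms by (simp add: cinner_diff_right mult.commute)
  then show ?thesis
    using tendsto_0_le[OF assms(4), of "\<lambda>n. cinner H z (s n) - cinner H z v" "hnorm H z"]
    by (simp add: LIM_zero_iff)
qed

lemma self_adjoint_zero:
  assumes "self_adjoint H T" shows "T \<zero> = \<zero>"
proof (rule cinner_ext)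
  show "T \<zero> \<in> carrier H" using self_adjointD(1)[OF assms] by simp
  fix z assume "z \<in> carrier H"
  then show "cinner H z (T \<zero>) = cinner H z \<zero>"
    using self_adjointD[OF assms] by (metis M.zero_closed cinner_zero_right)
qed simp

text \<open>
  Linearity and boundedness come for free: an everywhere defined operator with an adjoint is linear,
  and \<open>\<parallel>T v\<parallel>\<^sup>2 = \<langle>v, T v\<rangle>\<close> together with Cauchy-Schwarz bounds it by 1.
\<close>

lemma projectionI:
  assumes T: "self_adjoint H T" and idem: "\<And>v. v \<in> carrier H \<Longrightarrow> T (T v) = T v"
  shows "projection H T"
proof -
  note [simp] = self_adjointD(1)[OF T]
  note adj = self_adjointD(2)[OF T, symmetric]
  have "T (u \<oplus> v) = T u \<oplus> T v" if "u \<in> carrier H" "v \<in> carrier H" for u v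
    by (rule cinner_ext) (use that in \<open>simp_all add: adj cinner_add\<close>)
  moreover have "T (c \<odot> v) = c \<odot> T v" if "v \<in> carrier H" for c v
    by (rule cinner_ext) (use that in \<open>simp_all add: adj cinner_smult\<close>)
  moreover have "hnorm H (T v) \<le> 1 * hnorm H v" if v: "v \<in> carrier H" for v
  proof -
    have "hnorm H (T v) * hnorm H (T v) = Re (cinner H v (T v))"
      using v hnorm_sq[of "T v"] adj[of v "T v"] by (simp add: idem power2_eq_square)
    also have "\<dots> \<le> hnorm H v * hnorm H (T v)"
      using Cauchy_Schwarz[of v "T v"] complex_Re_le_cmod[of "cinner H v (T v)"] v by simp
    finally show ?thesis using v hnorm_nonneg[of "T v"] hnorm_nonneg[of v]
      by (auto simp: mult_le_cancel_right simp del: hnorm_nonneg)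
  qed
  ultimately have "bounded_operator H T"
    unfolding bounded_operator_def by (intro conjI ballI allI exI[of _ 1]) simp_all
  then show ?thesis
    unfolding projection_def using idem self_adjointD(2)[OF T] by simp
qed

lemma PVM_cinner:
  assumes "PVM H E" "v \<in> carrier H" "z \<in> carrier H"
  shows "(\<Sum>i\<in>UNIV. cinner H z (E i v)) = cinner H z v"
proof -
  have "E i v \<in> carrier H" for i
    using assms by (auto simp: PVM_def dest!: spec[of _ i] projectionD(1) intro: self_adjointD)
  then have "cinner H z (\<Oplus>i\<in>UNIV. E i v) = (\<Sum>i\<in>UNIV. cinner H z (E i v))"
    using assms by (intro cinner_finsum) auto
  then show ?thesis using assms by (simp add: PVM_def)
qed

text \<open>
  If \<open>T\<^sup>2 \<le> T \<le> 1\<close> in the sense of forms, the numbers \<open>a k = \<langle>v, T\<^sup>k v\<rangle>\<close> decrease and are nonnegative,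
  hence converge. As \<open>\<parallel>T\<^sup>m v - T\<^sup>n v\<parallel>\<^sup>2 = a (2 m) - 2 a (m + n) + a (2 n)\<close>, the powers converge strongly.
\<close>

lemma power_limit:
  assumes T: "self_adjoint H T"
    and le: "\<And>v. v \<in> carrier H \<Longrightarrow> Re (cinner H (T v) (T v)) \<le> Re (cinner H v (T v))"
      "\<And>v. v \<in> carrier H \<Longrightarrow> Re (cinner H v (T v)) \<le> Re (cinner H v v)"
    and v: "v \<in> carrier H"
  shows "\<exists>w\<in>carrier H. \<forall>z\<in>carrier H. (\<lambda>k. cinner H z ((T ^^ k) v)) \<longlonglongrightarrow> cinner H z w"
proof -
  have Tk: "self_adjoint H (T ^^ k)" for k by (rule self_adjoint_funpow[OF T])
  have mem [simp]: "(T ^^ k) v \<in> carrier H" for k by (rule self_adjointD(1)[OF Tk v])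
  define a where "a k = Re (cinner H v ((T ^^ k) v))" for k
  have inner: "Re (cinner H ((T ^^ m) v) ((T ^^ n) v)) = a (m + n)" for m n
    using self_adjointD(2)[OF Tk[of m] v mem[of n]] by (simp add: a_def funpow_add)
  \<comment> \<open>the two form inequalities at the vector \<open>T\<^sup>k v\<close>\<close>
  have dec: "a (2 * k + 1) \<le> a (2 * k)" "a (2 * k + 2) \<le> a (2 * k + 1)" "0 \<le> a (2 * k)" for k
    using le[of "(T ^^ k) v"] cinner_nonneg[OF mem[of k]] inner[of k k] inner[of k "Suc k"] inner[of "Suc k" "Suc k"]
    by (simp_all add: mult_2)
  have "a (Suc k) \<le> a k \<and> 0 \<le> a k" for k
  proof (cases "even k")
    case True
    then obtain j where "k = 2 * j" by (elim evenE)
    then show ?thesis using dec[of j] by simp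
  next
    case False
    then obtain j where "k = 2 * j + 1" by (elim oddE)
    then show ?thesis using dec[of j] dec(3)[of "Suc j"] by simp
  qed
  then have "decseq a" "\<And>k. 0 \<le> a k" by (simp_all add: decseq_Suc_iff)
  then obtain L where "a \<longlonglongrightarrow> L" using decseq_convergent[of a 0] by metis
  then have a_Cauchy: "Cauchy a" by (rule LIMSEQ_imp_Cauchy)
  have "\<exists>w\<in>carrier H. (\<lambda>k. hnorm H ((T ^^ k) v \<ominus> w)) \<longlonglongrightarrow> 0"
  proof (rule complete)
    show "\<forall>e>0. \<exists>N. \<forall>m\<ge>N. \<forall>n\<ge>N. hnorm H ((T ^^ m) v \<ominus> (T ^^ n) v) < e"
    proof (intro allI impI)
      fix e :: real assume e: "0 < e"
      then obtain M where M: "\<And>m n. m \<ge> M \<Longrightarrow> n \<ge> M \<Longrightarrow> norm (a m - a n) < e\<^sup>2 / 2"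
        using CauchyD[OF a_Cauchy, of "e\<^sup>2 / 2"] by auto
      have "hnorm H ((T ^^ m) v \<ominus> (T ^^ n) v) < e" if "m \<ge> M" "n \<ge> M" for m n
      proof -
        have "(hnorm H ((T ^^ m) v \<ominus> (T ^^ n) v))\<^sup>2 = a (m + m) - 2 * a (m + n) + a (n + n)"
          using hnorm_diff_sq[of "(T ^^ m) v" "(T ^^ n) v"] by (simp add: hnorm_sq inner)
        also have "\<dots> < e\<^sup>2"
          using M[of "m + m" "m + n", OF trans_le_add1 trans_le_add1] that
            M[of "n + n" "m + n", OF trans_le_add1 trans_le_add1] unfolding real_norm_def by linarith
        finally show ?thesis using e by (simp add: power2_less_imp_less)
      qed
      then show "\<exists>N. \<forall>m\<ge>N. \<forall>n\<ge>N. hnorm H ((T ^^ m) v \<ominus> (T ^^ n) v) < e" by blast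
    qed
  qed simp
  then show ?thesis using cinner_tendsto[of "\<lambda>k. (T ^^ k) v"] by auto
qed

text \<open>
  The projection \<open>R\<close> onto the intersection of the kernels of finitely many projections, obtained as the
  strong limit of the powers of \<open>T = 1 - \<kappa> (\<Sum>i. Q i)\<close>. Being a limit of polynomials in the \<open>Q i\<close>, it
  commutes with every self-adjoint operator that commutes with all \<open>Q i\<close>; this replaces the statement
  that \<open>R\<close> lies in the von Neumann algebra generated by the \<open>Q i\<close>.
\<close>

lemma common_kernel_projection:
  fixes Q :: "'i \<Rightarrow> 'v \<Rightarrow> 'v"
  assumes fin: "finite I" and Q: "\<And>i. i \<in> I \<Longrightarrow> projection H (Q i)"
  shows "\<exists>R. self_adjoint H R \<and>
    (\<forall>v\<in>carrier H. R (R v) = R v) \<and>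
    (\<forall>i\<in>I. \<forall>v\<in>carrier H. R (Q i v) = \<zero>) \<and>
    (\<forall>v\<in>carrier H. (\<forall>i\<in>I. Q i v = \<zero>) \<longrightarrow> R v = v) \<and>
    (\<forall>C. self_adjoint H C \<longrightarrow> (\<forall>i\<in>I. \<forall>v\<in>carrier H. C (Q i v) = Q i (C v)) \<longrightarrow>
       (\<forall>v\<in>carrier H. C (R v) = R (C v)))"
proof -
  note Q_adj = projectionD(1)[OF Q]
  note Q_idem = projectionD(2)[OF Q]
  have Q_mem [simp]: "i \<in> I \<Longrightarrow> v \<in> carrier H \<Longrightarrow> Q i v \<in> carrier H" for i v
    using self_adjointD(1)[OF Q_adj] by blast
  \<comment> \<open>small enough for \<open>\<kappa> (\<Sum>i. Q i) \<le> 1\<close>; the summand 1 covers the empty family\<close>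
  define \<kappa> :: real where "\<kappa> = 1 / (real (card I) + 1)"
  have \<kappa>: "0 < \<kappa>" "\<kappa> * real (card I) \<le> 1" by (auto simp: \<kappa>_def field_simps)
  define D where "D v = complex_of_real \<kappa> \<odot> (\<Oplus>i\<in>I. Q i v)" for v
  define T where "T v = v \<ominus> D v" for v
  have D_mem [simp]: "D v \<in> carrier H" if "v \<in> carrier H" for v
    unfolding D_def using that by (intro smult_mem M.finsum_closed) auto
  have T_mem [simp]: "T v \<in> carrier H" if "v \<in> carrier H" for v
    using that by (simp add: T_def)
  have cinner_D: "cinner H z (D v) = \<kappa> * (\<Sum>i\<in>I. cinner H z (Q i v))"
    if "z \<in> carrier H" "v \<in> carrier H" for z v
    using that fin by (simp add: D_def cinner_smult cinner_finsum Pi_def)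
  have cinner_D_left: "cinner H (D z) v = \<kappa> * (\<Sum>i\<in>I. cinner H z (Q i v))"
    if "z \<in> carrier H" "v \<in> carrier H" for z v
  proof -
    have "cinner H (D z) v = cnj (cinner H v (D z))" using that by (intro cinner_commute) auto
    also have "\<dots> = \<kappa> * (\<Sum>i\<in>I. cinner H (Q i z) v)"
      using that by (simp add: cinner_D cinner_commute[of "Q _ z" v])
    finally show ?thesis using that by (simp add: self_adjointD(2)[OF Q_adj])
  qed
  have T_adj: "self_adjoint H T"
    unfolding self_adjoint_def
    by (simp add: T_def cinner_diff_right cinner_diff_left cinner_D cinner_D_left)
  have Re_D: "Re (cinner H v (D v)) = \<kappa> * (\<Sum>i\<in>I. (hnorm H (Q i v))\<^sup>2)" if "v \<in> carrier H" for v
  proof -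
    have "cinner H v (Q i v) = cinner H (Q i v) (Q i v)" if "i \<in> I" for i
      using \<open>v \<in> carrier H\<close> that by (simp add: self_adjointD(2)[OF Q_adj] Q_idem)
    then show ?thesis using that by (simp add: cinner_D hnorm_sq)
  qed
  \<comment> \<open>\<open>D\<^sup>2 \<le> D\<close>, which is what makes \<open>T\<^sup>2 \<le> T\<close>: expand one factor of \<open>\<langle>D v, D v\<rangle>\<close> and use
    \<open>2 Re \<langle>x, y\<rangle> \<le> \<parallel>x\<parallel>\<^sup>2 + \<parallel>y\<parallel>\<^sup>2\<close> in each summand\<close>
  have D_sq: "(hnorm H (D v))\<^sup>2 \<le> Re (cinner H v (D v))" if v: "v \<in> carrier H" for v
  proof -
    have "Re (cinner H (D v) (Q i v)) \<le> ((hnorm H (D v))\<^sup>2 + (hnorm H (Q i v))\<^sup>2) / 2" if "i \<in> I" for i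
      using hnorm_diff_sq[of "D v" "Q i v"] zero_le_power2[of "hnorm H (D v \<ominus> Q i v)"] v that by simp
    then have "(\<Sum>i\<in>I. Re (cinner H (D v) (Q i v))) \<le> (\<Sum>i\<in>I. ((hnorm H (D v))\<^sup>2 + (hnorm H (Q i v))\<^sup>2) / 2)"
      by (rule sum_mono)
    also have "\<dots> = (real (card I) * (hnorm H (D v))\<^sup>2 + (\<Sum>i\<in>I. (hnorm H (Q i v))\<^sup>2)) / 2"
      by (simp add: sum.distrib flip: sum_divide_distrib)
    finally have "\<kappa> * (\<Sum>i\<in>I. Re (cinner H (D v) (Q i v)))
        \<le> \<kappa> * ((real (card I) * (hnorm H (D v))\<^sup>2 + (\<Sum>i\<in>I. (hnorm H (Q i v))\<^sup>2)) / 2)"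
      using \<kappa> by (intro mult_left_mono) auto
    also have "\<dots> = (\<kappa> * real (card I)) * (hnorm H (D v))\<^sup>2 / 2 + Re (cinner H v (D v)) / 2"
      by (simp add: Re_D[OF v] algebra_simps add_divide_distrib)
    also have "(\<kappa> * real (card I)) * (hnorm H (D v))\<^sup>2 \<le> 1 * (hnorm H (D v))\<^sup>2"
      using \<kappa>(2) by (rule mult_right_mono) simp
    finally have "\<kappa> * (\<Sum>i\<in>I. Re (cinner H (D v) (Q i v))) \<le> (hnorm H (D v))\<^sup>2 / 2 + Re (cinner H v (D v)) / 2"
      by simp
    moreover have "(hnorm H (D v))\<^sup>2 = \<kappa> * (\<Sum>i\<in>I. Re (cinner H (D v) (Q i v)))"
      using v by (simp add: hnorm_sq cinner_D[of "D v"])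
    ultimately show ?thesis by simp
  qed
  have T_le: "Re (cinner H (T v) (T v)) \<le> Re (cinner H v (T v))" if "v \<in> carrier H" for v
    using hnorm_diff_sq[of v "D v"] D_sq[of v] that by (simp add: T_def hnorm_sq cinner_diff_right)
  have T_le': "Re (cinner H v (T v)) \<le> Re (cinner H v v)" if "v \<in> carrier H" for v
    using that \<kappa> by (simp add: T_def cinner_diff_right Re_D sum_nonneg)
  define R where "R v = (SOME w. w \<in> carrier H \<and>
      (\<forall>z\<in>carrier H. (\<lambda>k. cinner H z ((T ^^ k) v)) \<longlonglongrightarrow> cinner H z w))" for v
  have R: "R v \<in> carrier H \<and> (\<forall>z\<in>carrier H. (\<lambda>k. cinner H z ((T ^^ k) v)) \<longlonglongrightarrow> cinner H z (R v))"
    if "v \<in> carrier H" for v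
    unfolding R_def using power_limit[OF T_adj T_le T_le' that] by (intro someI_ex[of "\<lambda>w. w \<in> carrier H \<and> _ w"]) blast
  have R_mem [simp]: "R v \<in> carrier H" if "v \<in> carrier H" for v using R[OF that] by blast
  have lim: "(\<lambda>k. cinner H z ((T ^^ k) v)) \<longlonglongrightarrow> cinner H z (R v)"
    if "v \<in> carrier H" "z \<in> carrier H" for v z using R that by blast
  note Tk = self_adjoint_funpow[OF T_adj]
  note Tk_mem [simp] = self_adjointD(1)[OF Tk]
  have R_commutes: "C (R v) = R (C v)"
    if C: "self_adjoint H C" and CT: "\<And>v. v \<in> carrier H \<Longrightarrow> C (T v) = T (C v)" and v: "v \<in> carrier H" for C v
  proof (rule cinner_ext)
    fix z assume z: "z \<in> carrier H"
    note C_mem = self_adjointD(1)[OF C]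
    have "C ((T ^^ k) v) = (T ^^ k) (C v)" for k
      by (induction k) (simp_all add: CT v)
    then have "(\<lambda>k. cinner H (C z) ((T ^^ k) v)) = (\<lambda>k. cinner H z ((T ^^ k) (C v)))"
      using z v by (simp add: self_adjointD(2)[OF C])
    moreover have "(\<lambda>k. cinner H (C z) ((T ^^ k) v)) \<longlonglongrightarrow> cinner H z (C (R v))"
      using lim[of v "C z"] z v C_mem by (simp add: self_adjointD(2)[OF C])
    moreover have "(\<lambda>k. cinner H z ((T ^^ k) (C v))) \<longlonglongrightarrow> cinner H z (R (C v))"
      using lim[of "C v" z] z v C_mem by simp
    ultimately show "cinner H z (C (R v)) = cinner H z (R (C v))"
      using LIMSEQ_unique by metis
  qed (use v self_adjointD(1)[OF C] in auto)
  have R_adj: "self_adjoint H R"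
    unfolding self_adjoint_def
  proof (intro conjI ballI)
    fix u v assume uv: "u \<in> carrier H" "v \<in> carrier H"
    have "(\<lambda>k. cnj (cinner H v ((T ^^ k) u))) \<longlonglongrightarrow> cnj (cinner H v (R u))"
      using lim[of u v] uv by (intro tendsto_cnj)
    moreover have "cnj (cinner H v ((T ^^ k) u)) = cinner H u ((T ^^ k) v)" for k
      using uv cinner_commute[of "(T ^^ k) u" v] by (simp add: self_adjointD(2)[OF Tk])
    moreover have "cnj (cinner H v (R u)) = cinner H (R u) v"
      using uv cinner_commute[of "R u" v] by simp
    ultimately show "cinner H (R u) v = cinner H u (R v)"
      using LIMSEQ_unique[OF _ lim[of v u]] uv by simp
  qed simp
  \<comment> \<open>\<open>R v\<close> is fixed by \<open>T\<close>, so \<open>\<langle>R v, D (R v)\<rangle> = 0\<close>, a sum of the nonnegative terms \<open>\<kappa> \<parallel>Q i (R v)\<parallel>\<^sup>2\<close>\<close>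
  have TR: "T (R v) = R v" if v: "v \<in> carrier H" for v
  proof (rule cinner_ext)
    fix z assume z: "z \<in> carrier H"
    have "(\<lambda>k. cinner H z ((T ^^ Suc k) v)) \<longlonglongrightarrow> cinner H z (T (R v))"
      using lim[of v "T z"] z v by (simp add: self_adjointD(2)[OF T_adj])
    then show "cinner H z (T (R v)) = cinner H z (R v)"
      using LIMSEQ_unique[OF _ LIMSEQ_Suc[OF lim[of v z]]] z v by simp
  qed (use v in auto)
  have QR: "Q i (R v) = \<zero>" if i: "i \<in> I" and v: "v \<in> carrier H" for i v
  proof -
    have "cinner H (R v) (T (R v)) = cinner H (R v) (R v)" using TR[OF v] by simp
    then have "Re (cinner H (R v) (D (R v))) = 0"
      using v by (simp add: T_def cinner_diff_right)
    then have "(\<Sum>i\<in>I. (hnorm H (Q i (R v)))\<^sup>2) = 0"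
      using v \<kappa> by (simp add: Re_D)
    then have "hnorm H (Q i (R v)) = 0"
      using i fin by (simp add: sum_nonneg_eq_0_iff)
    then show ?thesis
      using i v cinner_eq_hnorm[of "Q i (R v)"] by (intro cinner_definite) auto
  qed
  have R_fix: "R v = v" if v: "v \<in> carrier H" and ker: "\<forall>i\<in>I. Q i v = \<zero>" for v
  proof (rule cinner_ext)
    fix z assume z: "z \<in> carrier H"
    have "T v = v"
    proof (rule cinner_ext)
      fix z assume "z \<in> carrier H"
      then show "cinner H z (T v) = cinner H z v"
        using v ker by (simp add: T_def cinner_diff_right cinner_D)
    qed (use v in auto)
    then have "(T ^^ k) v = v" for k by (induction k) simp_all
    then show "cinner H z (R v) = cinner H z v"
      using lim[of v z] v z by (simp add: LIMSEQ_const_iff)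
  qed (use v in auto)
  have RQ: "R (Q i v) = \<zero>" if "i \<in> I" "v \<in> carrier H" for i v
  proof (rule cinner_ext)
    fix z assume z: "z \<in> carrier H"
    have "cinner H z (R (Q i v)) = cinner H (Q i (R z)) v"
      using that z by (simp add: self_adjointD(2)[OF R_adj] self_adjointD(2)[OF Q_adj])
    then show "cinner H z (R (Q i v)) = cinner H z \<zero>"
      using QR[of i z] that z by simp
  qed (use that in auto)
  have RC: "C (R v) = R (C v)"
    if C: "self_adjoint H C" and CQ: "\<forall>i\<in>I. \<forall>v\<in>carrier H. C (Q i v) = Q i (C v)"
      and v: "v \<in> carrier H" for C v
  proof (rule R_commutes[OF C _ v])
    fix v assume v: "v \<in> carrier H"
    note [simp] = self_adjointD(1)[OF C]
    show "C (T v) = T (C v)"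
    proof (rule cinner_ext)
      fix z assume z: "z \<in> carrier H"
      have "cinner H (C z) (Q i v) = cinner H z (Q i (C v))" if "i \<in> I" for i
        using CQ that z v by (simp add: self_adjointD(2)[OF C])
      then show "cinner H z (C (T v)) = cinner H z (T (C v))"
        using z v by (simp add: T_def cinner_diff_right cinner_D self_adjointD(2)[OF C]
          flip: self_adjointD(2)[OF C, of z "v \<ominus> D v"])
    qed (use v in auto)
  qed
  show ?thesis
  proof (intro exI[of _ R] conjI ballI allI impI)
    show "R (R v) = R v" if "v \<in> carrier H" for v
      using that by (intro R_fix) (simp_all add: QR)
  qed (fact R_adj RQ R_fix RC)+
qed

end

section \<open>From a perfect strategy to a trace\<close>

definition linear_extension :: "('g nc_word \<Rightarrow> complex) \<Rightarrow> 'g ncpoly \<Rightarrow> complex" where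
  "linear_extension F f = (\<Sum>w\<in>Poly_Mapping.keys f. Poly_Mapping.lookup f w * F w)"

lemma linear_extension_superset:
  "finite K \<Longrightarrow> Poly_Mapping.keys f \<subseteq> K \<Longrightarrow>
    linear_extension F f = (\<Sum>w\<in>K. Poly_Mapping.lookup f w * F w)"
  unfolding linear_extension_def by (rule sum.mono_neutral_left) (auto simp: in_keys_iff)

lemma linear_extension_add: "linear_extension F (f + g) = linear_extension F f + linear_extension F g"
proof -
  let ?K = "Poly_Mapping.keys f \<union> Poly_Mapping.keys g"
  have "Poly_Mapping.keys (f + g) \<subseteq> ?K" by (rule Poly_Mapping.keys_add)
  then show ?thesis
    by (simp add: linear_extension_superset[of ?K] lookup_add distrib_right sum.distrib)
qed

lemma linear_extension_smult: "linear_extension F (nc_smult c f) = c * linear_extension F f"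
proof -
  have "Poly_Mapping.keys (nc_smult c f) \<subseteq> Poly_Mapping.keys f"
    by (auto simp: in_keys_iff lookup_nc_smult)
  then show ?thesis
    by (simp add: linear_extension_superset[of "Poly_Mapping.keys f"] lookup_nc_smult sum_distrib_left mult.assoc)
qed

lemma linear_extension_single: "linear_extension F (Poly_Mapping.single w c) = c * F w"
  by (cases "c = 0") (simp_all add: linear_extension_def)

lemma linear_extension_zero: "linear_extension F 0 = 0"
  by (simp add: linear_extension_def)

lemma linear_extension_sum: "linear_extension F (sum G I) = (\<Sum>i\<in>I. linear_extension F (G i))"
  by (induction I rule: infinite_finite_induct) (simp_all add: linear_extension_add linear_extension_zero)

lemma linear_extension_minus: "linear_extension F (- f) = - linear_extension F f"
  using linear_extension_smult[of F "-1" f] by (simp add: nc_smult_minus_1)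

lemma linear_extension_diff: "linear_extension F (f - g) = linear_extension F f - linear_extension F g"
  using linear_extension_add[of F f "- g"] by (simp add: linear_extension_minus)

lemma linear_extension_trace:
  assumes F: "\<And>v w. F (v + w) = F (w + v)"
  shows "linear_extension F (f * g) = linear_extension F (g * f)"
proof (induction f rule: ncpoly_induct)
  case (single v c)
  show ?case
    by (induction g rule: ncpoly_induct)
      (simp_all add: mult_single linear_extension_single F[of "Word v"] mult.commute
        distrib_left distrib_right linear_extension_add del: plus_nc_word.simps)
qed (simp add: distrib_left distrib_right linear_extension_add)

lemma linear_extension_vanishes_left:
  assumes "\<And>w. linear_extension F (r * Poly_Mapping.single (Word w) 1) = 0"
  shows "linear_extension F (r * f) = 0"
proof (induction f rule: ncpoly_induct)
  case (single w c)
  have "r * Poly_Mapping.single (Word w) c = nc_smult c (r * Poly_Mapping.single (Word w) 1)"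
    by (simp add: nc_smult_single flip: nc_smult_mult_right)
  then show ?case using assms by (simp add: linear_extension_smult)
qed (simp add: distrib_left linear_extension_add)

fun word_action :: "('g \<Rightarrow> 'v \<Rightarrow> 'v) \<Rightarrow> 'g nc_word \<Rightarrow> 'v \<Rightarrow> 'v" where
  "word_action T (Word w) v = foldr T w v"

lemma word_action_add: "word_action T (u + w) v = word_action T u (word_action T w v)"
  by (cases u; cases w) simp

lemma word_action_zero [simp]: "word_action T 0 v = v"
  by (simp add: zero_nc_word_def)

lemma word_action_gen [simp]: "word_action T (Word [g]) v = T g v"
  by simp

context complex_hilbert_space
begin

text \<open>
  Let \<open>R\<close> project onto the vectors killed by all \<open>F j k\<close> that are forbidden together with \<open>i\<close>. The vector
  \<open>E i \<xi>\<close> is such a vector, so \<open>R\<close> fixes it. For \<open>i' \<noteq> i\<close> take \<open>j\<close> that distinguishes \<open>i\<close> from \<open>i'\<close>: each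
  \<open>F j k\<close> is either annihilated by \<open>R\<close> or kills \<open>E i' \<xi>\<close>, and the \<open>F j k\<close> sum to 1, so \<open>R (E i' \<xi>) = 0\<close>.
  Summing over \<open>i'\<close> gives \<open>R \<xi> = E i \<xi>\<close>.
\<close>

lemma imitation_transfer:
  fixes E :: "'i::finite \<Rightarrow> 'v \<Rightarrow> 'v" and F :: "'j::finite \<Rightarrow> 'k::finite \<Rightarrow> 'v \<Rightarrow> 'v"
  assumes E: "PVM H E" and F: "\<And>j. PVM H (F j)" and \<xi>: "\<xi> \<in> carrier H"
    and comm: "\<And>i j k v. v \<in> carrier H \<Longrightarrow> E i (F j k v) = F j k (E i v)"
    and forbidden: "\<And>i j k. \<not> L i j k \<Longrightarrow> E i (F j k \<xi>) = \<zero>"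
    and distinguish: "\<And>i i'. i \<noteq> i' \<Longrightarrow> \<exists>j. \<forall>k. L i j k \<longrightarrow> \<not> L i' j k"
  shows "\<exists>R. self_adjoint H R \<and> (\<forall>v\<in>carrier H. R (R v) = R v) \<and> R \<xi> = E i \<xi> \<and>
    (\<forall>j k. \<not> L i j k \<longrightarrow> (\<forall>v\<in>carrier H. R (F j k v) = \<zero>)) \<and>
    (\<forall>C. self_adjoint H C \<longrightarrow> (\<forall>j k. \<forall>v\<in>carrier H. C (F j k v) = F j k (C v)) \<longrightarrow>
       (\<forall>v\<in>carrier H. C (R v) = R (C v)))"
proof -
  have F_proj: "projection H (F j k)" for j k using F by (simp add: PVM_def)
  have E_proj: "projection H (E i)" for i using E by (simp add: PVM_def)
  note [simp] = self_adjointD(1)[OF projectionD(1)[OF F_proj]] self_adjointD(1)[OF projectionD(1)[OF E_proj]]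
  let ?I = "{(j, k). \<not> L i j k}"
  obtain R where R: "self_adjoint H R" "\<forall>v\<in>carrier H. R (R v) = R v"
      and RF: "\<forall>m\<in>?I. \<forall>v\<in>carrier H. R (F (fst m) (snd m) v) = \<zero>"
      and fix_R: "\<forall>v\<in>carrier H. (\<forall>m\<in>?I. F (fst m) (snd m) v = \<zero>) \<longrightarrow> R v = v"
      and RC: "\<forall>C. self_adjoint H C \<longrightarrow>
        (\<forall>m\<in>?I. \<forall>v\<in>carrier H. C (F (fst m) (snd m) v) = F (fst m) (snd m) (C v)) \<longrightarrow>
        (\<forall>v\<in>carrier H. C (R v) = R (C v))"
    using common_kernel_projection[of ?I "\<lambda>m. F (fst m) (snd m)", OF finite F_proj]
    by (elim exE conjE) (rule that)
  have RF': "R (F j k v) = \<zero>" if "\<not> L i j k" "v \<in> carrier H" for j k v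
    using RF that by force
  note [simp] = self_adjointD(1)[OF R(1)]
  have other: "R (E i' \<xi>) = \<zero>" if ne: "i' \<noteq> i" for i'
  proof (rule cinner_ext)
    fix z assume z: "z \<in> carrier H"
    obtain j where j: "\<And>k. L i j k \<longrightarrow> \<not> L i' j k" using distinguish[OF ne[symmetric]] by blast
    have "R (F j k (E i' \<xi>)) = \<zero>" for k
    proof (cases "L i j k")
      case True
      then have "F j k (E i' \<xi>) = \<zero>" using j[of k] forbidden[of i' j k] comm[OF \<xi>, of i' j k] by simp
      then show ?thesis using self_adjoint_zero[OF R(1)] by simp
    qed (use RF' \<xi> in simp)
    then have "cinner H (R z) (F j k (E i' \<xi>)) = 0" for k
      using z \<xi> by (simp add: self_adjointD(2)[OF R(1)])
    then have "cinner H (R z) (E i' \<xi>) = 0"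
      using PVM_cinner[OF F, of "E i' \<xi>" "R z" j] z \<xi> by simp
    then show "cinner H z (R (E i' \<xi>)) = cinner H z \<zero>"
      using z \<xi> by (simp add: self_adjointD(2)[OF R(1)])
  qed (use \<xi> in auto)
  have same: "R (E i \<xi>) = E i \<xi>"
    using \<xi> forbidden by (intro fix_R[rule_format]) (auto simp: comm[OF \<xi>, symmetric])
  have "R \<xi> = E i \<xi>"
  proof (rule cinner_ext)
    fix z assume z: "z \<in> carrier H"
    have "cinner H z (R \<xi>) = (\<Sum>i'\<in>UNIV. cinner H z (R (E i' \<xi>)))"
      using PVM_cinner[OF E \<xi>, of "R z"] z \<xi> by (simp add: self_adjointD(2)[OF R(1)])
    also have "\<dots> = (\<Sum>i'\<in>UNIV. if i' = i then cinner H z (E i \<xi>) else 0)"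
      using z by (intro sum.cong) (auto simp: same other)
    finally show "cinner H z (R \<xi>) = cinner H z (E i \<xi>)" by simp
  qed (use \<xi> in auto)
  then show ?thesis
    using R RF' RC by (intro exI[of _ R] conjI) auto
qed

text \<open>
  The functional is the vector state of \<open>\<xi>\<close> on words in the operators \<open>T g\<close>. It is a trace because each
  \<open>T g\<close> agrees on \<open>\<xi>\<close> with a self-adjoint \<open>C g\<close> that commutes with all \<open>T h\<close>:
  \<open>\<langle>\<xi>, T g w \<xi>\<rangle> = \<langle>C g \<xi>, w \<xi>\<rangle> = \<langle>\<xi>, w (C g \<xi>)\<rangle> = \<langle>\<xi>, w (T g \<xi>)\<rangle>\<close>. The sums of the projections are only
  assumed to fix \<open>\<xi>\<close> itself; the trace property extends this to the whole relation.
\<close>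

lemma game_trace_of_mirrored_operators:
  fixes lam :: "'x::finite \<Rightarrow> 'y::finite \<Rightarrow> 'a::finite \<Rightarrow> 'b::finite \<Rightarrow> bool"
    and T C :: "('x, 'y, 'a, 'b) generator \<Rightarrow> 'v \<Rightarrow> 'v"
  assumes T: "\<And>g. self_adjoint H (T g)" and C: "\<And>g. self_adjoint H (C g)"
    and comm: "\<And>g h v. v \<in> carrier H \<Longrightarrow> C g (T h v) = T h (C g v)"
    and \<xi>: "\<xi> \<in> carrier H" "cinner H \<xi> \<xi> = 1" and mirror: "\<And>g. C g \<xi> = T g \<xi>"
    and idem: "\<And>g v. v \<in> carrier H \<Longrightarrow> T g (T g v) = T g v"
    and forbidden: "\<And>x y a b v. \<not> lam x y a b \<Longrightarrow> v \<in> carrier H \<Longrightarrow> T (GenP x a) (T (GenQ y b) v) = \<zero>"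
    and sumP: "\<And>x z. z \<in> carrier H \<Longrightarrow> (\<Sum>a\<in>UNIV. cinner H z (T (GenP x a) \<xi>)) = cinner H z \<xi>"
    and sumQ: "\<And>y z. z \<in> carrier H \<Longrightarrow> (\<Sum>b\<in>UNIV. cinner H z (T (GenQ y b) \<xi>)) = cinner H z \<xi>"
  shows "\<exists>\<phi>. game_trace lam \<phi>"
proof -
  define F where "F w = cinner H \<xi> (word_action T w \<xi>)" for w
  define \<phi> where "\<phi> = linear_extension F"
  note [simp] = self_adjointD(1)[OF T] self_adjointD(1)[OF C] \<xi>(1)
  have mem [simp]: "word_action T w v \<in> carrier H" if "v \<in> carrier H" for w v
  proof -
    obtain l where "w = Word l" by (cases w)
    moreover have "foldr T l v \<in> carrier H" by (induction l) (simp_all add: that)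
    ultimately show ?thesis by simp
  qed
  have adj: "cinner H (word_action T (rev_word w) u) v = cinner H u (word_action T w v)"
    if "u \<in> carrier H" "v \<in> carrier H" for w u v
  proof -
    obtain l where l: "w = Word l" by (cases w)
    have "cinner H (foldr T (rev l) u) v = cinner H u (foldr T l v)"
      using that(1)
    proof (induction l arbitrary: u)
      case (Cons g l)
      have "foldr T l v \<in> carrier H" using mem[of v "Word l"] that by simp
      then show ?case using Cons by (simp add: self_adjointD(2)[OF T])
    qed simp
    then show ?thesis by (simp add: l)
  qed
  have C_act: "C g (word_action T w v) = word_action T w (C g v)" if "v \<in> carrier H" for g w v
  proof -
    obtain l where l: "w = Word l" by (cases w)
    have "foldr T l v \<in> carrier H \<and> C g (foldr T l v) = foldr T l (C g v)"
      by (induction l) (simp_all add: that comm)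
    then show ?thesis by (simp add: l)
  qed
  \<comment> \<open>moving one letter from the front of a word to its end\<close>
  have F_gen: "F (Word [g] + w) = F (w + Word [g])" for g w
  proof -
    have "F (Word [g] + w) = cinner H (C g \<xi>) (word_action T w \<xi>)"
      by (simp add: F_def word_action_add mirror self_adjointD(2)[OF T] del: plus_nc_word.simps word_action.simps)
    also have "\<dots> = cinner H \<xi> (C g (word_action T w \<xi>))"
      by (rule self_adjointD(2)[OF C]) simp_all
    also have "\<dots> = cinner H \<xi> (word_action T w (T g \<xi>))"
      by (simp only: C_act \<xi>(1) mirror)
    also have "\<dots> = F (w + Word [g])"
      by (simp add: F_def word_action_add del: plus_nc_word.simps)
    finally show ?thesis .
  qed
  have F_trace: "F (v + w) = F (w + v)" for v w
  proof -
    obtain l where "v = Word l" by (cases v)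
    moreover have "F (Word l + w) = F (w + Word l)"
    proof (induction l arbitrary: w)
      case Nil
      show ?case by (simp flip: zero_nc_word_def)
    next
      case (Cons g l)
      have gl: "Word (g # l) = Word [g] + Word l" by simp
      have "F (Word (g # l) + w) = F (Word [g] + (Word l + w))" unfolding gl by (simp only: add.assoc)
      also have "\<dots> = F (Word l + (w + Word [g]))" by (simp only: F_gen add.assoc)
      also have "\<dots> = F (w + Word (g # l))" unfolding gl by (simp only: Cons add.assoc)
      finally show ?case .
    qed
    ultimately show ?thesis by simp
  qed
  have \<phi>_trace: "\<phi> (f * g) = \<phi> (g * f)" for f g
    unfolding \<phi>_def by (rule linear_extension_trace) (rule F_trace)
  have \<phi>_single: "\<phi> (gen g * Poly_Mapping.single w c) = c * F (Word [g] + w)"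
    "\<phi> (Poly_Mapping.single w c) = c * F w" for g w c
    by (simp_all add: gen_def mult_single \<phi>_def linear_extension_single del: plus_nc_word.simps)
  have \<phi>_pos: "\<phi> (nc_star f * f) \<in> \<real> \<and> 0 \<le> Re (\<phi> (nc_star f * f))" for f
  proof -
    let ?K = "Poly_Mapping.keys f" and ?c = "Poly_Mapping.lookup f"
    \<comment> \<open>the vector obtained by applying the polynomial \<open>f\<close> in the operators \<open>T g\<close> to \<open>\<xi>\<close>\<close>
    define V where "V = (\<Oplus>w\<in>?K. ?c w \<odot> word_action T w \<xi>)"
    have V: "V \<in> carrier H" unfolding V_def by (rule M.finsum_closed) simp
    have "nc_star f * f = nc_star (\<Sum>v\<in>?K. Poly_Mapping.single v (?c v)) * (\<Sum>w\<in>?K. Poly_Mapping.single w (?c w))"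
      by (simp only: ncpoly_sum)
    also have "\<dots> = (\<Sum>v\<in>?K. \<Sum>w\<in>?K. Poly_Mapping.single (rev_word v + w) (cnj (?c v) * ?c w))"
      by (simp add: nc_star_sum nc_star_single sum_product mult_single)
    finally have "\<phi> (nc_star f * f) = (\<Sum>v\<in>?K. \<Sum>w\<in>?K. cnj (?c v) * ?c w * F (rev_word v + w))"
      by (simp add: \<phi>_def linear_extension_sum linear_extension_single)
    also have "\<dots> = (\<Sum>v\<in>?K. cnj (?c v) * (\<Sum>w\<in>?K. ?c w * cinner H (word_action T v \<xi>) (word_action T w \<xi>)))"
      using adj[of \<xi> _ "rev_word _"] by (simp add: F_def word_action_add sum_distrib_left mult.assoc)
    also have "\<dots> = (\<Sum>v\<in>?K. cnj (?c v) * cinner H (word_action T v \<xi>) V)"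
      by (simp add: V_def cinner_finsum cinner_smult)
    also have "\<dots> = cinner H V V"
      unfolding V_def[THEN arg_cong[of _ _ "\<lambda>u. cinner H u V"]]
      using V by (simp add: cinner_finsum_left cinner_smult_left)
    finally show ?thesis
      using V by (simp add: cinner_nonneg cinner_self complex_is_Real_iff)
  qed
  have \<phi>_rel: "\<phi> (r * f) = 0" if r: "r \<in> game_relations lam" for r f
    unfolding \<phi>_def
  proof (rule linear_extension_vanishes_left, fold \<phi>_def)
    fix l :: "('x, 'y, 'a, 'b) generator list"
    let ?w = "Poly_Mapping.single (Word l) 1 :: ('x, 'y, 'a, 'b) generator ncpoly"
    have \<phi>_lin: "\<phi> (f + g) = \<phi> f + \<phi> g" "\<phi> (f - g) = \<phi> f - \<phi> g" "\<phi> (sum G I) = (\<Sum>i\<in>I. \<phi> (G i))"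
      for f g G I
      by (simp_all add: \<phi>_def linear_extension_add linear_extension_diff linear_extension_sum)
    have sum_rel: "\<phi> (((\<Sum>i\<in>UNIV. gen (G i)) - 1) * ?w) = 0"
      if "\<And>z. z \<in> carrier H \<Longrightarrow> (\<Sum>i\<in>UNIV. cinner H z (T (G i) \<xi>)) = cinner H z \<xi>"
      for G :: "'i::finite \<Rightarrow> _"
    proof -
      have "\<phi> (((\<Sum>i\<in>UNIV. gen (G i)) - 1) * ?w) = (\<Sum>i\<in>UNIV. F (Word [G i] + Word l)) - F (Word l)"
        by (simp add: left_diff_distrib sum_distrib_right \<phi>_lin(2) \<phi>_lin(3)
            \<phi>_single del: plus_nc_word.simps)
      also have "(\<Sum>i\<in>UNIV. F (Word [G i] + Word l)) =
          (\<Sum>i\<in>UNIV. cinner H (word_action T (rev_word (Word l)) \<xi>) (T (G i) \<xi>))"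
        unfolding F_gen adj[OF \<xi>(1) self_adjointD(1)[OF T \<xi>(1)]]
        by (simp add: F_def word_action_add del: plus_nc_word.simps)
      also have "\<dots> = F (Word l)"
        by (subst that) (simp_all only: adj \<xi>(1) mem F_def)
      finally show ?thesis by simp
    qed
    from r consider g where "r = gen g * gen g - gen g"
      | x where "r = (\<Sum>a\<in>UNIV. polyP x a) - 1"
      | y where "r = (\<Sum>b\<in>UNIV. polyQ y b) - 1"
      | x y a b where "\<not> lam x y a b" "r = polyP x a * polyQ y b"
      unfolding game_relations_def by blast
    then show "\<phi> (r * ?w) = 0"
    proof cases
      case 1
      have "gen g * gen g * ?w = gen g * Poly_Mapping.single (Word [g] + Word l) 1"
        by (simp add: gen_def mult_single mult.assoc)
      then show ?thesis
        by (simp only: 1 left_diff_distrib \<phi>_lin(2) \<phi>_single)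
          (simp add: F_def word_action_add idem del: plus_nc_word.simps word_action.simps)
    next
      case 4
      have "polyP x a * polyQ y b * ?w = polyP x a * Poly_Mapping.single (Word [GenQ y b] + Word l) 1"
        by (simp add: gen_def mult_single mult.assoc)
      then show ?thesis
        by (simp only: 4 \<phi>_single)
          (simp add: F_def word_action_add forbidden 4 del: plus_nc_word.simps word_action.simps)
    qed (simp_all only: sum_rel sumP sumQ)
  qed
  have "game_trace lam \<phi>"
  proof
    show "\<phi> 1 = 1"
      by (simp only: single_one[symmetric] \<phi>_single) (simp add: F_def \<xi>)
  qed (use \<phi>_pos \<phi>_trace \<phi>_rel in
      \<open>auto simp: \<phi>_def linear_extension_add linear_extension_smult\<close>)
  then show ?thesis by blast
qed

end

lemma imitation_game_distinguish:
  assumes "imitation_game lam"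
  shows "a \<noteq> a' \<Longrightarrow> \<exists>y. \<forall>b. lam x y a b \<longrightarrow> \<not> lam x y a' b"
    and "b \<noteq> b' \<Longrightarrow> \<exists>x. \<forall>a. lam x y a b \<longrightarrow> \<not> lam x y a b'"
proof -
  show "\<exists>y. \<forall>b. lam x y a b \<longrightarrow> \<not> lam x y a' b" if "a \<noteq> a'"
  proof -
    have "\<exists>y. (\<Sum>b\<in>UNIV. of_bool (lam x y a b) * of_bool (lam x y a' b)) = (0::nat)"
      using assms that unfolding imitation_game_def by blast
    then show ?thesis by (auto simp: sum_eq_0_iff)
  qed
  show "\<exists>x. \<forall>a. lam x y a b \<longrightarrow> \<not> lam x y a b'" if "b \<noteq> b'"
  proof -
    have "\<exists>x. (\<Sum>a\<in>UNIV. of_bool (lam x y a b) * of_bool (lam x y a b')) = (0::nat)"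
      using assms that unfolding imitation_game_def by blast
    then show ?thesis by (auto simp: sum_eq_0_iff)
  qed
qed

text \<open>
  \<open>R\<close> is built from \<open>Q\<close>, and \<open>S\<close> from \<open>P\<close>. The generators are represented by \<open>R\<close> and \<open>Q\<close>, whose products
  vanish for forbidden outcomes; their mirror images are \<open>P\<close> and \<open>S\<close>. All commutation relations between
  the two sides reduce to the one between \<open>P\<close> and \<open>Q\<close>.
\<close>

theorem game_trace_if_perfect_qc_strategy:
  fixes lam :: "'x::finite \<Rightarrow> 'y::finite \<Rightarrow> 'a::finite \<Rightarrow> 'b::finite \<Rightarrow> bool"
  assumes imit: "imitation_game lam" and p: "p \<in> perfect_qc_strategies TYPE('v) lam"
  shows "\<exists>\<phi>. game_trace lam \<phi>"
proof -
  obtain H :: "'v inner_module" and \<xi> P Q where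
    "complex_hilbert_space H" and \<xi>: "\<xi> \<in> carrier H" "hnorm H \<xi> = 1"
    and P: "\<And>x. PVM H (P x)" and Q: "\<And>y. PVM H (Q y)"
    and PQ: "\<And>x y a b v. v \<in> carrier H \<Longrightarrow> P x a (Q y b v) = Q y b (P x a v)"
    and p_eq: "\<And>a b x y. complex_of_real (p a b x y) = cinner H \<xi> (P x a (Q y b \<xi>))"
    using p by (force simp: perfect_qc_strategies_def qc_correlations_def)
  interpret complex_hilbert_space H by fact
  have P_proj: "projection H (P x a)" and Q_proj: "projection H (Q y b)" for x y a b
    using P Q by (auto simp: PVM_def)
  note P_adj = projectionD(1)[OF P_proj] and Q_adj = projectionD(1)[OF Q_proj]
  note [simp] = self_adjointD(1)[OF P_adj] self_adjointD(1)[OF Q_adj] \<xi>(1)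
  \<comment> \<open>for commuting projections, \<open>\<langle>\<xi>, P Q \<xi>\<rangle>\<close> is the squared norm of \<open>P Q \<xi>\<close>\<close>
  have vanish: "P x a (Q y b \<xi>) = \<zero>\<^bsub>H\<^esub>" if "\<not> lam x y a b" for x y a b
  proof -
    have "p a b x y = 0" using p that by (simp add: perfect_qc_strategies_def)
    then have "cinner H \<xi> (P x a (Q y b \<xi>)) = 0" using p_eq[of a b x y] by simp
    moreover have "cinner H (P x a (Q y b \<xi>)) (P x a (Q y b \<xi>)) = cinner H \<xi> (P x a (Q y b \<xi>))"
      by (simp add: self_adjointD(2)[OF P_adj] self_adjointD(2)[OF Q_adj] projectionD(2)[OF P_proj]
          projectionD(2)[OF Q_proj] flip: PQ)
    ultimately show ?thesis by (intro cinner_definite) auto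
  qed
  have vanish': "Q y b (P x a \<xi>) = \<zero>\<^bsub>H\<^esub>" if "\<not> lam x y a b" for x y a b
    using vanish[OF that] PQ[OF \<xi>(1)] by simp
  define good_R where "good_R x a R \<longleftrightarrow>
    self_adjoint H R \<and> (\<forall>v\<in>carrier H. R (R v) = R v) \<and> R \<xi> = P x a \<xi> \<and>
    (\<forall>y b. \<not> lam x y a b \<longrightarrow> (\<forall>v\<in>carrier H. R (Q y b v) = \<zero>\<^bsub>H\<^esub>)) \<and>
    (\<forall>C. self_adjoint H C \<longrightarrow> (\<forall>y b. \<forall>v\<in>carrier H. C (Q y b v) = Q y b (C v)) \<longrightarrow>
       (\<forall>v\<in>carrier H. C (R v) = R (C v)))" for x a R
  have "\<exists>R. good_R x a R" for x a
    unfolding good_R_def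
    by (rule imitation_transfer[of "P x" Q \<xi> "\<lambda>a y b. lam x y a b" a])
      (simp_all add: P Q PQ vanish' imitation_game_distinguish(1)[OF imit])
  then obtain R where good_R: "\<And>x a. good_R x a (R x a)" by metis
  have R: "self_adjoint H (R x a)" "v \<in> carrier H \<Longrightarrow> R x a (R x a v) = R x a v" "R x a \<xi> = P x a \<xi>"
      "\<not> lam x y a b \<Longrightarrow> v \<in> carrier H \<Longrightarrow> R x a (Q y b v) = \<zero>\<^bsub>H\<^esub>" for x a y b v
    using good_R[of x a] unfolding good_R_def by blast+
  have R_commutes: "C (R x a v) = R x a (C v)"
    if "self_adjoint H C" "\<And>y b v. v \<in> carrier H \<Longrightarrow> C (Q y b v) = Q y b (C v)" "v \<in> carrier H" for x a C v
    using good_R[of x a] that unfolding good_R_def by simp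
  define good_S where "good_S y b S \<longleftrightarrow>
    self_adjoint H S \<and> (\<forall>v\<in>carrier H. S (S v) = S v) \<and> S \<xi> = Q y b \<xi> \<and>
    (\<forall>x a. \<not> lam x y a b \<longrightarrow> (\<forall>v\<in>carrier H. S (P x a v) = \<zero>\<^bsub>H\<^esub>)) \<and>
    (\<forall>C. self_adjoint H C \<longrightarrow> (\<forall>x a. \<forall>v\<in>carrier H. C (P x a v) = P x a (C v)) \<longrightarrow>
       (\<forall>v\<in>carrier H. C (S v) = S (C v)))" for y b S
  have "\<exists>S. good_S y b S" for y b
    unfolding good_S_def
    by (rule imitation_transfer[of "Q y" P \<xi> "\<lambda>b x a. lam x y a b" b])
      (simp_all add: P Q vanish imitation_game_distinguish(2)[OF imit] flip: PQ)
  then obtain S where good_S: "\<And>y b. good_S y b (S y b)" by metis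
  have S: "self_adjoint H (S y b)" "S y b \<xi> = Q y b \<xi>" for y b
    using good_S[of y b] unfolding good_S_def by blast+
  have S_commutes: "C (S y b v) = S y b (C v)"
    if "self_adjoint H C" "\<And>x a v. v \<in> carrier H \<Longrightarrow> C (P x a v) = P x a (C v)" "v \<in> carrier H" for y b C v
    using good_S[of y b] that unfolding good_S_def by simp
  have PR: "P x' a' (R x a v) = R x a (P x' a' v)" if "v \<in> carrier H" for x a x' a' v
    using that by (intro R_commutes) (simp_all add: P_adj PQ)
  have QS: "Q y' b' (S y b v) = S y b (Q y' b' v)" if "v \<in> carrier H" for y b y' b' v
    using that by (intro S_commutes) (simp_all add: Q_adj PQ)
  have SR: "S y b (R x a v) = R x a (S y b v)" if "v \<in> carrier H" for x a y b v
    using that by (intro R_commutes) (simp_all add: S QS)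
  define T where "T g = (case g of GenP x a \<Rightarrow> R x a | GenQ y b \<Rightarrow> Q y b)" for g
  define C where "C g = (case g of GenP x a \<Rightarrow> P x a | GenQ y b \<Rightarrow> S y b)" for g
  show ?thesis
  proof (rule game_trace_of_mirrored_operators[of T C \<xi> lam])
    show "cinner H \<xi> \<xi> = 1" by (simp add: cinner_eq_hnorm \<xi>)
    show "C g (T h v) = T h (C g v)" if "v \<in> carrier H" for g h v
      using that by (auto simp: C_def T_def PR PQ QS SR split: generator.splits)
  qed (auto simp: T_def C_def R S P_adj Q_adj projectionD(2)[OF Q_proj] PVM_cinner[OF P] PVM_cinner[OF Q]
      split: generator.splits)
qed

section \<open>The Hilbert space of square-summable sequences\<close>

text \<open>
  Sequences are supported in \<open>I\<close>, which will be the set of indices at which the Gram-Schmidt process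
  produces a basis vector.
\<close>

definition ell2 :: "nat set \<Rightarrow> (nat \<Rightarrow> complex) set" where
  "ell2 I = {v. (\<forall>n. n \<notin> I \<longrightarrow> v n = 0) \<and> summable (\<lambda>n. (cmod (v n))\<^sup>2)}"

definition ell2_inner :: "(nat \<Rightarrow> complex) \<Rightarrow> (nat \<Rightarrow> complex) \<Rightarrow> complex" where
  "ell2_inner u v = (suminf (\<lambda>n. cnj (u n) * v n))"

text \<open>
  The vectors are placed in the second summand, so that the space exists for every choice of the type
  \<open>'h\<close>.
\<close>

definition ell2_space :: "nat set \<Rightarrow> ('h + (nat \<Rightarrow> complex)) inner_module" where
  "ell2_space I = \<lparr>carrier = Inr ` ell2 I, mult = undefined, one = undefined, zero = Inr (\<lambda>_. 0),
     add = (\<lambda>u v. Inr (\<lambda>n. projr u n + projr v n)), smult = (\<lambda>c v. Inr (\<lambda>n. c * projr v n)),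
     cinner = (\<lambda>u v. ell2_inner (projr u) (projr v))\<rparr>"

lemma ell2_space_simps [simp]:
  "carrier (ell2_space I) = Inr ` ell2 I"
  "\<zero>\<^bsub>ell2_space I\<^esub> = Inr (\<lambda>_. 0)"
  "u \<oplus>\<^bsub>ell2_space I\<^esub> v = Inr (\<lambda>n. projr u n + projr v n)"
  "c \<odot>\<^bsub>ell2_space I\<^esub> v = Inr (\<lambda>n. c * projr v n)"
  "cinner (ell2_space I) u v = ell2_inner (projr u) (projr v)"
  by (simp_all add: ell2_space_def)

lemma ell2_zero [simp]: "(\<lambda>_. 0) \<in> ell2 I"
  by (simp add: ell2_def)

lemma ell2_smult [simp]: "v \<in> ell2 I \<Longrightarrow> (\<lambda>n. c * v n) \<in> ell2 I"
  by (auto simp: ell2_def norm_mult power_mult_distrib intro: summable_mult)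

lemma cmod_sq_add_le: "(cmod (x + y))\<^sup>2 \<le> 2 * (cmod x)\<^sup>2 + 2 * (cmod y)\<^sup>2"
proof -
  have "(cmod (x + y))\<^sup>2 \<le> (cmod x + cmod y)\<^sup>2"
    by (intro power_mono norm_triangle_ineq) simp
  also have "\<dots> \<le> 2 * (cmod x)\<^sup>2 + 2 * (cmod y)\<^sup>2"
    using sum_squares_bound[of "cmod x" "cmod y"] by (simp add: power2_sum)
  finally show ?thesis .
qed

lemma ell2_add [simp]:
  assumes "u \<in> ell2 I" "v \<in> ell2 I" shows "(\<lambda>n. u n + v n) \<in> ell2 I"
proof -
  have "summable (\<lambda>n. (cmod (u n + v n))\<^sup>2)"
  proof (rule summable_comparison_test')
    show "summable (\<lambda>n. 2 * (cmod (u n))\<^sup>2 + 2 * (cmod (v n))\<^sup>2)"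
      using assms by (auto simp: ell2_def intro: summable_add summable_mult)
  qed (use cmod_sq_add_le in auto)
  then show ?thesis using assms by (simp add: ell2_def)
qed

lemma ell2_uminus [simp]: "v \<in> ell2 I \<Longrightarrow> (\<lambda>n. - v n) \<in> ell2 I"
  by (simp add: ell2_def)

lemma ell2_diff [simp]:
  assumes "u \<in> ell2 I" "v \<in> ell2 I" shows "(\<lambda>n. u n - v n) \<in> ell2 I"
  using ell2_add[OF assms(1) ell2_uminus[OF assms(2)]] by simp

lemma ell2_finite_support:
  assumes "\<And>n. n \<notin> I \<Longrightarrow> v n = 0" "\<And>n. n \<ge> K \<Longrightarrow> v n = 0"
  shows "v \<in> ell2 I"
proof -
  have "summable (\<lambda>n. (cmod (v n))\<^sup>2)"
    by (rule summable_finite[of "{..<K}"]) (auto simp: assms)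
  then show ?thesis using assms by (simp add: ell2_def)
qed

lemma ell2_summable:
  assumes "u \<in> ell2 I" "v \<in> ell2 I"
  shows "summable (\<lambda>n. cnj (u n) * v n)"
proof (rule summable_comparison_test')
  show "summable (\<lambda>n. (cmod (u n))\<^sup>2 + (cmod (v n))\<^sup>2)"
    using assms by (auto simp: ell2_def intro: summable_add)
  fix n
  have "2 * (cmod (u n) * cmod (v n)) \<le> (cmod (u n))\<^sup>2 + (cmod (v n))\<^sup>2"
    using sum_squares_bound[of "cmod (u n)" "cmod (v n)"] by simp
  moreover have "0 \<le> cmod (u n) * cmod (v n)" by simp
  ultimately show "norm (cnj (u n) * v n) \<le> (cmod (u n))\<^sup>2 + (cmod (v n))\<^sup>2"
    unfolding norm_mult complex_mod_cnj by linarith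
qed

lemma ell2_inner_self:
  assumes "v \<in> ell2 I"
  shows "ell2_inner v v = complex_of_real (suminf (\<lambda>n. (cmod (v n))\<^sup>2))"
proof -
  have "(\<lambda>n. complex_of_real ((cmod (v n))\<^sup>2)) = (\<lambda>n. cnj (v n) * v n)"
    by (simp add: complex_norm_square mult.commute del: of_real_power)
  then show ?thesis
    using assms suminf_of_real[of "\<lambda>n. (cmod (v n))\<^sup>2", where 'a = complex]
    by (simp add: ell2_inner_def ell2_def)
qed

lemma ell2_inner_add:
  "\<lbrakk>u \<in> ell2 I; v \<in> ell2 I; w \<in> ell2 I\<rbrakk> \<Longrightarrow> ell2_inner u (\<lambda>n. v n + w n) = ell2_inner u v + ell2_inner u w"
  by (simp add: ell2_inner_def distrib_left suminf_add ell2_summable)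

lemma ell2_inner_smult:
  assumes "u \<in> ell2 I" "v \<in> ell2 I"
  shows "ell2_inner u (\<lambda>n. c * v n) = c * ell2_inner u v"
  using suminf_mult[OF ell2_summable[OF assms], of c]
  by (simp add: ell2_inner_def mult.left_commute)

lemma ell2_inner_commute:
  assumes "u \<in> ell2 I" "v \<in> ell2 I"
  shows "ell2_inner u v = cnj (ell2_inner v u)"
proof -
  have "(\<lambda>n. cnj (v n) * u n) sums ell2_inner v u"
    using ell2_summable[OF assms(2,1)] by (simp add: ell2_inner_def summable_sums)
  then have "(\<lambda>n. cnj (cnj (v n) * u n)) sums cnj (ell2_inner v u)"
    by (simp only: sums_cnj)
  then have "(\<lambda>n. cnj (u n) * v n) sums cnj (ell2_inner v u)"
    by (simp add: mult.commute)
  then show ?thesis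
    unfolding ell2_inner_def[of u v] by (rule sums_unique[symmetric])
qed

text \<open>
  A Cauchy sequence converges in each coordinate. The Cauchy estimate for the first \<open>K\<close> coordinates
  passes to the limit, uniformly in \<open>K\<close>, which bounds the whole distance to the coordinatewise limit.
\<close>

lemma ell2_complete:
  assumes s: "\<And>n. s n \<in> ell2 I"
    and Cauchy: "\<And>e. 0 < e \<Longrightarrow> \<exists>M. \<forall>m\<ge>M. \<forall>n\<ge>M. (suminf (\<lambda>k. (cmod (s m k - s n k))\<^sup>2)) < e"
  obtains v where "v \<in> ell2 I" "(\<lambda>n. suminf (\<lambda>k. (cmod (s n k - v k))\<^sup>2)) \<longlonglongrightarrow> 0"
proof -
  have sm: "summable (\<lambda>k. (cmod (s m k - s n k))\<^sup>2)" for m n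
    using ell2_diff[OF s s, of m n] by (simp add: ell2_def)
  have coord_Cauchy: "convergent (\<lambda>n. s n k)" for k
  proof -
    have "Cauchy (\<lambda>n. s n k)"
    proof (rule CauchyI)
      fix e :: real assume e: "0 < e"
      then obtain M where M: "\<And>m n. m \<ge> M \<Longrightarrow> n \<ge> M \<Longrightarrow> (suminf (\<lambda>k. (cmod (s m k - s n k))\<^sup>2)) < e\<^sup>2"
        using Cauchy[of "e\<^sup>2"] by auto
      have "norm (s m k - s n k) < e" if "m \<ge> M" "n \<ge> M" for m n
      proof -
        have "(\<Sum>k\<in>{k}. (cmod (s m k - s n k))\<^sup>2) \<le> (suminf (\<lambda>k. (cmod (s m k - s n k))\<^sup>2))"
          by (rule sum_le_suminf[OF sm]) auto
        then have "(cmod (s m k - s n k))\<^sup>2 < e\<^sup>2" using M[OF that] by simp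
        then show ?thesis using e by (simp add: power2_less_imp_less)
      qed
      then show "\<exists>M. \<forall>m\<ge>M. \<forall>n\<ge>M. norm (s m k - s n k) < e" by blast
    qed
    then show ?thesis by (simp add: Cauchy_convergent_iff)
  qed
  define v where "v k = lim (\<lambda>n. s n k)" for k
  have v: "(\<lambda>n. s n k) \<longlonglongrightarrow> v k" for k
    using coord_Cauchy[of k] by (simp add: v_def convergent_LIMSEQ_iff)
  have bound: "summable (\<lambda>k. (cmod (s m k - v k))\<^sup>2) \<and> (suminf (\<lambda>k. (cmod (s m k - v k))\<^sup>2)) \<le> e"
    if M: "\<forall>m\<ge>M. \<forall>n\<ge>M. (suminf (\<lambda>k. (cmod (s m k - s n k))\<^sup>2)) < e" and m: "m \<ge> M" for M m e
  proof -
    have fin: "(\<Sum>k<K. (cmod (s m k - v k))\<^sup>2) \<le> e" for K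
    proof (rule LIMSEQ_le_const2)
      show "(\<lambda>n. \<Sum>k<K. (cmod (s m k - s n k))\<^sup>2) \<longlonglongrightarrow> (\<Sum>k<K. (cmod (s m k - v k))\<^sup>2)"
        by (intro tendsto_sum tendsto_power tendsto_norm tendsto_diff tendsto_const v)
      have "(\<Sum>k<K. (cmod (s m k - s n k))\<^sup>2) \<le> e" if "n \<ge> M" for n
      proof -
        have "(\<Sum>k<K. (cmod (s m k - s n k))\<^sup>2) \<le> (suminf (\<lambda>k. (cmod (s m k - s n k))\<^sup>2))"
          by (rule sum_le_suminf[OF sm]) auto
        then show ?thesis using M m that by (meson less_imp_le order_trans)
      qed
      then show "\<exists>M. \<forall>n\<ge>M. (\<Sum>k<K. (cmod (s m k - s n k))\<^sup>2) \<le> e" by blast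
    qed
    have "summable (\<lambda>k. (cmod (s m k - v k))\<^sup>2)"
      by (rule summableI_nonneg_bounded[of _ e]) (simp_all add: fin)
    then show ?thesis using suminf_le_const[OF _ fin] by blast
  qed
  obtain M where M: "\<forall>m\<ge>M. \<forall>n\<ge>M. (suminf (\<lambda>k. (cmod (s m k - s n k))\<^sup>2)) < 1"
    using Cauchy[of 1] by auto
  have "v k = 0" if "k \<notin> I" for k
    using v[of k] s that by (simp add: ell2_def LIMSEQ_const_iff)
  moreover have "s M k = 0" if "k \<notin> I" for k
    using s that by (simp add: ell2_def)
  ultimately have "(\<lambda>k. s M k - v k) \<in> ell2 I"
    using bound[OF M, of M] by (simp add: ell2_def)
  from ell2_diff[OF s[of M] this] have "v \<in> ell2 I" by simp
  moreover have "(\<lambda>n. suminf (\<lambda>k. (cmod (s n k - v k))\<^sup>2)) \<longlonglongrightarrow> 0"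
  proof (rule LIMSEQ_I)
    fix e :: real assume "0 < e"
    then obtain M where M: "\<forall>m\<ge>M. \<forall>n\<ge>M. (suminf (\<lambda>k. (cmod (s m k - s n k))\<^sup>2)) < e / 2"
      using Cauchy[of "e / 2"] by auto
    have "norm ((suminf (\<lambda>k. (cmod (s n k - v k))\<^sup>2)) - 0) < e" if "n \<ge> M" for n
      using bound[OF M that] \<open>0 < e\<close> suminf_nonneg[of "\<lambda>k. (cmod (s n k - v k))\<^sup>2"] by simp
    then show "\<exists>M. \<forall>n\<ge>M. norm ((suminf (\<lambda>k. (cmod (s n k - v k))\<^sup>2)) - 0) < e" by blast
  qed
  ultimately show thesis by (rule that)
qed

lemma cring_complex_ring: "cring complex_ring"
proof (rule cringI)
  show "abelian_group complex_ring"
  proof (rule abelian_groupI)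
    fix x :: complex
    show "\<exists>y\<in>carrier complex_ring. y \<oplus>\<^bsub>complex_ring\<^esub> x = \<zero>\<^bsub>complex_ring\<^esub>"
      by (rule bexI[of _ "- x"]) simp_all
  qed simp_all
  show "comm_monoid complex_ring"
    by (rule comm_monoidI) simp_all
qed (simp add: distrib_right)

lemma module_ell2_space: "module complex_ring (ell2_space I)"
proof (rule moduleI)
  show "cring complex_ring" by (rule cring_complex_ring)
  show "abelian_group (ell2_space I)"
  proof (rule abelian_groupI)
    fix x assume "x \<in> carrier (ell2_space I)"
    then show "\<exists>y\<in>carrier (ell2_space I). y \<oplus>\<^bsub>ell2_space I\<^esub> x = \<zero>\<^bsub>ell2_space I\<^esub>"
      by (intro bexI[of _ "Inr (\<lambda>n. - projr x n)"]) auto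
  qed (auto simp: add.assoc add.commute)
qed (auto simp: distrib_left distrib_right mult.assoc)

lemma ell2_space_minus:
  assumes "u \<in> carrier (ell2_space I)" "v \<in> carrier (ell2_space I)"
  shows "u \<ominus>\<^bsub>ell2_space I\<^esub> v = Inr (\<lambda>n. projr u n - projr v n)"
proof -
  interpret module complex_ring "ell2_space I" by (rule module_ell2_space)
  have "Inr (\<lambda>n. - projr v n) \<in> carrier (ell2_space I)" using assms by auto
  then have "\<ominus>\<^bsub>ell2_space I\<^esub> v = Inr (\<lambda>n. - projr v n)"
    using assms by (intro M.minus_equality) auto
  then show ?thesis using assms by (simp add: M.minus_eq)
qed

lemma hnorm_ell2_space:
  "v \<in> ell2 I \<Longrightarrow> hnorm (ell2_space I) (Inr v) = sqrt (suminf (\<lambda>n. (cmod (v n))\<^sup>2))"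
  by (simp add: hnorm_def ell2_inner_self)

lemma complex_hilbert_space_ell2_space:
  "complex_hilbert_space (ell2_space I :: ('h + (nat \<Rightarrow> complex)) inner_module)"
    (is "complex_hilbert_space ?H")
proof -
  interpret module complex_ring ?H by (rule module_ell2_space)
  show ?thesis
  proof
    fix u v w :: "'h + (nat \<Rightarrow> complex)"
    assume "u \<in> carrier ?H" "v \<in> carrier ?H" "w \<in> carrier ?H"
    then obtain u' v' w' where uvw: "u = Inr u'" "u' \<in> ell2 I" "v = Inr v'" "v' \<in> ell2 I" "w = Inr w'" "w' \<in> ell2 I"
      by auto
    show "cinner ?H u (v \<oplus>\<^bsub>?H\<^esub> w) = cinner ?H u v + cinner ?H u w"
      using uvw by (simp add: ell2_inner_add[of _ I])
  next
    fix u v :: "'h + (nat \<Rightarrow> complex)" and c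
    assume "u \<in> carrier ?H" "v \<in> carrier ?H"
    then obtain u' v' where uv: "u = Inr u'" "u' \<in> ell2 I" "v = Inr v'" "v' \<in> ell2 I"
      by auto
    show "cinner ?H u (c \<odot>\<^bsub>?H\<^esub> v) = c * cinner ?H u v"
      using uv by (simp add: ell2_inner_smult[of _ I])
    show "cinner ?H u v = cnj (cinner ?H v u)"
      using uv by (simp add: ell2_inner_commute[of u' I v'])
  next
    fix v :: "'h + (nat \<Rightarrow> complex)" assume "v \<in> carrier ?H"
    then obtain v' where v: "v = Inr v'" "v' \<in> ell2 I" by auto
    then have sm: "summable (\<lambda>n. (cmod (v' n))\<^sup>2)" by (simp add: ell2_def)
    show "0 \<le> Re (cinner ?H v v)"
      using v sm by (simp add: ell2_inner_self[of _ I] suminf_nonneg)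
    assume "cinner ?H v v = 0"
    then have "(suminf (\<lambda>n. (cmod (v' n))\<^sup>2)) = 0"
      using v by (simp add: ell2_inner_self[of _ I])
    then have "v' n = 0" for n
      using suminf_eq_zero_iff[OF sm] by simp
    then show "v = \<zero>\<^bsub>?H\<^esub>" using v by auto
  next
    fix s :: "nat \<Rightarrow> 'h + (nat \<Rightarrow> complex)"
    assume s: "\<And>n. s n \<in> carrier ?H"
      and Cauchy: "\<forall>e>0. \<exists>N. \<forall>m\<ge>N. \<forall>n\<ge>N. hnorm ?H (s m \<ominus>\<^bsub>?H\<^esub> s n) < e"
    have s': "projr (s n) \<in> ell2 I" "Inr (projr (s n)) = s n" for n
      using s[of n] by auto
    have dist: "hnorm ?H (s m \<ominus>\<^bsub>?H\<^esub> Inr v) = sqrt (suminf (\<lambda>k. (cmod (projr (s m) k - v k))\<^sup>2))"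
      if "v \<in> ell2 I" for m v
      using ell2_space_minus[OF s[of m], of "Inr v"] that s'(1)[of m] by (simp add: hnorm_ell2_space)
    have c: "\<exists>M. \<forall>m\<ge>M. \<forall>n\<ge>M. (suminf (\<lambda>k. (cmod (projr (s m) k - projr (s n) k))\<^sup>2)) < e" if "0 < e" for e
    proof -
      have "0 < sqrt e" using that by simp
      with Cauchy obtain M where "\<forall>m\<ge>M. \<forall>n\<ge>M. hnorm ?H (s m \<ominus>\<^bsub>?H\<^esub> s n) < sqrt e"
        by blast
      then have "\<forall>m\<ge>M. \<forall>n\<ge>M. (suminf (\<lambda>k. (cmod (projr (s m) k - projr (s n) k))\<^sup>2)) < e"
        using dist[OF s'(1)] by (simp add: s'(2))
      then show ?thesis by blast
    qed
    obtain v where v: "v \<in> ell2 I" "(\<lambda>n. suminf (\<lambda>k. (cmod (projr (s n) k - v k))\<^sup>2)) \<longlonglongrightarrow> 0"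
      using ell2_complete[of "\<lambda>n. projr (s n)" I, OF s'(1) c] by blast
    have "(\<lambda>n. hnorm ?H (s n \<ominus>\<^bsub>?H\<^esub> Inr v)) \<longlonglongrightarrow> 0"
      using tendsto_real_sqrt[OF v(2)] by (simp add: dist[OF v(1)])
    then show "\<exists>v\<in>carrier ?H. (\<lambda>n. hnorm ?H (s n \<ominus>\<^bsub>?H\<^esub> v)) \<longlonglongrightarrow> 0"
      using v(1) by (intro bexI[of _ "Inr v"]) auto
  qed
qed

lemma ell2_Cauchy_Schwarz:
  assumes "u \<in> ell2 I" "v \<in> ell2 I"
  shows "cmod (ell2_inner u v) \<le> sqrt (suminf (\<lambda>n. (cmod (u n))\<^sup>2)) * sqrt (suminf (\<lambda>n. (cmod (v n))\<^sup>2))"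
proof -
  interpret complex_hilbert_space "ell2_space I :: (unit + (nat \<Rightarrow> complex)) inner_module"
    by (rule complex_hilbert_space_ell2_space)
  show ?thesis using Cauchy_Schwarz[of "Inr u" "Inr v"] assms by (simp add: hnorm_ell2_space)
qed

section \<open>From a trace to a perfect strategy\<close>

locale gram_schmidt = positive_functional \<phi>
  for \<phi> :: "'g ncpoly \<Rightarrow> complex" +
  fixes word :: "nat \<Rightarrow> 'g list"
  assumes surj_word: "surj word"
begin

abbreviation base :: "nat \<Rightarrow> 'g ncpoly" where
  "base n \<equiv> Poly_Mapping.single (Word (word n)) 1"

text \<open>
  The Gram-Schmidt process for the semidefinite form \<open>B\<close>, applied to the words. When a word depends on
  the previous ones modulo null vectors, its residual has seminorm 0, and \<open>1 / 0 = 0\<close> makes \<open>onb n = 0\<close>.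
  So \<open>onb n\<close> is a unit vector for \<open>n\<close> in the set \<open>I\<close> below and 0 otherwise.
\<close>

function onb :: "nat \<Rightarrow> 'g ncpoly" where
  "onb n = (let r = base n - (\<Sum>k<n. nc_smult (B (onb k) (base n)) (onb k))
     in nc_smult (complex_of_real (1 / N r)) r)"
  by auto
termination by (relation "Wellfounded.measure id") auto

declare onb.simps [simp del]

definition residual :: "nat \<Rightarrow> 'g ncpoly" where
  "residual n = base n - (\<Sum>k<n. nc_smult (B (onb k) (base n)) (onb k))"

lemma onb_residual: "onb n = nc_smult (complex_of_real (1 / N (residual n))) (residual n)"
  unfolding residual_def by (subst onb.simps) (simp only: Let_def)

definition I :: "nat set" where
  "I = {n. N (residual n) \<noteq> 0}"

lemma onb_notin: "n \<notin> I \<Longrightarrow> onb n = 0"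
  by (simp add: I_def onb_residual nc_smult_0)

lemma B_onb_self: "B (onb n) (onb n) = (if n \<in> I then 1 else 0)"
proof -
  have "B (onb n) (onb n) = complex_of_real ((1 / N (residual n))\<^sup>2) * B (residual n) (residual n)"
    by (simp add: onb_residual B_smult_left B_smult_right power2_eq_square)
  also have "\<dots> = complex_of_real ((1 / N (residual n))\<^sup>2 * (N (residual n))\<^sup>2)"
    by (simp only: B_eq_N of_real_mult)
  finally show ?thesis by (simp add: I_def power_divide)
qed

lemma B_onb_onb: "B (onb m) (onb n) = (if m = n \<and> n \<in> I then 1 else 0)"
proof -
  have below: "\<forall>m<n. B (onb m) (onb n) = 0" for n
  proof (induction n rule: less_induct)
    case (less n)
    show ?case
    proof (intro allI impI)
      fix m assume m: "m < n"
      have off: "B (onb m) (onb k) = (if k = m then B (onb m) (onb m) else 0)" if "k < n" for k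
        using less.IH[of m] less.IH[of k] m that B_commute[of "onb m" "onb k"]
        by (cases m k rule: linorder_cases) auto
      have "B (onb m) (residual n) = B (onb m) (base n)
          - (\<Sum>k<n. B (onb k) (base n) * B (onb m) (onb k))"
        by (simp add: residual_def B_diff_right B_sum_right B_smult_right)
      also have "(\<Sum>k<n. B (onb k) (base n) * B (onb m) (onb k))
          = (\<Sum>k<n. if k = m then B (onb m) (base n) * B (onb m) (onb m) else 0)"
      proof (intro sum.cong refl)
        fix k assume "k \<in> {..<n}"
        then show "B (onb k) (base n) * B (onb m) (onb k)
            = (if k = m then B (onb m) (base n) * B (onb m) (onb m) else 0)"
          using off[of k] by (cases "k = m") simp_all
      qed
      also have "\<dots> = B (onb m) (base n) * B (onb m) (onb m)"
        using m by simp
      finally have "B (onb m) (residual n) = 0"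
        using onb_notin[of m] by (cases "m \<in> I") (simp_all add: B_onb_self)
      then show "B (onb m) (onb n) = 0"
        by (simp add: onb_residual[of n] B_smult_right)
    qed
  qed
  show ?thesis
    using below[of m] below[of n] B_commute[of "onb m" "onb n"] B_onb_self[of n]
    by (cases m n rule: linorder_cases) auto
qed

definition coords :: "'g ncpoly \<Rightarrow> nat \<Rightarrow> complex" where
  "coords f k = B (onb k) f"

lemma coords_notin: "k \<notin> I \<Longrightarrow> coords f k = 0"
  by (simp add: coords_def onb_notin)

lemma coords_add: "coords (f + g) k = coords f k + coords g k"
  and coords_diff: "coords (f - g) k = coords f k - coords g k"
  and coords_smult: "coords (nc_smult c f) k = c * coords f k"
  and coords_sum: "coords (sum F A) k = (\<Sum>i\<in>A. coords (F i) k)"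
  and coords_onb: "coords (onb n) k = (if k = n \<and> n \<in> I then 1 else 0)"
  by (simp_all add: coords_def B_add_right B_diff_right B_smult_right B_sum_right B_onb_onb)

lemma coords_null: "N f = 0 \<Longrightarrow> coords f k = 0"
  by (simp add: coords_def N_eq_0_imp)

lemma N_add_null: "N f = 0 \<Longrightarrow> N g = 0 \<Longrightarrow> N (f + g) = 0"
  using N_add[of f g] N_nonneg[of "f + g"] by linarith

lemma spans: "\<exists>K c. N (f - (\<Sum>k<K. nc_smult (c k) (onb k))) = 0"
proof (induction f rule: ncpoly_induct)
  case (single w d)
  obtain n where n: "word n = w" using surj_word by (metis surjD)
  define c where "c k = (if k = n then complex_of_real (N (residual n)) else B (onb k) (base n))" for k
  have "(\<Sum>k<n. nc_smult (c k) (onb k)) = (\<Sum>k<n. nc_smult (B (onb k) (base n)) (onb k))"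
    by (intro sum.cong) (auto simp: c_def)
  then have "base n - (\<Sum>k<Suc n. nc_smult (c k) (onb k)) = residual n - nc_smult (c n) (onb n)"
    by (simp add: residual_def)
  moreover have "N (residual n - nc_smult (c n) (onb n)) = 0"
    by (cases "n \<in> I") (auto simp: I_def c_def onb_residual nc_smult_nc_smult nc_smult_1 nc_smult_0 N_def)
  ultimately have "N (nc_smult d (base n - (\<Sum>k<Suc n. nc_smult (c k) (onb k)))) = 0"
    by (simp only: N_smult)
  moreover have "nc_smult d (base n - (\<Sum>k<Suc n. nc_smult (c k) (onb k)))
      = Poly_Mapping.single (Word w) d - (\<Sum>k<Suc n. nc_smult (d * c k) (onb k))"
    by (simp add: n nc_smult_eq right_diff_distrib distrib_left sum_distrib_left mult_single mult.assoc[symmetric]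
        del: sum.lessThan_Suc)
  ultimately show ?case by (intro exI[of _ "Suc n"] exI[of _ "\<lambda>k. d * c k"]) simp
next
  case (add f g)
  then obtain K c L d where f: "N (f - (\<Sum>k<K. nc_smult (c k) (onb k))) = 0"
    and g: "N (g - (\<Sum>k<L. nc_smult (d k) (onb k))) = 0" by blast
  define e where "e k = (if k < K then c k else 0) + (if k < L then d k else 0)" for k
  have extend: "(\<Sum>k<max K L. nc_smult (if k < M then b k else 0) (onb k)) = (\<Sum>k<M. nc_smult (b k) (onb k))"
    if "M \<le> max K L" for M b
    using that by (intro sum.mono_neutral_cong_right) (auto simp: nc_smult_0)
  have "(\<Sum>k<max K L. nc_smult (e k) (onb k))
      = (\<Sum>k<max K L. nc_smult (if k < K then c k else 0) (onb k))
        + (\<Sum>k<max K L. nc_smult (if k < L then d k else 0) (onb k))"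
    unfolding sum.distrib[symmetric]
    by (intro sum.cong) (simp_all add: e_def nc_smult_eq single_add distrib_right)
  also have "\<dots> = (\<Sum>k<K. nc_smult (c k) (onb k)) + (\<Sum>k<L. nc_smult (d k) (onb k))"
    by (simp only: extend max.cobounded1 max.cobounded2)
  finally have "f + g - (\<Sum>k<max K L. nc_smult (e k) (onb k))
      = (f - (\<Sum>k<K. nc_smult (c k) (onb k))) + (g - (\<Sum>k<L. nc_smult (d k) (onb k)))"
    by (simp add: algebra_simps)
  then have "N (f + g - (\<Sum>k<max K L. nc_smult (e k) (onb k))) = 0"
    using N_add_null[OF f g] by (simp only:)
  then show ?case by blast
qed

text \<open>
  The words span, so modulo null vectors every polynomial is a finite combination of the basis; its
  coefficients must be the coordinates.
\<close>

lemma expansion: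
  obtains K where "\<And>k. k \<ge> K \<Longrightarrow> coords f k = 0"
    "N (f - (\<Sum>k<K. nc_smult (coords f k) (onb k))) = 0"
proof -
  obtain K c where Kc: "N (f - (\<Sum>k<K. nc_smult (c k) (onb k))) = 0" using spans by blast
  have "coords f k = (\<Sum>j<K. if j = k then if k \<in> I then c k else 0 else 0)" for k
  proof -
    have "coords (f - (\<Sum>k<K. nc_smult (c k) (onb k))) k = 0" by (rule coords_null[OF Kc])
    then have "coords f k = (\<Sum>j<K. c j * coords (onb j) k)"
      by (simp add: coords_diff coords_sum coords_smult)
    also have "\<dots> = (\<Sum>j<K. if j = k then if k \<in> I then c k else 0 else 0)"
      by (intro sum.cong) (auto simp: coords_onb)
    finally show ?thesis .
  qed
  then have c: "coords f k = (if k < K \<and> k \<in> I then c k else 0)" for k by simp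
  have "(\<Sum>k<K. nc_smult (c k) (onb k)) = (\<Sum>k<K. nc_smult (coords f k) (onb k))"
  proof (intro sum.cong refl)
    fix k assume "k \<in> {..<K}"
    then show "nc_smult (c k) (onb k) = nc_smult (coords f k) (onb k)"
      by (cases "k \<in> I") (simp_all add: c onb_notin nc_smult_eq)
  qed
  then show thesis using that[of K] Kc c by simp
qed

lemma coords_ell2 [simp]: "coords f \<in> ell2 I"
proof -
  obtain K where "\<And>k. k \<ge> K \<Longrightarrow> coords f k = 0" using expansion[of f] by blast
  then show ?thesis using coords_notin by (intro ell2_finite_support[of I "coords f" K])
qed

text \<open>
  The inner product of a polynomial with a sequence. As polynomials have finitely many nonzero
  coordinates, it makes sense for arbitrary sequences.
\<close>

definition pair :: "'g ncpoly \<Rightarrow> (nat \<Rightarrow> complex) \<Rightarrow> complex" where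
  "pair f v = ell2_inner (coords f) v"

lemma pair_finite:
  assumes "\<And>k. k \<ge> K \<Longrightarrow> coords f k = 0"
  shows "pair f v = (\<Sum>k<K. cnj (coords f k) * v k)"
  unfolding pair_def ell2_inner_def by (rule suminf_finite) (auto simp: assms)

lemma pair_summable: "summable (\<lambda>k. cnj (coords f k) * v k)"
proof -
  obtain K where "\<And>k. k \<ge> K \<Longrightarrow> coords f k = 0" using expansion[of f] by blast
  then show ?thesis by (intro summable_finite[of "{..<K}"]) auto
qed

lemma pair_cong: "(\<And>k. coords f k = coords g k) \<Longrightarrow> pair f v = pair g v"
  by (simp add: pair_def ell2_inner_def)

lemma pair_add: "pair (f + g) v = pair f v + pair g v"
  by (simp add: pair_def ell2_inner_def coords_add distrib_right suminf_add pair_summable)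

lemma pair_smult: "pair (nc_smult c f) v = cnj c * pair f v"
  using suminf_mult[OF pair_summable[of f v], of "cnj c"]
  by (simp add: pair_def ell2_inner_def coords_smult mult.assoc)

lemma pair_0 [simp]: "pair 0 v = 0"
  using pair_smult[of 0 0 v] by (simp add: nc_smult_0)

lemma pair_sum: "pair (sum F A) v = (\<Sum>i\<in>A. pair (F i) v)"
  by (induction A rule: infinite_finite_induct) (simp_all add: pair_add)

lemma pair_null: "N f = 0 \<Longrightarrow> pair f v = 0"
  using pair_cong[of f 0 v] by (simp add: coords_null N_def)

lemma pair_onb:
  assumes "v \<in> ell2 I" shows "pair (onb m) v = v m"
proof -
  have "pair (onb m) v = (\<Sum>k<Suc m. cnj (coords (onb m) k) * v k)"
    by (rule pair_finite) (auto simp: coords_onb)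
  also have "\<dots> = (\<Sum>k<Suc m. if k = m then if m \<in> I then v m else 0 else 0)"
    by (intro sum.cong) (auto simp: coords_onb)
  also have "\<dots> = v m" using assms by (auto simp: ell2_def)
  finally show ?thesis .
qed

lemma pair_coords: "pair f (coords g) = B f g"
proof -
  obtain K where K: "\<And>k. k \<ge> K \<Longrightarrow> coords f k = 0"
    "N (f - (\<Sum>k<K. nc_smult (coords f k) (onb k))) = 0" using expansion[of f] by blast
  have "B f g = B (\<Sum>k<K. nc_smult (coords f k) (onb k)) g"
    using N_eq_0_imp(1)[OF K(2), of g] by (simp add: B_diff_left)
  also have "\<dots> = pair f (coords g)"
    by (simp add: pair_finite[OF K(1)] B_sum_left B_smult_left) (simp add: coords_def)
  finally show ?thesis by simp
qed

lemma ell2_norm_coords: "suminf (\<lambda>k. (cmod (coords f k))\<^sup>2) = (N f)\<^sup>2"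
proof -
  have "complex_of_real (suminf (\<lambda>k. (cmod (coords f k))\<^sup>2)) = complex_of_real ((N f)\<^sup>2)"
    using ell2_inner_self[OF coords_ell2[of f]] pair_coords[of f f] by (simp only: pair_def B_eq_N)
  then show ?thesis by (simp only: of_real_eq_iff)
qed

text \<open>A linear map on polynomials that acts as an orthogonal projection modulo null vectors.\<close>

definition projection_like :: "('g ncpoly \<Rightarrow> 'g ncpoly) \<Rightarrow> bool" where
  "projection_like L \<longleftrightarrow> (\<forall>f g. L (f + g) = L f + L g) \<and> (\<forall>c f. L (nc_smult c f) = nc_smult c (L f)) \<and>
     (\<forall>f g. B (L f) g = B f (L g)) \<and> (\<forall>f g. B f (L (L g)) = B f (L g))"

text \<open>
  The extension of \<open>L\<close> to sequences. Its matrix entries are the values of \<open>B (L (onb m)) (onb n)\<close>; each row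
  is finite, so the sum defining an entry of the image is finite for every sequence \<open>v\<close>. Computations
  with \<open>lift\<close> go through the rule \<open>pair_lift\<close>.
\<close>

definition lift :: "('g ncpoly \<Rightarrow> 'g ncpoly) \<Rightarrow> (nat \<Rightarrow> complex) \<Rightarrow> nat \<Rightarrow> complex" where
  "lift L v m = pair (L (onb m)) v"

context
  fixes L assumes L: "projection_like L"
begin

lemma L_add: "L (f + g) = L f + L g" and L_smult: "L (nc_smult c f) = nc_smult c (L f)"
  and L_adj: "B (L f) g = B f (L g)" and L_idem: "B f (L (L g)) = B f (L g)"
  using L by (simp_all add: projection_like_def)

lemma L_0: "L 0 = 0"
  using L_smult[of 0 0] by (simp add: nc_smult_0)

lemma L_sum: "L (sum F A) = (\<Sum>i\<in>A. L (F i))"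
  by (induction A rule: infinite_finite_induct) (simp_all add: L_add L_0)

lemma N_L_le: "N (L f) \<le> N f"
proof -
  have "N (L f) * N (L f) = Re (B f (L f))"
    using N_sq[of "L f"] by (simp add: L_adj L_idem power2_eq_square)
  also have "\<dots> \<le> N f * N (L f)"
    using Cauchy_Schwarz[of f "L f"] complex_Re_le_cmod by (rule order_trans[rotated])
  finally show ?thesis using N_nonneg[of "L f"] by (auto simp: mult_le_cancel_right less_le)
qed

lemma pair_lift: "pair f (lift L v) = pair (L f) v"
proof -
  obtain K where K: "\<And>k. k \<ge> K \<Longrightarrow> coords f k = 0"
    "N (f - (\<Sum>k<K. nc_smult (coords f k) (onb k))) = 0" using expansion[of f] by blast
  let ?g = "\<Sum>k<K. nc_smult (coords f k) (onb k)"
  have "N (L (f - ?g)) = 0" using N_L_le[of "f - ?g"] K(2) N_nonneg[of "L (f - ?g)"] by linarith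
  then have "pair (L (f - ?g)) v = 0" by (rule pair_null)
  moreover have "pair (L (f - ?g)) v + pair (L ?g) v = pair (L f) v"
    by (simp flip: pair_add L_add)
  ultimately have "pair (L f) v = pair (L ?g) v" by simp
  also have "\<dots> = (\<Sum>k<K. cnj (coords f k) * lift L v k)"
    by (simp add: L_sum L_smult pair_sum pair_smult lift_def)
  also have "\<dots> = pair f (lift L v)" by (rule pair_finite[OF K(1), symmetric])
  finally show ?thesis by simp
qed

text \<open>
  The polynomial \<open>g\<close> whose coordinates are the truncated image sequence satisfies \<open>S = pair (L g) v\<close>, where \<open>S\<close> is the partial sum to
  be estimated. Cauchy-Schwarz and the contractivity of \<open>L\<close> give \<open>S \<le> sqrt S * \<parallel>v\<parallel>\<close>.
\<close>

lemma lift_partial_sum: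
  assumes v: "v \<in> ell2 I"
  shows "(\<Sum>m<M. (cmod (lift L v m))\<^sup>2) \<le> suminf (\<lambda>n. (cmod (v n))\<^sup>2)"
proof -
  define S where "S = (\<Sum>m<M. (cmod (lift L v m))\<^sup>2)"
  define g where "g = (\<Sum>m<M. nc_smult (lift L v m) (onb m))"
  have S_nonneg: "0 \<le> S" by (simp add: S_def sum_nonneg)
  have "pair (L g) v = (\<Sum>m<M. cnj (lift L v m) * lift L v m)"
    by (simp add: g_def L_sum L_smult pair_sum pair_smult) (simp add: lift_def)
  also have "\<dots> = complex_of_real S"
    by (simp add: S_def complex_norm_square mult.commute del: of_real_power)
  finally have pair_S: "pair (L g) v = complex_of_real S" .
  have onb_g: "B (onb m) g = (if m \<in> I then lift L v m else 0)" if "m < M" for m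
  proof -
    have "B (onb m) g = (\<Sum>n<M. if n = m then if m \<in> I then lift L v m else 0 else 0)"
      unfolding g_def B_sum_right B_smult_right by (intro sum.cong) (auto simp: B_onb_onb)
    then show ?thesis using that by simp
  qed
  have "B g g = (\<Sum>m<M. cnj (lift L v m) * B (onb m) g)"
    by (subst (1) g_def) (simp only: B_sum_left B_smult_left)
  also have "\<dots> = (\<Sum>m<M. complex_of_real (if m \<in> I then (cmod (lift L v m))\<^sup>2 else 0))"
    by (intro sum.cong refl) (simp add: onb_g complex_norm_square mult.commute del: of_real_power)
  also have "\<dots> = complex_of_real (\<Sum>m<M. if m \<in> I then (cmod (lift L v m))\<^sup>2 else 0)"
    by (simp only: of_real_sum)
  finally have "(N g)\<^sup>2 = (\<Sum>m<M. if m \<in> I then (cmod (lift L v m))\<^sup>2 else 0)"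
    unfolding N_sq by (simp only: Re_complex_of_real)
  also have "\<dots> \<le> S" unfolding S_def by (intro sum_mono) simp
  finally have "N g \<le> sqrt S" by (simp add: real_le_rsqrt)
  have "S = cmod (pair (L g) v)" using S_nonneg by (simp add: pair_S)
  also have "\<dots> \<le> N (L g) * sqrt (suminf (\<lambda>n. (cmod (v n))\<^sup>2))"
    using ell2_Cauchy_Schwarz[OF coords_ell2 v, of "L g"] by (simp add: pair_def ell2_norm_coords)
  also have "\<dots> \<le> sqrt S * sqrt (suminf (\<lambda>n. (cmod (v n))\<^sup>2))"
    using N_L_le[of g] \<open>N g \<le> sqrt S\<close> v
    by (intro mult_right_mono) (auto simp: ell2_def intro: suminf_nonneg)
  finally have le: "sqrt S * sqrt S \<le> sqrt S * sqrt (suminf (\<lambda>n. (cmod (v n))\<^sup>2))"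
    using S_nonneg by simp
  have "S \<le> suminf (\<lambda>n. (cmod (v n))\<^sup>2)"
  proof (cases "S = 0")
    case True
    then show ?thesis using v by (auto simp: ell2_def intro: suminf_nonneg)
  next
    case False
    then have "0 < sqrt S" using S_nonneg by simp
    with le have "sqrt S \<le> sqrt (suminf (\<lambda>n. (cmod (v n))\<^sup>2))" by (rule mult_left_le_imp_le)
    then show ?thesis by simp
  qed
  then show ?thesis by (simp add: S_def)
qed

lemma lift_ell2:
  assumes v: "v \<in> ell2 I"
  shows "lift L v \<in> ell2 I" "suminf (\<lambda>m. (cmod (lift L v m))\<^sup>2) \<le> suminf (\<lambda>n. (cmod (v n))\<^sup>2)"
proof -
  have sm: "summable (\<lambda>m. (cmod (lift L v m))\<^sup>2)"
    by (rule summableI_nonneg_bounded[OF _ lift_partial_sum[OF v]]) simp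
  then show "suminf (\<lambda>m. (cmod (lift L v m))\<^sup>2) \<le> suminf (\<lambda>n. (cmod (v n))\<^sup>2)"
    by (rule suminf_le_const[OF _ lift_partial_sum[OF v]])
  show "lift L v \<in> ell2 I"
    using sm by (simp add: ell2_def lift_def onb_notin L_0)
qed

lemma lift_coords: "lift L (coords f) = coords (L f)"
  by (rule ext) (simp add: lift_def pair_coords L_adj coords_def)

lemma lift_diff:
  "lift L (\<lambda>n. u n - v n) m = lift L u m - lift L v m"
  by (simp add: lift_def pair_def ell2_inner_def right_diff_distrib
      suminf_diff pair_summable)

text \<open>
  Approximate \<open>v\<close> by its truncations, which are the coordinates of polynomials \<open>g M\<close>. For them the identity
  is algebraic: the inner product of \<open>u\<close> with \<open>coords (L (g M))\<close> is a partial sum of the series for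
  \<open>ell2_inner (lift L u) v\<close>. The limit is justified since \<open>lift L\<close> is a contraction.
\<close>

lemma lift_adj:
  assumes u: "u \<in> ell2 I" and v: "v \<in> ell2 I"
  shows "ell2_inner (lift L u) v = ell2_inner u (lift L v)"
proof -
  define g where "g M = (\<Sum>m<M. nc_smult (v m) (onb m))" for M
  have coords_g: "coords (g M) = (\<lambda>k. if k < M then v k else 0)" for M
  proof
    fix k
    have "coords (g M) k = (\<Sum>m<M. if m = k then if k \<in> I then v k else 0 else 0)"
      unfolding g_def coords_sum coords_smult by (intro sum.cong) (auto simp: coords_onb)
    also have "\<dots> = (if k < M then v k else 0)" using v by (auto simp: ell2_def)
    finally show "coords (g M) k = (if k < M then v k else 0)" .
  qed
  have smv: "summable (\<lambda>k. (cmod (v k))\<^sup>2)" using v by (simp add: ell2_def)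
  have tail: "suminf (\<lambda>k. (cmod (v k - coords (g M) k))\<^sup>2) = suminf (\<lambda>k. (cmod (v k))\<^sup>2) - (\<Sum>k<M. (cmod (v k))\<^sup>2)" for M
  proof -
    have eq: "(\<lambda>k. (cmod (v k - coords (g M) k))\<^sup>2) = (\<lambda>k. (cmod (v k))\<^sup>2 - (if k \<in> {..<M} then (cmod (v k))\<^sup>2 else 0))"
      by (auto simp: coords_g)
    have "(\<lambda>k. if k \<in> {..<M} then (cmod (v k))\<^sup>2 else 0) sums (\<Sum>k<M. (cmod (v k))\<^sup>2)"
      by (rule sums_If_finite_set) simp
    then show ?thesis
      unfolding eq by (intro sums_unique[symmetric] sums_diff summable_sums[OF smv])
  qed
  have tail_0: "(\<lambda>M. sqrt (suminf (\<lambda>k. (cmod (v k - coords (g M) k))\<^sup>2))) \<longlonglongrightarrow> 0"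
    using tendsto_real_sqrt[OF tendsto_diff[OF tendsto_const summable_LIMSEQ[OF smv]], of "suminf (\<lambda>k. (cmod (v k))\<^sup>2)"]
    by (simp add: tail)
  have "(\<lambda>M. \<Sum>m<M. cnj (lift L u m) * v m) \<longlonglongrightarrow> ell2_inner (lift L u) v"
    unfolding ell2_inner_def by (rule summable_LIMSEQ[OF ell2_summable[OF lift_ell2(1)[OF u] v]])
  moreover have "(\<Sum>m<M. cnj (lift L u m) * v m) = ell2_inner u (lift L (coords (g M)))" for M
  proof -
    have "(\<Sum>m<M. cnj (lift L u m) * v m) = cnj (pair (L (g M)) u)"
      by (simp add: g_def L_sum L_smult pair_sum pair_smult lift_def mult.commute)
    also have "\<dots> = ell2_inner u (coords (L (g M)))"
      using ell2_inner_commute[OF u coords_ell2[of "L (g M)"]] by (simp add: pair_def)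
    finally show ?thesis by (simp add: lift_coords)
  qed
  ultimately have lim1: "(\<lambda>M. ell2_inner u (lift L (coords (g M)))) \<longlonglongrightarrow> ell2_inner (lift L u) v" by simp
  have "norm (ell2_inner u (lift L v) - ell2_inner u (lift L (coords (g M))))
      \<le> norm (sqrt (suminf (\<lambda>k. (cmod (v k - coords (g M) k))\<^sup>2))) * sqrt (suminf (\<lambda>k. (cmod (u k))\<^sup>2))" for M
  proof -
    let ?d = "\<lambda>n. v n - coords (g M) n"
    have d: "?d \<in> ell2 I" by (simp add: v)
    have "ell2_inner u (lift L v) - ell2_inner u (lift L (coords (g M))) = ell2_inner u (lift L ?d)"
    proof -
      have "lift L v = (\<lambda>n. lift L ?d n + lift L (coords (g M)) n)"
        using lift_diff[of v "coords (g M)"] by auto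
      then show ?thesis
        using ell2_inner_add[OF u lift_ell2(1)[OF d] lift_ell2(1)[OF coords_ell2], of "g M"] by simp
    qed
    also have "norm \<dots> \<le> sqrt (suminf (\<lambda>k. (cmod (u k))\<^sup>2)) * sqrt (suminf (\<lambda>k. (cmod (lift L ?d k))\<^sup>2))"
      by (rule ell2_Cauchy_Schwarz[OF u lift_ell2(1)[OF d]])
    also have "\<dots> \<le> sqrt (suminf (\<lambda>k. (cmod (u k))\<^sup>2)) * sqrt (suminf (\<lambda>k. (cmod (?d k))\<^sup>2))"
      using u by (intro mult_left_mono real_sqrt_le_mono lift_ell2(2)[OF d] real_sqrt_ge_zero suminf_nonneg)
        (auto simp: ell2_def)
    finally show ?thesis
      using d by (simp add: mult.commute ell2_def suminf_nonneg)
  qed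
  then have "(\<lambda>M. ell2_inner u (lift L v) - ell2_inner u (lift L (coords (g M)))) \<longlonglongrightarrow> 0"
    by (intro tendsto_0_le[OF tail_0, of _ "sqrt (suminf (\<lambda>k. (cmod (u k))\<^sup>2))"]) simp
  then have "(\<lambda>M. ell2_inner u (lift L (coords (g M)))) \<longlonglongrightarrow> ell2_inner u (lift L v)"
    using tendsto_diff[OF tendsto_const[of "ell2_inner u (lift L v)"]] by fastforce
  then show ?thesis using LIMSEQ_unique[OF lim1] by simp
qed

lemma lift_idem: "lift L (lift L v) = lift L v"
proof
  fix m
  have "lift L (lift L v) m = pair (L (L (onb m))) v" by (simp add: lift_def[of L "lift L v"] pair_lift)
  also have "\<dots> = lift L v m"
    unfolding lift_def by (rule pair_cong) (simp add: coords_def L_idem)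
  finally show "lift L (lift L v) m = lift L v m" .
qed

lemma projection_lift: "projection (ell2_space I) (\<lambda>v. Inr (lift L (projr v)))"
proof -
  interpret complex_hilbert_space "ell2_space I" by (rule complex_hilbert_space_ell2_space)
  show ?thesis
    by (rule projectionI) (auto simp: self_adjoint_def lift_ell2 lift_adj lift_idem)
qed

end

lemma PVM_lift:
  fixes L :: "'i::finite \<Rightarrow> 'g ncpoly \<Rightarrow> 'g ncpoly"
  assumes L: "\<And>i. projection_like (L i)" and sum: "\<And>f g. B f (\<Sum>i\<in>UNIV. L i g) = B f g"
  shows "PVM (ell2_space I :: ('h + (nat \<Rightarrow> complex)) inner_module) (\<lambda>i v. Inr (lift (L i) (projr v)))"
    (is "PVM ?H _")
  unfolding PVM_def
proof (intro conjI allI ballI)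
  interpret complex_hilbert_space ?H by (rule complex_hilbert_space_ell2_space)
  show "projection ?H (\<lambda>v. Inr (lift (L i) (projr v)))" for i
    by (rule projection_lift[OF L])
  fix v assume "v \<in> carrier ?H"
  then obtain w where w: "v = Inr w" "w \<in> ell2 I" by auto
  have "(\<Oplus>\<^bsub>?H\<^esub>i\<in>A. Inr (lift (L i) w)) = Inr (\<lambda>m. \<Sum>i\<in>A. lift (L i) w m)" if "finite A" for A
    using that
  proof (induction A rule: finite_induct)
    case (insert i A)
    then show ?case
      using lift_ell2(1)[OF L w(2)] by (subst M.finsum_insert) auto
  qed simp
  moreover have "(\<Sum>i\<in>UNIV. lift (L i) w m) = w m" for m
  proof -
    have "(\<Sum>i\<in>UNIV. lift (L i) w m) = pair (\<Sum>i\<in>UNIV. L i (onb m)) w"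
      by (simp add: lift_def pair_sum)
    also have "\<dots> = pair (onb m) w"
      by (rule pair_cong) (simp add: coords_def sum)
    finally show ?thesis by (simp add: pair_onb[OF w(2)])
  qed
  ultimately show "(\<Oplus>\<^bsub>?H\<^esub>i\<in>UNIV. Inr (lift (L i) (projr v))) = v"
    by (simp add: w)
qed

end

instance generator :: (countable, countable, countable, countable) countable
  by countable_datatype

text \<open>
  Left multiplications commute with right multiplications by associativity, and right multiplication by
  a self-adjoint element is symmetric because \<open>\<phi>\<close> is a trace. The resulting correlation is
  \<open>\<phi> (p_{x,a} q_{y,b})\<close>.
\<close>

theorem perfect_qc_strategy_if_game_trace:
  fixes lam :: "'x::finite \<Rightarrow> 'y::finite \<Rightarrow> 'a::finite \<Rightarrow> 'b::finite \<Rightarrow> bool"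
  assumes "game_trace lam \<phi>"
  shows "perfect_qc_strategies TYPE('h + (nat \<Rightarrow> complex)) lam \<noteq> {}"
proof -
  interpret game_trace lam \<phi> by fact
  interpret gram_schmidt \<phi> "from_nat :: nat \<Rightarrow> ('x, 'y, 'a, 'b) generator list"
    by unfold_locales (rule surj_from_nat)
  let ?H = "ell2_space I :: ('h + (nat \<Rightarrow> complex)) inner_module"
  interpret H: complex_hilbert_space ?H by (rule complex_hilbert_space_ell2_space)
  define l where "l g f = gen g * f" for g :: "('x, 'y, 'a, 'b) generator" and f
  define r where "r g f = f * gen g" for g :: "('x, 'y, 'a, 'b) generator" and f
  have rel: "\<phi> (f * r * g) = 0" if "r \<in> game_relations lam" for r f g
    by (rule phi_relation_mid[OF that])
  have B_r: "B (f * g) h = B f (h * nc_star g)" for f g h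
    using phi_trace[of "nc_star g" "nc_star f * h"] by (simp add: B_def nc_star_mult mult.assoc)
  have idem: "gen g * gen g - gen g \<in> game_relations lam" for g :: "('x, 'y, 'a, 'b) generator"
    by (simp add: game_relations_def)
  have l: "projection_like (l g)" for g
    unfolding projection_like_def
    by (simp add: l_def distrib_left nc_smult_mult_right B_mult_left nc_star_gen gen_idem)
  have r: "projection_like (r g)" for g
  proof -
    have "B f (h * gen g * gen g) = B f (h * gen g)" for f h
      using rel[OF idem[of g], of "nc_star f * h" 1]
      by (simp add: B_def right_diff_distrib phi_diff mult.assoc)
    then show ?thesis
      unfolding projection_like_def
      by (simp add: r_def distrib_right nc_smult_mult_left B_r nc_star_gen)
  qed
  define P where "P x a v = (Inr (lift (l (GenP x a)) (projr v)) :: 'h + (nat \<Rightarrow> complex))" for x a and v :: "'h + (nat \<Rightarrow> complex)"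
  define Q where "Q y b v = (Inr (lift (r (GenQ y b)) (projr v)) :: 'h + (nat \<Rightarrow> complex))" for y b and v :: "'h + (nat \<Rightarrow> complex)"
  define \<xi> where "\<xi> = (Inr (coords 1) :: 'h + (nat \<Rightarrow> complex))"
  define p where "p a b x y = Re (\<phi> (polyP x a * polyQ y b))" for a b x y
  have "PVM ?H (P x)" for x
    unfolding P_def
  proof (rule PVM_lift[OF l])
    fix f g
    have "\<phi> (nc_star f * ((\<Sum>a\<in>UNIV. polyP x a) - 1) * g) = 0"
      by (rule rel) (simp add: game_relations_def)
    then show "B f (\<Sum>a\<in>UNIV. l (GenP x a) g) = B f g"
      by (simp add: B_def l_def left_diff_distrib right_diff_distrib phi_diff sum_distrib_right mult.assoc)
  qed
  moreover have "PVM ?H (Q y)" for y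
    unfolding Q_def
  proof (rule PVM_lift[OF r])
    fix f g
    have "\<phi> (nc_star f * g * ((\<Sum>b\<in>UNIV. polyQ y b) - 1) * 1) = 0"
      by (rule rel) (simp add: game_relations_def)
    then show "B f (\<Sum>b\<in>UNIV. r (GenQ y b) g) = B f g"
      by (simp add: B_def r_def right_diff_distrib phi_diff sum_distrib_left mult.assoc)
  qed
  moreover have "P x a (Q y b v) = Q y b (P x a v)" for x y a b v
  proof -
    have "lift (l g) (lift (r h) w) m = lift (r h) (lift (l g) w) m" for g h w m
      by (simp add: lift_def[of "l g" "lift (r h) w"] lift_def[of "r h" "lift (l g) w"]
          pair_lift[OF l] pair_lift[OF r]) (simp add: l_def r_def mult.assoc)
    then have "lift (l g) (lift (r h) w) = lift (r h) (lift (l g) w)" for g h w by (rule ext)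
    then show ?thesis by (simp add: P_def Q_def)
  qed
  moreover have "complex_of_real (p a b x y) = cinner ?H \<xi> (P x a (Q y b \<xi>))" for a b x y
  proof -
    let ?p = "polyP x a" and ?q = "polyQ y b"
    have "cinner ?H \<xi> (P x a (Q y b \<xi>)) = B 1 (?p * ?q)"
      by (simp add: \<xi>_def P_def Q_def lift_coords[OF l] lift_coords[OF r] pair_def[symmetric] pair_coords)
        (simp add: l_def r_def)
    \<comment> \<open>the correlation is real, since \<open>\<phi>\<close> takes the same value at \<open>pq\<close> and at its adjoint \<open>qp\<close>\<close>
    moreover have "B 1 (?p * ?q) = cnj (B 1 (?p * ?q))"
    proof -
      have "cnj (B 1 (?p * ?q)) = B (?p * ?q) 1" by (rule B_commute[symmetric])
      also have "\<dots> = \<phi> (?q * ?p)" by (simp add: B_def nc_star_mult nc_star_gen)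
      also have "\<dots> = B 1 (?p * ?q)" by (simp add: B_def phi_trace[of ?q])
      finally show ?thesis by simp
    qed
    ultimately show ?thesis
      by (simp add: p_def B_def complex_eq_iff)
  qed
  moreover have "hnorm ?H \<xi> = 1"
    by (simp add: \<xi>_def hnorm_ell2_space ell2_norm_coords) (simp add: N_def B_def phi_one)
  moreover have "\<xi> \<in> carrier ?H" by (simp add: \<xi>_def)
  ultimately have "p \<in> qc_correlations TYPE('h + (nat \<Rightarrow> complex))"
    unfolding qc_correlations_def using H.complex_hilbert_space_axioms by blast
  moreover have "p a b x y = 0" if "\<not> lam x y a b" for x y a b
  proof -
    have "polyP x a * polyQ y b \<in> game_relations lam" using that by (auto simp: game_relations_def)
    from rel[OF this, of 1 1] show ?thesis by (simp add: p_def)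
  qed
  ultimately have "p \<in> perfect_qc_strategies TYPE('h + (nat \<Rightarrow> complex)) lam"
    by (simp add: perfect_qc_strategies_def)
  then show ?thesis by blast
qed

theorem corollary5p2:
  fixes lam :: "'x::finite \<Rightarrow> 'y::finite \<Rightarrow> 'a::finite \<Rightarrow> 'b::finite \<Rightarrow> bool"
  assumes "imitation_game lam"
  shows "perfect_qc_strategies TYPE('h + (nat \<Rightarrow> complex)) lam \<noteq> {} \<longleftrightarrow>
    carrier (game_cstar_algebra lam) \<noteq> {\<zero>\<^bsub>game_cstar_algebra lam\<^esub>} \<and>
    (\<exists>\<tau>. tracial_state (game_cstar_algebra lam) \<tau>)"
proof -
  have "perfect_qc_strategies TYPE('h + (nat \<Rightarrow> complex)) lam \<noteq> {} \<longleftrightarrow> (\<exists>\<phi>. game_trace lam \<phi>)"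
    using game_trace_if_perfect_qc_strategy[OF assms] perfect_qc_strategy_if_game_trace by blast
  then show ?thesis
    using tracial_state_iff_game_trace[of lam] carrier_nonzero_if_tracial_state[of lam] by blast
qed

end
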